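(* If $\mathcal{G}$ is stable and abelian, and $\mu \in \mathfrak{M}_x(\mathcal{G})$ is idempotent, then $S(\mu)$ (with the operation $*$ and the subspace topology from $S_x(\mathcal{G})$) is an abelian compact Hausdorff topological group.
   Context: Setting: $T$ is a first-order theory in a language $\mathcal{L}$ expanding a group, $\mathcal{G}$ is a sufficiently saturated (monster) model of $T$ ("$\mathcal{G}$ is stable" means $T$ is stable), and "small" means small relative to the saturation of $\mathcal{G}$. The variable $x$ (and $y$ in convolutions) is a singleton variable of the sort on which the group is defined. Keisler measures: for $A\subseteq\mathcal{G}$, $\mathcal{L}_x(A)$ is the Boolean algebra of formulas in $x$ with parameters from $A$ (up to equivalence), $S_x(A)$ is the space of types over $A$, and $\mathfrak{M}_x(A)$ is the set of Keisler measures over $A$, i.e. finitely additive probability measures on $\mathcal{L}_x(A)$; each is identified with the corresponding regular Borel probability measure on $S_x(A)$. $\mu|_A$ denotes restriction. The support of $\mu\in\mathfrak{M}_x(A)$ is $S(\mu)=\{p\in S_x(A):\mu(\varphi(x))>0 \text{ for all }\varphi(x)\in p\}$. Convolution: for $\mu,\nu\in\mathfrak{M}_x(\mathcal{G})$ let $\nu_y$ be $\nu$ viewed as a measure in the variable $y$. The pair $(\mu,\nu)$ is $*$-Borel if for every $\varphi(x,\bar c)\in\mathcal{L}_x(\mathcal{G})$ there is a small $N\prec\mathcal{G}$ containing $\bar c$ such that for every $q\in S(\nu_y|_N)$ the value $F(q):=\mu(\varphi(x\cdot d,\bar c))$ is the same for all $d\models q$ in $\mathcal{G}$, and $F:S(\nu_y|_N)\to[0,1]$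 is Borel. Then $(\mu*\nu)(\varphi(x,\bar c)):=\int_{S(\nu_y|_N)}F\,d\nu_N$, where $\nu_N$ is the Borel measure $\nu_y|_N$ restricted to its support (this does not depend on $N$). $\mu$ is idempotent if $(\mu,\mu)$ is $*$-Borel and $\mu*\mu=\mu$. Product of types: if $p,q\in S_x(\mathcal{G})$ are invariant over a small model $M$ (in a stable theory every global type is invariant over some small model), then $p*q:=\mathrm{tp}(a\cdot b/\mathcal{G})$, where (in a larger monster model) $b\models q$ and $a$ realizes the restriction to $\mathcal{G}b$ of the unique $M$-invariant extension of $p$. *)

theory Defs
  imports "HOL-Analysis.Analysis" "HOL-Probability.Probability_Measure" "HOL-Algebra.Group"
begin

unbundle cardinal_syntax

section \<open>Many-sorted first-order logic with parameters\<close>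

record ('s, 'f, 'r) lang =
  sorts :: "'s set"
  funs :: "'f set"
  rels :: "'r set"
  fdom :: "'f \<Rightarrow> 's list"
  fcod :: "'f \<Rightarrow> 's"
  rdom :: "'r \<Rightarrow> 's list"

definition wf_lang :: "('s, 'f, 'r) lang \<Rightarrow> bool" where
  "wf_lang L \<longleftrightarrow>
     (\<forall>f \<in> funs L. set (fdom L f) \<subseteq> sorts L \<and> fcod L f \<in> sorts L) \<and>
     (\<forall>r \<in> rels L. set (rdom L r) \<subseteq> sorts L)"

text \<open>Variables are pairs (sort, index); a parameter is a pair (sort, element), so that the
  carriers of different sorts need not be disjoint.\<close>

type_synonym 's var = "'s \<times> nat"
type_synonym ('s, 'a) param = "'s \<times> 'a"

datatype (tm_vars: 'v, tm_funs: 'f, tm_pars: 'c) tm =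
  Var 'v | Par 'c | Fn 'f "('v, 'f, 'c) tm list"

datatype (fm_vars: 'v, fm_funs: 'f, fm_rels: 'r, pars: 'c) fm =
  Falsum
| Eq "('v, 'f, 'c) tm" "('v, 'f, 'c) tm"
| Rel 'r "('v, 'f, 'c) tm list"
| Imp "('v, 'f, 'r, 'c) fm" "('v, 'f, 'r, 'c) fm"
| All 'v "('v, 'f, 'r, 'c) fm"

type_synonym ('s, 'f, 'a) term' = "('s var, 'f, ('s, 'a) param) tm"
type_synonym ('s, 'f, 'r, 'a) form = "('s var, 'f, 'r, ('s, 'a) param) fm"

abbreviation Neg :: "('v, 'f, 'r, 'c) fm \<Rightarrow> ('v, 'f, 'r, 'c) fm" where
  "Neg \<phi> \<equiv> Imp \<phi> Falsum"

abbreviation Disj :: "('v, 'f, 'r, 'c) fm \<Rightarrow> ('v, 'f, 'r, 'c) fm \<Rightarrow> ('v, 'f, 'r, 'c) fm" where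
  "Disj \<phi> \<psi> \<equiv> Imp (Neg \<phi>) \<psi>"

fun sort_of :: "('s, 'f, 'r) lang \<Rightarrow> ('s, 'f, 'a) term' \<Rightarrow> 's" where
  "sort_of L (Var v) = fst v"
| "sort_of L (Par c) = fst c"
| "sort_of L (Fn f ts) = fcod L f"

fun wf_tm :: "('s, 'f, 'r) lang \<Rightarrow> ('s, 'f, 'a) term' \<Rightarrow> bool" where
  "wf_tm L (Var v) \<longleftrightarrow> fst v \<in> sorts L"
| "wf_tm L (Par c) \<longleftrightarrow> fst c \<in> sorts L"
| "wf_tm L (Fn f ts) \<longleftrightarrow> f \<in> funs L \<and> map (sort_of L) ts = fdom L f \<and> (\<forall>t \<in> set ts. wf_tm L t)"

fun wf_fm :: "('s, 'f, 'r) lang \<Rightarrow> ('s, 'f, 'r, 'a) form \<Rightarrow> bool" where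
  "wf_fm L Falsum \<longleftrightarrow> True"
| "wf_fm L (Eq t u) \<longleftrightarrow> wf_tm L t \<and> wf_tm L u \<and> sort_of L t = sort_of L u"
| "wf_fm L (Rel r ts) \<longleftrightarrow> r \<in> rels L \<and> map (sort_of L) ts = rdom L r \<and> (\<forall>t \<in> set ts. wf_tm L t)"
| "wf_fm L (Imp \<phi> \<psi>) \<longleftrightarrow> wf_fm L \<phi> \<and> wf_fm L \<psi>"
| "wf_fm L (All v \<phi>) \<longleftrightarrow> fst v \<in> sorts L \<and> wf_fm L \<phi>"

fun fv :: "('v, 'f, 'r, 'c) fm \<Rightarrow> 'v set" where
  "fv Falsum = {}"
| "fv (Eq t u) = tm_vars t \<union> tm_vars u"
| "fv (Rel r ts) = (\<Union>t \<in> set ts. tm_vars t)"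
| "fv (Imp \<phi> \<psi>) = fv \<phi> \<union> fv \<psi>"
| "fv (All v \<phi>) = fv \<phi> - {v}"

fun subst_tm :: "('v \<Rightarrow> ('v, 'f, 'c) tm) \<Rightarrow> ('v, 'f, 'c) tm \<Rightarrow> ('v, 'f, 'c) tm" where
  "subst_tm \<sigma> (Var v) = \<sigma> v"
| "subst_tm \<sigma> (Par c) = Par c"
| "subst_tm \<sigma> (Fn f ts) = Fn f (map (subst_tm \<sigma>) ts)"

text \<open>Bound variables are not renamed.  This is only used for substitutions in which a variable
  other than \<open>v\<close> never occurs in \<open>\<sigma> v\<close>, so that no capture is possible.\<close>

fun subst :: "('v \<Rightarrow> ('v, 'f, 'c) tm) \<Rightarrow> ('v, 'f, 'r, 'c) fm \<Rightarrow> ('v, 'f, 'r, 'c) fm" where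
  "subst \<sigma> Falsum = Falsum"
| "subst \<sigma> (Eq t u) = Eq (subst_tm \<sigma> t) (subst_tm \<sigma> u)"
| "subst \<sigma> (Rel r ts) = Rel r (map (subst_tm \<sigma>) ts)"
| "subst \<sigma> (Imp \<phi> \<psi>) = Imp (subst \<sigma> \<phi>) (subst \<sigma> \<psi>)"
| "subst \<sigma> (All v \<phi>) = All v (subst (\<sigma>(v := Var v)) \<phi>)"

text \<open>\<open>fmls L V A\<close> is the set of formulas with free variables in \<open>V\<close> and parameters in \<open>A\<close>;
  in particular \<open>fmls L {x} A\<close> is the set of formulas underlying the Boolean algebra
  of \<open>x\<close>-formulas over \<open>A\<close>.\<close>

definition fmls :: "('s, 'f, 'r) lang \<Rightarrow> 's var set \<Rightarrow> ('s, 'a) param set \<Rightarrow> ('s, 'f, 'r, 'a) form set"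
  where "fmls L V A = {\<phi>. wf_fm L \<phi> \<and> fv \<phi> \<subseteq> V \<and> pars \<phi> \<subseteq> A}"

text \<open>The instance \<open>\<phi>(x, c)\<close> of a formula: every free variable other than \<open>x\<close> is replaced
  by the corresponding entry of \<open>c\<close>.\<close>

definition inst :: "'s var \<Rightarrow> ('s var \<Rightarrow> 'a) \<Rightarrow> ('s, 'f, 'r, 'a) form \<Rightarrow> ('s, 'f, 'r, 'a) form" where
  "inst x c \<phi> = subst (\<lambda>v. if v = x then Var x else Par (fst v, c v)) \<phi>"


section \<open>Structures, theories and stability\<close>

record ('s, 'f, 'r, 'a) fo_struct =
  univ :: "'s \<Rightarrow> 'a set"
  fint :: "'f \<Rightarrow> 'a list \<Rightarrow> 'a"
  rint :: "'r \<Rightarrow> 'a list \<Rightarrow> bool"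

definition is_struct :: "('s, 'f, 'r) lang \<Rightarrow> ('s, 'f, 'r, 'a) fo_struct \<Rightarrow> bool" where
  "is_struct L M \<longleftrightarrow>
     (\<forall>s \<in> sorts L. univ M s \<noteq> {}) \<and>
     (\<forall>f \<in> funs L. \<forall>as. list_all2 (\<lambda>a s. a \<in> univ M s) as (fdom L f) \<longrightarrow>
        fint M f as \<in> univ M (fcod L f))"

definition elems :: "('s, 'f, 'r) lang \<Rightarrow> ('s, 'f, 'r, 'a) fo_struct \<Rightarrow> ('s, 'a) param set" where
  "elems L M = Sigma (sorts L) (univ M)"

definition assign :: "('s, 'f, 'r) lang \<Rightarrow> ('s, 'f, 'r, 'a) fo_struct \<Rightarrow> ('s var \<Rightarrow> 'a) set" where
  "assign L M = {e. \<forall>v. fst v \<in> sorts L \<longrightarrow> e v \<in> univ M (fst v)}"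

fun eval :: "('s, 'f, 'r, 'a) fo_struct \<Rightarrow> ('s var \<Rightarrow> 'a) \<Rightarrow> ('s, 'f, 'a) term' \<Rightarrow> 'a" where
  "eval M e (Var v) = e v"
| "eval M e (Par c) = snd c"
| "eval M e (Fn f ts) = fint M f (map (eval M e) ts)"

fun sat :: "('s, 'f, 'r, 'a) fo_struct \<Rightarrow> ('s var \<Rightarrow> 'a) \<Rightarrow> ('s, 'f, 'r, 'a) form \<Rightarrow> bool" where
  "sat M e Falsum \<longleftrightarrow> False"
| "sat M e (Eq t u) \<longleftrightarrow> eval M e t = eval M e u"
| "sat M e (Rel r ts) \<longleftrightarrow> rint M r (map (eval M e) ts)"
| "sat M e (Imp \<phi> \<psi>) \<longleftrightarrow> (sat M e \<phi> \<longrightarrow> sat M e \<psi>)"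
| "sat M e (All v \<phi>) \<longleftrightarrow> (\<forall>a \<in> univ M (fst v). sat M (e(v := a)) \<phi>)"

text \<open>Satisfaction of a formula with at most one free variable.\<close>

definition holds_at :: "('s, 'f, 'r, 'a) fo_struct \<Rightarrow> 'a \<Rightarrow> ('s, 'f, 'r, 'a) form \<Rightarrow> bool" where
  "holds_at M a \<phi> \<longleftrightarrow> sat M (\<lambda>_. a) \<phi>"

text \<open>\<open>N\<close> is an elementary substructure of \<open>M\<close>.  That the function and relation symbols are
  interpreted in the same way on \<open>N\<close> is the case of atomic formulas.\<close>

definition elem_sub ::
  "('s, 'f, 'r) lang \<Rightarrow> ('s, 'f, 'r, 'a) fo_struct \<Rightarrow> ('s, 'f, 'r, 'a) fo_struct \<Rightarrow> bool" where
  "elem_sub L N M \<longleftrightarrow> is_struct L N \<and> is_struct L M \<and>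
     (\<forall>s \<in> sorts L. univ N s \<subseteq> univ M s) \<and>
     (\<forall>\<phi> \<in> fmls L UNIV {}. \<forall>e \<in> assign L N. sat N e \<phi> \<longleftrightarrow> sat M e \<phi>)"

definition is_theory :: "('s, 'f, 'r) lang \<Rightarrow> ('s, 'f, 'r, 'a) form set \<Rightarrow> bool" where
  "is_theory L T \<longleftrightarrow> T \<subseteq> fmls L {} {}"

definition model_of ::
  "('s, 'f, 'r) lang \<Rightarrow> ('s, 'f, 'r, 'a) form set \<Rightarrow> ('s, 'f, 'r, 'a) fo_struct \<Rightarrow> bool" where
  "model_of L T M \<longleftrightarrow> is_struct L M \<and> (\<forall>\<sigma> \<in> T. \<forall>e \<in> assign L M. sat M e \<sigma>)"

text \<open>The order property of \<open>\<phi>(V; V')\<close>, where the set \<open>V\<close> of variables singles out the first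
  group of variables and the remaining variables form the second one.  Only finitely many entries
  of the assignments \<open>a i\<close> and \<open>b j\<close> matter.\<close>

definition order_property ::
  "('s, 'f, 'r) lang \<Rightarrow> ('s, 'f, 'r, 'a) fo_struct \<Rightarrow> ('s, 'f, 'r, 'a) form \<Rightarrow> 's var set \<Rightarrow> bool" where
  "order_property L M \<phi> V \<longleftrightarrow>
     (\<exists>a b :: nat \<Rightarrow> 's var \<Rightarrow> 'a. range a \<subseteq> assign L M \<and> range b \<subseteq> assign L M \<and>
        (\<forall>i j. sat M (override_on (b j) (a i) V) \<phi> \<longleftrightarrow> i < j))"

text \<open>The models range over structures living on the type \<open>'a\<close>; as soon as one of the models of
  a complete \<open>T\<close> on this type is sufficiently saturated, this is no restriction.\<close>

definition stable_theory :: "('s, 'f, 'r) lang \<Rightarrow> ('s, 'f, 'r, 'a) form set \<Rightarrow> bool" where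
  "stable_theory L T \<longleftrightarrow>
     (\<forall>M. model_of L T M \<longrightarrow> (\<forall>\<phi> \<in> fmls L UNIV {}. \<forall>V. \<not> order_property L M \<phi> V))"


section \<open>Type spaces and saturation\<close>

text \<open>In the following, the parameter sets \<open>A\<close> are subsets of \<open>elems L M\<close>.\<close>

definition types ::
  "('s, 'f, 'r) lang \<Rightarrow> ('s, 'f, 'r, 'a) fo_struct \<Rightarrow> 's var \<Rightarrow> ('s, 'a) param set \<Rightarrow>
   ('s, 'f, 'r, 'a) form set set" where
  "types L M x A = {p. p \<subseteq> fmls L {x} A \<and>
     (\<forall>\<phi> \<in> fmls L {x} A. \<phi> \<in> p \<or> Neg \<phi> \<in> p) \<and>
     (\<forall>\<Phi>. finite \<Phi> \<and> \<Phi> \<subseteq> p \<longrightarrow> (\<exists>a \<in> univ M (fst x). \<forall>\<phi> \<in> \<Phi>. holds_at M a \<phi>))}"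

definition realizes ::
  "('s, 'f, 'r, 'a) fo_struct \<Rightarrow> 's var \<Rightarrow> 'a \<Rightarrow> ('s, 'f, 'r, 'a) form set \<Rightarrow> bool" where
  "realizes M x a p \<longleftrightarrow> a \<in> univ M (fst x) \<and> (\<forall>\<phi> \<in> p. holds_at M a \<phi>)"

definition tp ::
  "('s, 'f, 'r) lang \<Rightarrow> ('s, 'f, 'r, 'a) fo_struct \<Rightarrow> 's var \<Rightarrow> 'a \<Rightarrow> ('s, 'a) param set \<Rightarrow>
   ('s, 'f, 'r, 'a) form set" where
  "tp L M x a A = {\<phi> \<in> fmls L {x} A. holds_at M a \<phi>}"

definition type_topology ::
  "('s, 'f, 'r) lang \<Rightarrow> ('s, 'f, 'r, 'a) fo_struct \<Rightarrow> 's var \<Rightarrow> ('s, 'a) param set \<Rightarrow>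
   ('s, 'f, 'r, 'a) form set topology" where
  "type_topology L M x A =
     topology_generated_by {{p \<in> types L M x A. \<phi> \<in> p} | \<phi>. \<phi> \<in> fmls L {x} A}"

definition small :: "'k rel \<Rightarrow> 'b set \<Rightarrow> bool" where
  "small \<kappa> A \<longleftrightarrow> |A| <o \<kappa>"

text \<open>A monster model: \<open>\<kappa>\<close>-saturated for a cardinal \<open>\<kappa>\<close> larger than the number of formulas.
  ``Small'' means of cardinality less than \<open>\<kappa>\<close>.\<close>

definition monster ::
  "('s, 'f, 'r) lang \<Rightarrow> 'k rel \<Rightarrow> ('s, 'f, 'r, 'a) fo_struct \<Rightarrow> bool" where
  "monster L \<kappa> M \<longleftrightarrow> is_struct L M \<and> Card_order \<kappa> \<and> natLeq <o \<kappa> \<and>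
     |sorts L <+> funs L <+> rels L| <o \<kappa> \<and>
     (\<forall>x A p. fst x \<in> sorts L \<and> A \<subseteq> elems L M \<and> small \<kappa> A \<and> p \<in> types L M x A \<longrightarrow>
        (\<exists>a. realizes M x a p))"


section \<open>Keisler measures\<close>

text \<open>A Keisler measure is represented by a real-valued function on formulas that respects
  equivalence.  Values at formulas outside \<open>fmls L {x} A\<close> are irrelevant, so the restriction
  of a measure to a smaller parameter set is given by the same function.\<close>

definition keisler ::
  "('s, 'f, 'r) lang \<Rightarrow> ('s, 'f, 'r, 'a) fo_struct \<Rightarrow> 's var \<Rightarrow> ('s, 'a) param set \<Rightarrow>
   (('s, 'f, 'r, 'a) form \<Rightarrow> real) \<Rightarrow> bool" where
  "keisler L M x A \<mu> \<longleftrightarrow>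
     (\<forall>\<phi> \<in> fmls L {x} A. 0 \<le> \<mu> \<phi>) \<and>
     (\<forall>\<phi> \<in> fmls L {x} A. (\<forall>a \<in> univ M (fst x). holds_at M a \<phi>) \<longrightarrow> \<mu> \<phi> = 1) \<and>
     (\<forall>\<phi> \<in> fmls L {x} A. \<forall>\<psi> \<in> fmls L {x} A.
        (\<forall>a \<in> univ M (fst x). holds_at M a \<phi> \<longleftrightarrow> holds_at M a \<psi>) \<longrightarrow> \<mu> \<phi> = \<mu> \<psi>) \<and>
     (\<forall>\<phi> \<in> fmls L {x} A. \<forall>\<psi> \<in> fmls L {x} A.
        (\<forall>a \<in> univ M (fst x). \<not> (holds_at M a \<phi> \<and> holds_at M a \<psi>)) \<longrightarrow>
        \<mu> (Disj \<phi> \<psi>) = \<mu> \<phi> + \<mu> \<psi>)"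

definition support ::
  "('s, 'f, 'r) lang \<Rightarrow> ('s, 'f, 'r, 'a) fo_struct \<Rightarrow> 's var \<Rightarrow> ('s, 'a) param set \<Rightarrow>
   (('s, 'f, 'r, 'a) form \<Rightarrow> real) \<Rightarrow> ('s, 'f, 'r, 'a) form set set" where
  "support L M x A \<mu> = {p \<in> types L M x A. \<forall>\<phi> \<in> p. \<mu> \<phi> > 0}"

definition borel_of_top :: "'b topology \<Rightarrow> 'b measure" where
  "borel_of_top X = sigma (topspace X) {U. openin X U}"

definition regular_borel_prob :: "'b topology \<Rightarrow> 'b measure \<Rightarrow> bool" where
  "regular_borel_prob X P \<longleftrightarrow> prob_space P \<and> space P = topspace X \<and>
     sets P = sets (borel_of_top X) \<and>
     (\<forall>B \<in> sets P. \<forall>\<epsilon>>0. \<exists>K U. compactin X K \<and> K \<in> sets P \<and> openin X U \<and>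
        K \<subseteq> B \<and> B \<subseteq> U \<and> measure P U - measure P K < \<epsilon>)"

definition keisler_borel ::
  "('s, 'f, 'r) lang \<Rightarrow> ('s, 'f, 'r, 'a) fo_struct \<Rightarrow> 's var \<Rightarrow> ('s, 'a) param set \<Rightarrow>
   (('s, 'f, 'r, 'a) form \<Rightarrow> real) \<Rightarrow> ('s, 'f, 'r, 'a) form set measure" where
  "keisler_borel L M x A \<mu> = (THE P. regular_borel_prob (type_topology L M x A) P \<and>
     (\<forall>\<phi> \<in> fmls L {x} A. measure P {p \<in> types L M x A. \<phi> \<in> p} = \<mu> \<phi>))"


section \<open>Convolution of Keisler measures\<close>

text \<open>Here \<open>m\<close> is the function symbol for the group operation and the group lives on the sort of
  \<open>x\<close>.  A measure in the variable \<open>y\<close> is represented by its copy in the variable \<open>x\<close>.\<close>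

text \<open>\<open>\<phi>(x \<cdot> d, c)\<close>, where \<open>\<phi>\<close> already contains the parameters \<open>c\<close>.\<close>

definition rtranslate ::
  "'f \<Rightarrow> 's var \<Rightarrow> 'a \<Rightarrow> ('s, 'f, 'r, 'a) form \<Rightarrow> ('s, 'f, 'r, 'a) form" where
  "rtranslate m x d \<phi> = subst (Var(x := Fn m [Var x, Par (fst x, d)])) \<phi>"

text \<open>The function \<open>F\<close> on types over \<open>N\<close>, evaluated at some realization; the choice is irrelevant
  under \<open>conv_model\<close> below.\<close>

definition conv_fun ::
  "('s, 'f, 'r, 'a) fo_struct \<Rightarrow> 'f \<Rightarrow> 's var \<Rightarrow> (('s, 'f, 'r, 'a) form \<Rightarrow> real) \<Rightarrow>
   ('s, 'f, 'r, 'a) form \<Rightarrow> ('s, 'f, 'r, 'a) form set \<Rightarrow> real" where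
  "conv_fun G m x \<mu> \<phi> q = \<mu> (rtranslate m x (SOME d. realizes G x d q) \<phi>)"

definition conv_model ::
  "('s, 'f, 'r) lang \<Rightarrow> 'k rel \<Rightarrow> ('s, 'f, 'r, 'a) fo_struct \<Rightarrow> 'f \<Rightarrow> 's var \<Rightarrow>
   (('s, 'f, 'r, 'a) form \<Rightarrow> real) \<Rightarrow> (('s, 'f, 'r, 'a) form \<Rightarrow> real) \<Rightarrow>
   ('s, 'f, 'r, 'a) form \<Rightarrow> ('s, 'f, 'r, 'a) fo_struct \<Rightarrow> bool" where
  "conv_model L \<kappa> G m x \<mu> \<nu> \<phi> N \<longleftrightarrow>
     elem_sub L N G \<and> small \<kappa> (elems L N) \<and> pars \<phi> \<subseteq> elems L N \<and>
     (\<forall>q \<in> support L G x (elems L N) \<nu>. \<forall>d d'. realizes G x d q \<and> realizes G x d' q \<longrightarrow>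
        \<mu> (rtranslate m x d \<phi>) = \<mu> (rtranslate m x d' \<phi>)) \<and>
     conv_fun G m x \<mu> \<phi> \<in> borel_measurable (borel_of_top
       (subtopology (type_topology L G x (elems L N)) (support L G x (elems L N) \<nu>)))"

definition star_borel ::
  "('s, 'f, 'r) lang \<Rightarrow> 'k rel \<Rightarrow> ('s, 'f, 'r, 'a) fo_struct \<Rightarrow> 'f \<Rightarrow> 's var \<Rightarrow>
   (('s, 'f, 'r, 'a) form \<Rightarrow> real) \<Rightarrow> (('s, 'f, 'r, 'a) form \<Rightarrow> real) \<Rightarrow> bool" where
  "star_borel L \<kappa> G m x \<mu> \<nu> \<longleftrightarrow>
     (\<forall>\<phi> \<in> fmls L {x} (elems L G). \<exists>N. conv_model L \<kappa> G m x \<mu> \<nu> \<phi> N)"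

definition conv ::
  "('s, 'f, 'r) lang \<Rightarrow> 'k rel \<Rightarrow> ('s, 'f, 'r, 'a) fo_struct \<Rightarrow> 'f \<Rightarrow> 's var \<Rightarrow>
   (('s, 'f, 'r, 'a) form \<Rightarrow> real) \<Rightarrow> (('s, 'f, 'r, 'a) form \<Rightarrow> real) \<Rightarrow>
   ('s, 'f, 'r, 'a) form \<Rightarrow> real" where
  "conv L \<kappa> G m x \<mu> \<nu> \<phi> =
     (let N = (SOME N. conv_model L \<kappa> G m x \<mu> \<nu> \<phi> N); A = elems L N
      in integral\<^sup>L (restrict_space (keisler_borel L G x A \<nu>) (support L G x A \<nu>))
           (conv_fun G m x \<mu> \<phi>))"

definition idempotent_measure ::
  "('s, 'f, 'r) lang \<Rightarrow> 'k rel \<Rightarrow> ('s, 'f, 'r, 'a) fo_struct \<Rightarrow> 'f \<Rightarrow> 's var \<Rightarrow>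
   (('s, 'f, 'r, 'a) form \<Rightarrow> real) \<Rightarrow> bool" where
  "idempotent_measure L \<kappa> G m x \<mu> \<longleftrightarrow> star_borel L \<kappa> G m x \<mu> \<mu> \<and>
     (\<forall>\<phi> \<in> fmls L {x} (elems L G). conv L \<kappa> G m x \<mu> \<mu> \<phi> = \<mu> \<phi>)"


section \<open>Products of global types\<close>

text \<open>\<open>p\<close> is a type over all of \<open>M\<close>; invariance over \<open>A\<close>: whether \<open>\<phi>(x, c)\<close> belongs to \<open>p\<close> only
  depends on the type of \<open>c\<close> over \<open>A\<close>.\<close>

definition invariant ::
  "('s, 'f, 'r) lang \<Rightarrow> ('s, 'f, 'r, 'a) fo_struct \<Rightarrow> 's var \<Rightarrow> ('s, 'a) param set \<Rightarrow>
   ('s, 'f, 'r, 'a) form set \<Rightarrow> bool" where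
  "invariant L M x A p \<longleftrightarrow>
     (\<forall>\<phi> \<in> fmls L UNIV {}. \<forall>c \<in> assign L M. \<forall>c' \<in> assign L M.
        (\<forall>\<psi> \<in> fmls L (fv \<phi> - {x}) A. sat M c \<psi> \<longleftrightarrow> sat M c' \<psi>) \<longrightarrow>
        (inst x c \<phi> \<in> p \<longleftrightarrow> inst x c' \<phi> \<in> p))"

text \<open>\<open>G'\<close> is the larger monster model in which types over \<open>G\<close> are realized.\<close>

definition is_type_prod ::
  "('s, 'f, 'r) lang \<Rightarrow> 'k rel \<Rightarrow> ('s, 'f, 'r, 'a) fo_struct \<Rightarrow> ('s, 'f, 'r, 'a) fo_struct \<Rightarrow> 'f \<Rightarrow>
   's var \<Rightarrow> ('s, 'f, 'r, 'a) form set \<Rightarrow> ('s, 'f, 'r, 'a) form set \<Rightarrow>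
   ('s, 'f, 'r, 'a) form set \<Rightarrow> bool" where
  "is_type_prod L \<kappa> G G' m x p q r \<longleftrightarrow>
     (\<exists>N p' a b. elem_sub L N G \<and> small \<kappa> (elems L N) \<and>
        invariant L G x (elems L N) p \<and> invariant L G x (elems L N) q \<and>
        p' \<in> types L G' x (elems L G') \<and> invariant L G' x (elems L N) p' \<and> p \<subseteq> p' \<and>
        realizes G' x b q \<and>
        realizes G' x a (p' \<inter> fmls L {x} (elems L G \<union> {(fst x, b)})) \<and>
        r = tp L G' x (fint G' m [a, b]) (elems L G))"

definition type_prod ::
  "('s, 'f, 'r) lang \<Rightarrow> 'k rel \<Rightarrow> ('s, 'f, 'r, 'a) fo_struct \<Rightarrow> ('s, 'f, 'r, 'a) fo_struct \<Rightarrow> 'f \<Rightarrow>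
   's var \<Rightarrow> ('s, 'f, 'r, 'a) form set \<Rightarrow> ('s, 'f, 'r, 'a) form set \<Rightarrow>
   ('s, 'f, 'r, 'a) form set" where
  "type_prod L \<kappa> G G' m x p q = (THE r. is_type_prod L \<kappa> G G' m x p q r)"


section \<open>Groups\<close>

text \<open>The group on the sort \<open>s\<close> given by the function symbol \<open>m\<close>, with neutral element \<open>e\<close>.\<close>

definition def_group ::
  "('s, 'f, 'r, 'a) fo_struct \<Rightarrow> 'f \<Rightarrow> 's \<Rightarrow> 'a \<Rightarrow> 'a monoid" where
  "def_group M m s e = \<lparr>carrier = univ M s, monoid.mult = (\<lambda>a b. fint M m [a, b]), one = e\<rparr>"

definition topological_group :: "('b, 'c) monoid_scheme \<Rightarrow> 'b topology \<Rightarrow> bool" where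
  "topological_group H X \<longleftrightarrow> group H \<and> topspace X = carrier H \<and>
     continuous_map (prod_topology X X) X (\<lambda>(a, b). a \<otimes>\<^bsub>H\<^esub> b) \<and>
     continuous_map X X (\<lambda>a. inv\<^bsub>H\<^esub> a)"

end

theory Submission
  imports Defs
begin

text \<open>
  Types are treated as ultrafilters on the Boolean algebra of definable subsets of the group.
  For a definable set \<open>E\<close> and a type \<open>p\<close> let \<open>d\<^sub>p E\<close> be the set of those \<open>a\<close> for which the
  translate \<open>{b. a b \<in> E}\<close> belongs to \<open>p\<close>.  Stability of the relation \<open>a b \<in> E\<close> makes \<open>d\<^sub>p E\<close>
  definable (\<open>ultra_definable\<close>, \<open>dfn_mem\<close>), and \<open>E \<in> p * q\<close> iff \<open>d\<^sub>q E \<in> p\<close>.  By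
  Grothendieck's double limit criterion (\<open>double_limit\<close>) limits along two types may be
  interchanged, so that for an abelian group the operation \<open>*\<close> is commutative and associative.
  The same criterion yields a quantitative statement (\<open>dfn_approx\<close>): up to a set of small measure,
  \<open>d\<^sub>p E\<close> is determined by which of finitely many group elements it contains.  Hence
  \<open>p \<mapsto> \<mu> (d\<^sub>p E)\<close> and \<open>p \<mapsto> \<mu> (d\<^sub>p E \<triangle> d\<^sub>q E)\<close> are continuous on the type space.

  Idempotence of \<open>\<mu>\<close> says that \<open>\<mu> E\<close> is the mean of \<open>\<mu> (d\<^sub>p E)\<close> over \<open>p\<close>.  Applied to \<open>d\<^sub>q E\<close> in
  place of \<open>E\<close>, this makes \<open>p \<mapsto> \<mu> (d\<^sub>p E)\<close> a harmonic function on the compact set \<open>S(\<mu>)\<close>; at a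
  maximum and at a minimum the mean is attained everywhere, and by commutativity the two values
  meet, so the function is constant (\<open>m_dfn_supp\<close>).  Thus \<open>\<mu> (d\<^sub>p E) = \<mu> E\<close> for all \<open>p \<in> S(\<mu>)\<close>.
  This invariance gives \<open>p * S(\<mu>) = S(\<mu>)\<close> for all \<open>p \<in> S(\<mu>)\<close> (\<open>supp_divisible\<close>), which turns the
  commutative semigroup \<open>S(\<mu>)\<close> into a group.  It also makes the pseudometrics
  \<open>\<mu> (d\<^sub>p E \<triangle> d\<^sub>q E)\<close> invariant under translation.  They separate points, hence define the compact
  topology of \<open>S(\<mu>)\<close>, and an abelian group whose topology is given by invariant pseudometrics is a
  topological group (\<open>supp_topological_group\<close>).

  Three facts connect this with the model-theoretic notions.  A Keisler measure has exactly one
  regular Borel extension to the type space (\<open>ex_regular_borel\<close>, \<open>regular_borel_unique\<close>).  The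
  integral over types over a small model that defines the convolution equals the integral of
  \<open>\<mu> (d\<^sub>p E)\<close> over global types (\<open>conv_eq_integral\<close>): restriction of types carries one measure to the
  other, and by saturation a type in \<open>S(\<mu>)\<close> can be approximated by elements of the monster model.
  Finally, the product of types computed in a larger monster model is the product described above
  (\<open>type_prod_is_prod\<close>); there the invariant extension of a type is its coheir, which is invariant over
  a small model that contains the parameters of all definitions of the type.
\<close>

section \<open>Ultrafilters and double limits\<close>

definition ultra :: "'a filter \<Rightarrow> bool" where
  "ultra U \<longleftrightarrow> U \<noteq> bot \<and> (\<forall>P. eventually P U \<or> eventually (\<lambda>x. \<not> P x) U)"

lemma ultra_not: "ultra U \<Longrightarrow> eventually (\<lambda>x. \<not> P x) U \<longleftrightarrow> \<not> eventually P U"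
  unfolding ultra_def using eventually_conj[of P U "\<lambda>x. \<not> P x"]
  by (auto simp: trivial_limit_def eventually_mono)

lemma ultra_iff: "ultra U \<Longrightarrow> eventually (\<lambda>x. P x \<longleftrightarrow> Q x) U \<longleftrightarrow> (eventually P U \<longleftrightarrow> eventually Q U)"
proof -
  assume u: "ultra U"
  have "eventually (\<lambda>x. P x \<longleftrightarrow> Q x) U" if "eventually P U" "eventually Q U"
    using that by eventually_elim auto
  moreover have "eventually (\<lambda>x. P x \<longleftrightarrow> Q x) U"
    if "eventually (\<lambda>x. \<not> P x) U" "eventually (\<lambda>x. \<not> Q x) U"
    using that by eventually_elim auto
  moreover have "eventually P U \<longleftrightarrow> eventually Q U" if e: "eventually (\<lambda>x. P x \<longleftrightarrow> Q x) U"
    using eventually_subst[OF e] .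
  ultimately show ?thesis using ultra_not[OF u] by blast
qed

lemma ultra_nonbot: "ultra U \<Longrightarrow> U \<noteq> bot" by (simp add: ultra_def)

lemma ultra_ex: "ultra U \<Longrightarrow> eventually P U \<Longrightarrow> \<exists>x. P x"
  using eventually_happens ultra_nonbot by blast

lemma ultra_filtermap: "ultra U \<Longrightarrow> ultra (filtermap f U)"
  by (auto simp: ultra_def eventually_filtermap filtermap_bot_iff)

text \<open>Ultrafilters are the minimal proper filters, and proper filters are closed under infima of
  chains.\<close>
lemma ultra_exists:
  assumes "F \<noteq> bot"
  shows "\<exists>U\<le>F. ultra U"
proof -
  define \<A> where "\<A> = {H. H \<noteq> bot \<and> H \<le> F}"
  interpret dual: order "(\<ge>) :: 'a filter \<Rightarrow> 'a filter \<Rightarrow> bool" "(>)"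
    by (rule dual_order)
  have "\<exists>U\<in>\<A>. \<forall>H\<in>\<A>. H \<le> U \<longrightarrow> H = U"
  proof (rule predicate_Zorn[where P="(\<ge>)" and A=\<A>, simplified])
    show "partial_order_on \<A> (relation_of (\<ge>) \<A>)"
      by (rule partial_order_on_relation_ofI) auto
    show "\<exists>u\<in>\<A>. \<forall>H\<in>Z. u \<le> H" if "Z \<in> Chains (relation_of (\<ge>) \<A>)" for Z
    proof (cases "Z = {}")
      case True
      then show ?thesis using assms by (auto simp: \<A>_def)
    next
      case False
      have Z: "Z \<subseteq> \<A>" "\<And>H K. H \<in> Z \<Longrightarrow> K \<in> Z \<Longrightarrow> H \<le> K \<or> K \<le> H"
        using that by (auto simp: Chains_def relation_of_def)
      have ev: "eventually P (Inf Z) \<longleftrightarrow> (\<exists>b\<in>Z. eventually P b)" for P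
      proof (rule eventually_Inf_base)
        show "\<exists>x\<in>Z. x \<le> inf H K" if "H \<in> Z" "K \<in> Z" for H K
          using Z(2)[OF that] that by (metis inf.orderE inf.orderI inf_commute order_refl)
      qed (rule False)
      have "Inf Z \<noteq> bot"
        using Z(1) unfolding trivial_limit_def ev by (auto simp: \<A>_def trivial_limit_def)
      moreover have "Inf Z \<le> F"
        using False Z(1) by (auto simp: \<A>_def intro: Inf_lower2)
      ultimately show ?thesis by (auto simp: \<A>_def intro!: bexI[of _ "Inf Z"] Inf_lower)
    qed
  qed
  then obtain U where U: "U \<noteq> bot" "U \<le> F" "\<And>H. H \<noteq> bot \<Longrightarrow> H \<le> F \<Longrightarrow> H \<le> U \<Longrightarrow> H = U"
    unfolding \<A>_def by blast
  have "eventually P U \<or> eventually (\<lambda>x. \<not> P x) U" for P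
  proof (rule disjCI)
    assume n: "\<not> eventually (\<lambda>x. \<not> P x) U"
    have "inf U (principal {x. P x}) \<noteq> bot"
      using n by (simp add: trivial_limit_def eventually_inf_principal)
    then have "inf U (principal {x. P x}) = U"
      using U(2) by (intro U(3)) (auto intro: le_infI1)
    moreover have "eventually P (inf U (principal {x. P x}))"
      by (simp add: eventually_inf_principal)
    ultimately show "eventually P U" by simp
  qed
  then show ?thesis using U by (auto simp: ultra_def)
qed

lemma ultra_of_fip:
  assumes "\<And>\<F>. finite \<F> \<Longrightarrow> \<F> \<subseteq> \<S> \<Longrightarrow> \<Inter>\<F> \<noteq> {}"
  shows "\<exists>U. ultra U \<and> (\<forall>S\<in>\<S>. eventually (\<lambda>x. x \<in> S) U)"
proof -
  define F where "F = (INF S\<in>\<S>. principal S)"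
  have "F \<noteq> bot"
  proof
    assume "F = bot"
    then have "eventually (\<lambda>x. False) F" by simp
    then obtain \<F> where "\<F> \<subseteq> \<S>" "finite \<F>" and e: "eventually (\<lambda>x. False) (INF S\<in>\<F>. principal S)"
      unfolding F_def by (metis (no_types, lifting) eventually_INF)
    from e have "\<Inter>\<F> = {}"
      unfolding INF_principal_finite[OF \<open>finite \<F>\<close>] eventually_principal by auto
    then show False using assms[OF \<open>finite \<F>\<close> \<open>\<F> \<subseteq> \<S>\<close>] by simp
  qed
  then obtain U where "U \<le> F" "ultra U" using ultra_exists by blast
  moreover have "F \<le> principal S" if "S \<in> \<S>" for S
    unfolding F_def using that by (rule INF_lower)
  ultimately have "\<forall>S\<in>\<S>. U \<le> principal S" by (blast intro: order_trans)
  then have "\<forall>S\<in>\<S>. eventually (\<lambda>x. x \<in> S) U"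
    by (simp add: le_principal)
  then show ?thesis using \<open>ultra U\<close> by blast
qed

text \<open>The condition on the complement of \<open>R\<close> forbids ladders descending in the first argument.\<close>
definition stable_rel :: "'a set \<Rightarrow> 'b set \<Rightarrow> ('a \<Rightarrow> 'b \<Rightarrow> bool) \<Rightarrow> bool" where
  "stable_rel A B R \<longleftrightarrow>
     \<not> (\<exists>a b. range a \<subseteq> A \<and> range b \<subseteq> B \<and> (\<forall>i j::nat. R (a i) (b j) \<longleftrightarrow> i < j)) \<and>
     \<not> (\<exists>a b. range a \<subseteq> A \<and> range b \<subseteq> B \<and> (\<forall>i j::nat. \<not> R (a i) (b j) \<longleftrightarrow> i < j))"

lemma stable_rel_Not: "stable_rel A B (\<lambda>a b. \<not> R a b) \<longleftrightarrow> stable_rel A B R"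
  unfolding stable_rel_def by auto

lemma stable_rel_image:
  assumes "stable_rel A B R" "f ` A' \<subseteq> A" "g ` B' \<subseteq> B"
  shows "stable_rel A' B' (\<lambda>a b. R (f a) (g b))"
proof -
  have "\<not> (\<exists>a b. range a \<subseteq> A' \<and> range b \<subseteq> B' \<and> (\<forall>i j::nat. S (f (a i)) (g (b j)) \<longleftrightarrow> i < j))"
    if n: "\<not> (\<exists>a b. range a \<subseteq> A \<and> range b \<subseteq> B \<and> (\<forall>i j::nat. S (a i) (b j) \<longleftrightarrow> i < j))" for S
  proof
    assume "\<exists>a b. range a \<subseteq> A' \<and> range b \<subseteq> B' \<and> (\<forall>i j::nat. S (f (a i)) (g (b j)) \<longleftrightarrow> i < j)"
    then obtain a b where "range a \<subseteq> A'" "range b \<subseteq> B'"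
      and ij: "\<forall>i j::nat. S (f (a i)) (g (b j)) \<longleftrightarrow> i < j" by blast
    then have "range (\<lambda>i. f (a i)) \<subseteq> A" "range (\<lambda>i. g (b i)) \<subseteq> B"
      using assms(2,3) by (meson UNIV_I image_subset_iff)+
    with ij n show False by blast
  qed
  from this[of R] this[of "\<lambda>a b. \<not> R a b"] show ?thesis
    using assms(1) unfolding stable_rel_def by blast
qed

lemma stable_rel_mono: "stable_rel A B R \<Longrightarrow> A' \<subseteq> A \<Longrightarrow> B' \<subseteq> B \<Longrightarrow> stable_rel A' B' R"
  using stable_rel_image[of A B R id A' id B'] by auto

lemma stable_rel_cong:
  assumes "stable_rel A B R" "\<And>a b. a \<in> A \<Longrightarrow> b \<in> B \<Longrightarrow> R a b \<longleftrightarrow> R' a b"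
  shows "stable_rel A B R'"
proof -
  have "R (a i) (b j) \<longleftrightarrow> R' (a i) (b j)" if "range a \<subseteq> A" "range b \<subseteq> B" for a b and i j :: nat
    using assms(2) that by (simp add: range_subsetD)
  then show ?thesis using assms(1) unfolding stable_rel_def by (simp cong: conj_cong)
qed

text \<open>If the second iterated limit fails, elements \<open>a\<^sub>n\<close> and \<open>b\<^sub>n\<close> chosen alternately, each behaving
  towards its predecessors like the limit, satisfy \<open>R a\<^sub>i b\<^sub>j\<close> exactly for \<open>i \<le> j\<close>.\<close>
lemma double_limit_imp:
  assumes st: "stable_rel A B R" and U: "ultra U" and V: "ultra V"
    and UA: "\<forall>\<^sub>F a in U. a \<in> A" and VB: "\<forall>\<^sub>F b in V. b \<in> B"
    and UV: "\<forall>\<^sub>F a in U. \<forall>\<^sub>F b in V. R a b"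
  shows "\<forall>\<^sub>F b in V. \<forall>\<^sub>F a in U. R a b"
proof (rule ccontr)
  assume "\<not> ?thesis"
  then have VU: "\<forall>\<^sub>F b in V. \<forall>\<^sub>F a in U. \<not> R a b"
    using ultra_not[OF U] ultra_not[OF V] by simp
  define E where "E a \<longleftrightarrow> a \<in> A \<and> (\<forall>\<^sub>F b in V. R a b)" for a
  define D where "D b \<longleftrightarrow> b \<in> B \<and> (\<forall>\<^sub>F a in U. \<not> R a b)" for b
  define Q where "Q f n r \<longleftrightarrow> E (fst r) \<and> D (snd r) \<and> R (fst r) (snd r) \<and>
     (\<forall>i<n. \<not> R (fst r) (snd (f i)) \<and> R (fst (f i)) (snd r))"
    for f :: "nat \<Rightarrow> 'a \<times> 'b" and n r
  have EU: "eventually E U" and DV: "eventually D V"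
    unfolding E_def D_def using UA UV VB VU by (auto intro: eventually_conj)
  have "\<exists>f. \<forall>n. Q f n (f n)"
  proof (rule dependent_wellorder_choice)
    show "Q f n r = Q g n r" if "\<And>i. i < n \<Longrightarrow> f i = g i" for r f g n
      using that by (auto simp: Q_def)
    show "\<exists>r. Q f n r" if f: "\<And>i. i < n \<Longrightarrow> Q f i (f i)" for n f
    proof -
      have "\<forall>\<^sub>F a in U. \<forall>i\<in>{..<n}. \<not> R a (snd (f i))"
        by (rule eventually_ball_finite) (use f in \<open>auto simp: Q_def D_def\<close>)
      from ultra_ex[OF U eventually_conj[OF EU this]]
      obtain a where a: "E a" "\<And>i. i < n \<Longrightarrow> \<not> R a (snd (f i))"
        by auto
      have "\<forall>\<^sub>F b in V. \<forall>i\<in>{..<n}. R (fst (f i)) b"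
        by (rule eventually_ball_finite) (use f in \<open>auto simp: Q_def E_def\<close>)
      moreover have "\<forall>\<^sub>F b in V. R a b" using a(1) by (simp add: E_def)
      ultimately have "\<forall>\<^sub>F b in V. (\<forall>i\<in>{..<n}. R (fst (f i)) b) \<and> R a b \<and> D b"
        using DV by (intro eventually_conj)
      from ultra_ex[OF V this] obtain b where "D b" "R a b" "\<And>i. i < n \<Longrightarrow> R (fst (f i)) b"
        by auto
      then show ?thesis using a by (intro exI[of _ "(a, b)"]) (auto simp: Q_def)
    qed
  qed
  then obtain f where f: "\<And>n. Q f n (f n)" by blast
  have le: "R (fst (f i)) (snd (f j)) \<longleftrightarrow> i \<le> j" for i j
    using f[of i] f[of j] by (cases i j rule: linorder_cases) (auto simp: Q_def)
  have "range (\<lambda>i. fst (f (Suc i))) \<subseteq> A" "range (\<lambda>i. snd (f i)) \<subseteq> B"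
    using f by (auto simp: Q_def E_def D_def)
  moreover have "R (fst (f (Suc i))) (snd (f j)) \<longleftrightarrow> i < j" for i j
    by (auto simp: le)
  ultimately show False
    using st unfolding stable_rel_def by blast
qed

text \<open>Grothendieck's criterion for stability.\<close>
lemma double_limit:
  assumes "stable_rel A B R" "ultra U" "ultra V" "\<forall>\<^sub>F a in U. a \<in> A" "\<forall>\<^sub>F b in V. b \<in> B"
  shows "(\<forall>\<^sub>F a in U. \<forall>\<^sub>F b in V. R a b) \<longleftrightarrow> (\<forall>\<^sub>F b in V. \<forall>\<^sub>F a in U. R a b)"
  using double_limit_imp[OF assms]
    double_limit_imp[OF stable_rel_Not[THEN iffD2, OF assms(1)] assms(2-5)]
    ultra_not[OF assms(2)] ultra_not[OF assms(3)] by auto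

text \<open>Definability of types.  If no finite set works, there are \<open>b\<^sub>n\<close> and \<open>b'\<^sub>n\<close> that \<open>U\<close> separates
  but \<open>a\<^sub>0, \<dots>, a\<^sub>n\<^sub>-\<^sub>1\<close> do not, where \<open>a\<^sub>n\<close> imitates \<open>U\<close> on \<open>b\<^sub>i\<close> and \<open>b'\<^sub>i\<close> for \<open>i \<le> n\<close>.  Then the
  iterated limits of \<open>R a\<^sub>n b\<^sub>i\<close> and of \<open>R a\<^sub>n b'\<^sub>i\<close> agree in one order and differ in the other.\<close>
lemma ultra_definable:
  assumes st: "stable_rel A B R" and U: "ultra U" and UA: "\<forall>\<^sub>F a in U. a \<in> A"
  shows "\<exists>A0\<subseteq>A. finite A0 \<and> (\<forall>b\<in>B. \<forall>b'\<in>B. (\<forall>a\<in>A0. R a b \<longleftrightarrow> R a b') \<longrightarrow>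
           ((\<forall>\<^sub>F a in U. R a b) \<longleftrightarrow> (\<forall>\<^sub>F a in U. R a b')))"
proof (rule ccontr)
  assume undef: "\<not> ?thesis"
  have neg: "\<exists>b b'. b \<in> B \<and> b' \<in> B \<and> (\<forall>a\<in>A0. R a b \<longleftrightarrow> R a b') \<and>
      (\<forall>\<^sub>F a in U. R a b) \<and> (\<forall>\<^sub>F a in U. \<not> R a b')" if "A0 \<subseteq> A" "finite A0" for A0
  proof (rule ccontr)
    assume no: "\<nexists>b b'. b \<in> B \<and> b' \<in> B \<and> (\<forall>a\<in>A0. R a b \<longleftrightarrow> R a b') \<and>
      (\<forall>\<^sub>F a in U. R a b) \<and> (\<forall>\<^sub>F a in U. \<not> R a b')"
    have "(\<forall>\<^sub>F a in U. R a b) \<longleftrightarrow> (\<forall>\<^sub>F a in U. R a b')"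
      if "b \<in> B" "b' \<in> B" "\<forall>a\<in>A0. R a b \<longleftrightarrow> R a b'" for b b'
      using no that unfolding ultra_not[OF U] by blast
    then show False using undef \<open>A0 \<subseteq> A\<close> \<open>finite A0\<close> by blast
  qed
  define Q where "Q f n r \<longleftrightarrow> (case r of (a, b, b') \<Rightarrow> a \<in> A \<and> b \<in> B \<and> b' \<in> B \<and>
     (\<forall>i<n. R (fst (f i)) b \<longleftrightarrow> R (fst (f i)) b') \<and>
     (\<forall>\<^sub>F a in U. R a b) \<and> (\<forall>\<^sub>F a in U. \<not> R a b') \<and> R a b \<and> \<not> R a b' \<and>
     (\<forall>i<n. R a (fst (snd (f i))) \<and> \<not> R a (snd (snd (f i)))))"
    for f :: "nat \<Rightarrow> 'a \<times> 'b \<times> 'b" and n r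
  have "\<exists>f. \<forall>n. Q f n (f n)"
  proof (rule dependent_wellorder_choice)
    show "Q f n r = Q g n r" if "\<And>i. i < n \<Longrightarrow> f i = g i" for r f g n
      using that by (auto simp: Q_def)
    show "\<exists>r. Q f n r" if f: "\<And>i. i < n \<Longrightarrow> Q f i (f i)" for n f
    proof -
      have fA: "fst (f i) \<in> A" and fU: "\<forall>\<^sub>F a in U. R a (fst (snd (f i)))"
        "\<forall>\<^sub>F a in U. \<not> R a (snd (snd (f i)))" if "i < n" for i
        using f[OF that] by (simp_all add: Q_def split_beta)
      then have "(\<lambda>i. fst (f i)) ` {..<n} \<subseteq> A" by auto
      from neg[OF this] obtain b b' where b: "b \<in> B" "b' \<in> B"
        "\<And>i. i < n \<Longrightarrow> R (fst (f i)) b \<longleftrightarrow> R (fst (f i)) b'"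
        "\<forall>\<^sub>F a in U. R a b" "\<forall>\<^sub>F a in U. \<not> R a b'" by auto
      have "\<forall>\<^sub>F a in U. \<forall>i\<in>{..<n}. R a (fst (snd (f i))) \<and> \<not> R a (snd (snd (f i)))"
        by (rule eventually_ball_finite) (use fU in \<open>simp_all add: eventually_conj_iff\<close>)
      then have "\<forall>\<^sub>F a in U. a \<in> A \<and> R a b \<and> \<not> R a b' \<and>
          (\<forall>i\<in>{..<n}. R a (fst (snd (f i))) \<and> \<not> R a (snd (snd (f i))))"
        using UA b(4,5) by (intro eventually_conj)
      then obtain a where "a \<in> A \<and> R a b \<and> \<not> R a b' \<and>
          (\<forall>i\<in>{..<n}. R a (fst (snd (f i))) \<and> \<not> R a (snd (snd (f i))))"
        using ultra_ex[OF U, of "\<lambda>a. a \<in> A \<and> R a b \<and> \<not> R a b' \<and>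
          (\<forall>i\<in>{..<n}. R a (fst (snd (f i))) \<and> \<not> R a (snd (snd (f i))))"] by blast
      then show ?thesis using b by (intro exI[of _ "(a, b, b')"]) (auto simp: Q_def)
    qed
  qed
  then obtain f where f: "\<And>n. Q f n (f n)" by blast
  define a b b' where "a = (\<lambda>n. fst (f n))" and "b = (\<lambda>n. fst (snd (f n)))"
    and "b' = (\<lambda>n. snd (snd (f n)))"
  have fn: "a n \<in> A \<and> b n \<in> B \<and> b' n \<in> B \<and> (\<forall>i<n. R (a i) (b n) \<longleftrightarrow> R (a i) (b' n)) \<and>
      R (a n) (b n) \<and> \<not> R (a n) (b' n) \<and> (\<forall>i<n. R (a n) (b i) \<and> \<not> R (a n) (b' i))" for n
    using f[of n] by (simp add: Q_def a_def b_def b'_def split_beta)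
  have le: "R (a n) (b i)" "\<not> R (a n) (b' i)" if "i \<le> n" for i n
    using fn[of n] that by (auto simp: le_less)
  have lt: "R (a n) (b i) \<longleftrightarrow> R (a n) (b' i)" if "n < i" for i n
    using fn[of i] that by blast
  have ran: "a n \<in> A" "b n \<in> B" "b' n \<in> B" for n
    using fn[of n] by blast+
  obtain W :: "nat filter" where W: "ultra W" "W \<le> sequentially"
    using ultra_exists[of sequentially] by auto
  have ge: "\<forall>\<^sub>F i in W. i \<ge> n" "\<forall>\<^sub>F i in W. n < i" for n
    using W(2) by (auto intro: filter_leD eventually_ge_at_top eventually_gt_at_top)
  have dl: "(\<forall>\<^sub>F n in W. \<forall>\<^sub>F i in W. R (a n) (c i)) \<longleftrightarrow> (\<forall>\<^sub>F i in W. \<forall>\<^sub>F n in W. R (a n) (c i))"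
    if "\<And>n. c n \<in> B" for c
    using double_limit[OF st ultra_filtermap[OF W(1), of a] ultra_filtermap[OF W(1), of c]]
    by (simp add: eventually_filtermap ran that)
  have "\<forall>\<^sub>F n in W. R (a n) (b i)" "\<not> (\<forall>\<^sub>F n in W. R (a n) (b' i))" for i
    unfolding ultra_not[OF W(1), symmetric] using ge(1)[of i] le by (auto elim: eventually_mono)
  then have "\<forall>\<^sub>F n in W. \<forall>\<^sub>F i in W. R (a n) (b i)" "\<not> (\<forall>\<^sub>F n in W. \<forall>\<^sub>F i in W. R (a n) (b' i))"
    unfolding dl[of b, OF ran(2)] dl[of b', OF ran(3)] using ultra_nonbot[OF W(1)] by auto
  moreover have "(\<forall>\<^sub>F i in W. R (a n) (b i)) \<longleftrightarrow> (\<forall>\<^sub>F i in W. R (a n) (b' i))" for n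
    unfolding ultra_iff[OF W(1), symmetric] using ge(2)[of n] lt by (auto elim: eventually_mono)
  ultimately show False by simp
qed

section \<open>Stone spaces of Boolean algebras of sets\<close>

text \<open>Ultrafilters of an algebra of sets, in the form in which complete types are given: every set is
  decided, and finitely many members have a common point.\<close>
definition set_ultrafilter :: "'c set \<Rightarrow> 'c set set \<Rightarrow> 'c set set \<Rightarrow> bool" where
  "set_ultrafilter C \<B> u \<longleftrightarrow> u \<subseteq> \<B> \<and> (\<forall>E\<in>\<B>. E \<in> u \<or> C - E \<in> u) \<and>
     (\<forall>\<F>. finite \<F> \<and> \<F> \<subseteq> u \<longrightarrow> (\<exists>c\<in>C. \<forall>E\<in>\<F>. c \<in> E))"

text \<open>The points are kept abstract, with \<open>U p\<close> the ultrafilter of the point \<open>p\<close>, so that complete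
  types, which are sets of formulas, can serve as points.\<close>
locale stone_space = algebra C \<B> for C :: "'c set" and \<B> +
  fixes X :: "'x set" and U :: "'x \<Rightarrow> 'c set set"
  assumes bij: "bij_betw U X {u. set_ultrafilter C \<B> u}"
begin

definition cl :: "'c set \<Rightarrow> 'x set" where
  "cl E = {p \<in> X. E \<in> U p}"

definition \<tau> :: "'x topology" where
  "\<tau> = topology_generated_by (cl ` \<B>)"

lemma U_uf: "p \<in> X \<Longrightarrow> set_ultrafilter C \<B> (U p)"
  using bij by (auto simp: bij_betw_def)

lemma U_sub: "p \<in> X \<Longrightarrow> E \<in> U p \<Longrightarrow> E \<in> \<B>"
  using U_uf by (auto simp: set_ultrafilter_def)

lemma U_fin: "p \<in> X \<Longrightarrow> finite \<F> \<Longrightarrow> \<F> \<subseteq> U p \<Longrightarrow> \<exists>c\<in>C. \<forall>E\<in>\<F>. c \<in> E"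
  using U_uf by (auto simp: set_ultrafilter_def)

lemma U_Diff: assumes "p \<in> X" "E \<in> \<B>" shows "C - E \<in> U p \<longleftrightarrow> E \<notin> U p"
proof -
  have "E \<in> U p \<or> C - E \<in> U p" using U_uf[OF assms(1)] assms(2) by (auto simp: set_ultrafilter_def)
  moreover have "\<not> (E \<in> U p \<and> C - E \<in> U p)"
    using U_fin[OF assms(1), of "{E, C - E}"] by auto
  ultimately show ?thesis by blast
qed

lemma U_mono: assumes "p \<in> X" "E \<in> U p" "E \<subseteq> F" "F \<in> \<B>" shows "F \<in> U p"
proof (rule ccontr)
  assume "F \<notin> U p"
  then have "C - F \<in> U p" using U_Diff assms by blast
  then show False using U_fin[OF assms(1), of "{E, C - F}"] assms by auto
qed

lemma U_Int: assumes "p \<in> X" "E \<in> \<B>" "F \<in> \<B>" shows "E \<inter> F \<in> U p \<longleftrightarrow> E \<in> U p \<and> F \<in> U p"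
proof
  assume "E \<inter> F \<in> U p"
  then show "E \<in> U p \<and> F \<in> U p"
    using U_mono[OF assms(1) _ _ assms(2)] U_mono[OF assms(1) _ _ assms(3)] by blast
next
  assume EF: "E \<in> U p \<and> F \<in> U p"
  show "E \<inter> F \<in> U p"
  proof (rule ccontr)
    assume "E \<inter> F \<notin> U p"
    then have "C - (E \<inter> F) \<in> U p" using U_Diff assms by blast
    then show False using U_fin[OF assms(1), of "{E, F, C - (E \<inter> F)}"] EF by auto
  qed
qed

lemma U_empty: "p \<in> X \<Longrightarrow> {} \<notin> U p"
  using U_fin[of p "{{}}"] by auto

lemma U_space: "p \<in> X \<Longrightarrow> C \<in> U p"
  using U_Diff[of p "{}"] U_empty by auto

lemma U_Un: "p \<in> X \<Longrightarrow> E \<in> \<B> \<Longrightarrow> F \<in> \<B> \<Longrightarrow> E \<union> F \<in> U p \<longleftrightarrow> E \<in> U p \<or> F \<in> U p"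
  using U_Int[of p "C - E" "C - F"] U_Diff[of p E] U_Diff[of p F] U_Diff[of p "E \<union> F"]
  by (auto simp: Diff_Un[symmetric])

lemma U_diff: "p \<in> X \<Longrightarrow> E \<in> \<B> \<Longrightarrow> F \<in> \<B> \<Longrightarrow> E - F \<in> U p \<longleftrightarrow> E \<in> U p \<and> F \<notin> U p"
proof -
  assume *: "p \<in> X" "E \<in> \<B>" "F \<in> \<B>"
  then have "E - F = E \<inter> (C - F)" using sets_into_space by auto
  then show ?thesis using U_Int[of p E "C - F"] U_Diff[of p F] * by auto
qed

lemma point_eqI: "p \<in> X \<Longrightarrow> q \<in> X \<Longrightarrow> (\<And>E. E \<in> \<B> \<Longrightarrow> E \<in> U p \<longleftrightarrow> E \<in> U q) \<Longrightarrow> p = q"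
  using bij U_sub unfolding bij_betw_def inj_on_def by blast

text \<open>A predicate that commutes with the Boolean operations is membership in a point.  All limits of
  points and all products are obtained in this way.\<close>
lemma ex_point:
  assumes C: "T C" and D: "\<And>E. E \<in> \<B> \<Longrightarrow> T (C - E) \<longleftrightarrow> \<not> T E"
    and I: "\<And>E F. E \<in> \<B> \<Longrightarrow> F \<in> \<B> \<Longrightarrow> T E \<Longrightarrow> T F \<Longrightarrow> T (E \<inter> F)"
  shows "\<exists>p\<in>X. \<forall>E\<in>\<B>. E \<in> U p \<longleftrightarrow> T E"
proof -
  define u where "u = {E \<in> \<B>. T E}"
  have Inf: "C \<inter> \<Inter>\<F> \<in> \<B> \<and> T (C \<inter> \<Inter>\<F>)" if "finite \<F>" "\<F> \<subseteq> u" for \<F>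
    using that
  proof induction
    case empty
    then show ?case using C by simp
  next
    case (insert E \<F>)
    then have "E \<in> \<B>" "T E" "C \<inter> \<Inter>\<F> \<in> \<B>" "T (C \<inter> \<Inter>\<F>)" by (auto simp: u_def)
    moreover have "C \<inter> \<Inter>(insert E \<F>) = E \<inter> (C \<inter> \<Inter>\<F>)" by auto
    ultimately show ?case using I by auto
  qed
  have nT: "\<not> T {}" using D[of "{}"] C by simp
  have "set_ultrafilter C \<B> u"
    unfolding set_ultrafilter_def
  proof (intro conjI allI impI ballI)
    show "u \<subseteq> \<B>" by (auto simp: u_def)
    show "E \<in> u \<or> C - E \<in> u" if "E \<in> \<B>" for E using that D by (auto simp: u_def)
    show "\<exists>c\<in>C. \<forall>E\<in>\<F>. c \<in> E" if "finite \<F> \<and> \<F> \<subseteq> u" for \<F>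
    proof -
      have "C \<inter> \<Inter>\<F> \<noteq> {}" using Inf[of \<F>] that nT by metis
      then show ?thesis by blast
    qed
  qed
  then have "u \<in> U ` X" using bij by (simp add: bij_betw_def)
  then obtain p where "p \<in> X" and p: "U p = u" by (metis imageE)
  moreover have "\<forall>E\<in>\<B>. E \<in> U p \<longleftrightarrow> T E" unfolding p by (simp add: u_def)
  ultimately show ?thesis by blast
qed

lemma ex_point_of_ultra:
  assumes F: "ultra F" and C: "\<forall>\<^sub>F c in F. c \<in> C"
  shows "\<exists>p\<in>X. \<forall>E\<in>\<B>. E \<in> U p \<longleftrightarrow> (\<forall>\<^sub>F c in F. c \<in> E)"
proof (rule ex_point[where T="\<lambda>E. \<forall>\<^sub>F c in F. c \<in> E"])
  show "(\<forall>\<^sub>F c in F. c \<in> C - E) \<longleftrightarrow> \<not> (\<forall>\<^sub>F c in F. c \<in> E)" for E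
    unfolding ultra_not[OF F, symmetric] using C by (simp add: eventually_conj_iff)
qed (use C in \<open>simp_all add: eventually_conj_iff\<close>)

lemma ex_point_lim:
  assumes W: "ultra W" and P: "\<And>i. P i \<in> X"
  shows "\<exists>p\<in>X. \<forall>E\<in>\<B>. E \<in> U p \<longleftrightarrow> (\<forall>\<^sub>F i in W. E \<in> U (P i))"
  by (rule ex_point[where T="\<lambda>E. \<forall>\<^sub>F i in W. E \<in> U (P i)"])
    (simp_all add: P U_space U_Diff U_Int ultra_not[OF W] eventually_conj_iff)

lemma ex_point_fip:
  assumes "\<S> \<subseteq> \<B>" "\<And>\<F>. finite \<F> \<Longrightarrow> \<F> \<subseteq> \<S> \<Longrightarrow> \<exists>c\<in>C. \<forall>E\<in>\<F>. c \<in> E"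
  shows "\<exists>p\<in>X. \<S> \<subseteq> U p"
proof -
  have "\<Inter>\<F> \<noteq> {}" if F: "finite \<F>" "\<F> \<subseteq> insert C \<S>" for \<F>
  proof -
    obtain c where "c \<in> C" "\<forall>E\<in>\<F> - {C}. c \<in> E" using assms(2)[of "\<F> - {C}"] F by auto
    then show ?thesis by blast
  qed
  then obtain F where F: "ultra F" "\<forall>S\<in>insert C \<S>. \<forall>\<^sub>F c in F. c \<in> S"
    using ultra_of_fip[of "insert C \<S>"] by blast
  obtain p where "p \<in> X" "\<forall>E\<in>\<B>. E \<in> U p \<longleftrightarrow> (\<forall>\<^sub>F c in F. c \<in> E)"
    using ex_point_of_ultra[OF F(1)] F(2) by auto
  then show ?thesis using F(2) assms(1) by (intro bexI[of _ p]) auto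
qed

text \<open>Every point is induced by an ultrafilter on the underlying set; double limits are applied to
  these.\<close>
lemma point_ultra:
  assumes "p \<in> X"
  shows "\<exists>F. ultra F \<and> (\<forall>\<^sub>F c in F. c \<in> C) \<and> (\<forall>E\<in>\<B>. E \<in> U p \<longleftrightarrow> (\<forall>\<^sub>F c in F. c \<in> E))"
proof -
  have "\<Inter>\<F> \<noteq> {}" if "finite \<F>" "\<F> \<subseteq> U p" for \<F>
    using U_fin[OF assms that] by auto
  then obtain F where F: "ultra F" "\<forall>S\<in>U p. \<forall>\<^sub>F c in F. c \<in> S"
    using ultra_of_fip[of "U p"] by blast
  have "\<not> (\<forall>\<^sub>F c in F. c \<in> E)" if "E \<in> \<B>" "E \<notin> U p" for E
  proof -
    have "\<forall>\<^sub>F c in F. c \<in> C - E" using F(2) U_Diff that assms by blast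
    then show ?thesis unfolding ultra_not[OF F(1), symmetric] by (auto elim: eventually_mono)
  qed
  then show ?thesis using F U_space[OF assms] by blast
qed

lemma cl_sub: "cl E \<subseteq> X" by (auto simp: cl_def)
lemma cl_space [simp]: "cl C = X" by (auto simp: cl_def U_space)
lemma cl_empty [simp]: "cl {} = {}" by (auto simp: cl_def U_empty)
lemma cl_Int: "E \<in> \<B> \<Longrightarrow> F \<in> \<B> \<Longrightarrow> cl (E \<inter> F) = cl E \<inter> cl F" by (auto simp: cl_def U_Int)
lemma cl_Un: "E \<in> \<B> \<Longrightarrow> F \<in> \<B> \<Longrightarrow> cl (E \<union> F) = cl E \<union> cl F" by (auto simp: cl_def U_Un)
lemma cl_Diff: "E \<in> \<B> \<Longrightarrow> F \<in> \<B> \<Longrightarrow> cl (E - F) = cl E - cl F" by (auto simp: cl_def U_diff)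

lemma cl_mono_iff: assumes "E \<in> \<B>" "F \<in> \<B>" shows "cl E \<subseteq> cl F \<longleftrightarrow> E \<subseteq> F"
proof
  assume "cl E \<subseteq> cl F"
  then have 0: "cl (E - F) = {}" using cl_Diff assms by auto
  have "E - F = {}"
  proof (rule ccontr)
    assume "E - F \<noteq> {}"
    then obtain c where "c \<in> E - F" by blast
    then have "\<exists>p\<in>X. {E - F} \<subseteq> U p"
      using assms sets_into_space[OF assms(1)] by (intro ex_point_fip) auto
    then show False using 0 by (auto simp: cl_def)
  qed
  then show "E \<subseteq> F" by blast
next
  assume "E \<subseteq> F"
  then show "cl E \<subseteq> cl F" using assms U_mono by (auto simp: cl_def)
qed

lemma cl_finite_UN: "finite T \<Longrightarrow> T \<subseteq> \<B> \<Longrightarrow> cl (\<Union>T) = (\<Union>E\<in>T. cl E)"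
proof (induction T rule: finite_induct)
  case (insert E T)
  then have "\<Union>T \<in> \<B>" by auto
  then show ?case using insert cl_Un[of E "\<Union>T"] by auto
qed auto

text \<open>Compactness: otherwise \<open>E\<close> and the complements of the sets in \<open>\<G>\<close> lie in a common ultrafilter.\<close>
lemma cl_compact:
  assumes "E \<in> \<B>" "\<G> \<subseteq> \<B>" "cl E \<subseteq> (\<Union>F\<in>\<G>. cl F)"
  shows "\<exists>T\<subseteq>\<G>. finite T \<and> E \<subseteq> \<Union>T"
proof (rule ccontr)
  assume no: "\<not> ?thesis"
  have "\<exists>p\<in>X. insert E ((\<lambda>F. C - F) ` \<G>) \<subseteq> U p"
  proof (rule ex_point_fip)
    show "insert E ((\<lambda>F. C - F) ` \<G>) \<subseteq> \<B>" using assms by auto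
    fix \<F> assume F: "finite \<F>" "\<F> \<subseteq> insert E ((\<lambda>F. C - F) ` \<G>)"
    then have "finite (\<F> - {E})" "\<F> - {E} \<subseteq> (\<lambda>F. C - F) ` \<G>" by auto
    from finite_subset_image[OF this]
    obtain T where T: "T \<subseteq> \<G>" "finite T" "\<F> - {E} = (\<lambda>F. C - F) ` T" by blast
    then have "\<not> E \<subseteq> \<Union>T" using no by blast
    then obtain c where c: "c \<in> E" "c \<notin> \<Union>T" by blast
    have "c \<in> C" using \<open>c \<in> E\<close> sets_into_space assms(1) by blast
    moreover have "c \<in> D" if "D \<in> \<F>" for D
    proof (cases "D = E")
      case False
      then have "D \<in> (\<lambda>F. C - F) ` T" using T(3) that by blast
      then show ?thesis using c \<open>c \<in> C\<close> by auto
    qed (use c in simp)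
    ultimately show "\<exists>c\<in>C. \<forall>E\<in>\<F>. c \<in> E" by blast
  qed
  then obtain p where p: "p \<in> X" "E \<in> U p" "\<And>F. F \<in> \<G> \<Longrightarrow> C - F \<in> U p" by auto
  then have "p \<in> cl E" by (simp add: cl_def)
  then obtain F where "F \<in> \<G>" "F \<in> U p" using assms(3) by (auto simp: cl_def)
  then show False using p U_Diff assms(2) by blast
qed

lemma topspace_\<tau> [simp]: "topspace \<tau> = X"
  using cl_sub cl_space by (auto simp: \<tau>_def)

lemma openin_cl: "E \<in> \<B> \<Longrightarrow> openin \<tau> (cl E)"
  unfolding \<tau>_def by (rule topology_generated_by_Basis) simp

lemma openin_\<tau>: "openin \<tau> V \<longleftrightarrow> V \<subseteq> X \<and> (\<forall>p\<in>V. \<exists>E\<in>U p. cl E \<subseteq> V)"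
proof
  assume V: "openin \<tau> V"
  then have "generate_topology_on (cl ` \<B>) V" by (simp add: \<tau>_def openin_topology_generated_by)
  then have "\<forall>p\<in>V. p \<in> X \<longrightarrow> (\<exists>E\<in>U p. cl E \<subseteq> V)"
  proof induction
    case (Int a b)
    show ?case
    proof (intro ballI impI)
      fix p assume p: "p \<in> a \<inter> b" "p \<in> X"
      then obtain E F where EF: "E \<in> U p" "cl E \<subseteq> a" "F \<in> U p" "cl F \<subseteq> b" using Int by blast
      then have "E \<in> \<B>" "F \<in> \<B>" using U_sub p by auto
      then show "\<exists>E\<in>U p. cl E \<subseteq> a \<inter> b"
        using EF p by (intro bexI[of _ "E \<inter> F"]) (auto simp: cl_Int U_Int)
    qed
  next
    case (UN K)
    then show ?case by (meson UnionE Union_upper order_trans)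
  next
    case (Basis s)
    then show ?case by (auto simp: cl_def)
  qed auto
  then show "V \<subseteq> X \<and> (\<forall>p\<in>V. \<exists>E\<in>U p. cl E \<subseteq> V)"
    using openin_subset[OF V] by auto
next
  assume V: "V \<subseteq> X \<and> (\<forall>p\<in>V. \<exists>E\<in>U p. cl E \<subseteq> V)"
  have "\<exists>W. openin \<tau> W \<and> p \<in> W \<and> W \<subseteq> V" if "p \<in> V" for p
  proof -
    obtain E where "E \<in> U p" "cl E \<subseteq> V" using V \<open>p \<in> V\<close> by blast
    moreover have "p \<in> X" using V \<open>p \<in> V\<close> by blast
    ultimately show ?thesis
      using openin_cl[OF U_sub] by (intro exI[of _ "cl E"]) (auto simp: cl_def)
  qed
  then show "openin \<tau> V" using openin_subopen by metis
qed

lemma closedin_cl: "E \<in> \<B> \<Longrightarrow> closedin \<tau> (cl E)"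
  using openin_cl[of "C - E"] cl_Diff[of C E] by (simp add: closedin_def cl_sub compl_sets)

lemma compact_space_\<tau>: "compact_space \<tau>"
  unfolding compact_space_alt
proof (intro allI impI)
  fix \<U> assume Us: "Ball \<U> (openin \<tau>) \<and> topspace \<tau> \<subseteq> \<Union>\<U>"
  define \<G> where "\<G> = {E \<in> \<B>. \<exists>V\<in>\<U>. cl E \<subseteq> V}"
  have "X \<subseteq> (\<Union>F\<in>\<G>. cl F)"
  proof
    fix p assume p: "p \<in> X"
    then obtain V where "V \<in> \<U>" "p \<in> V" using Us by auto
    then obtain E where "E \<in> U p" "cl E \<subseteq> V" using Us openin_\<tau> by blast
    then show "p \<in> (\<Union>F\<in>\<G>. cl F)" using p U_sub \<open>V \<in> \<U>\<close> by (auto simp: \<G>_def cl_def)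
  qed
  then obtain T where T: "T \<subseteq> \<G>" "finite T" "C \<subseteq> \<Union>T"
    using cl_compact[of C \<G>] by (auto simp: \<G>_def)
  have "\<forall>E\<in>T. \<exists>V\<in>\<U>. cl E \<subseteq> V" using T(1) by (auto simp: \<G>_def)
  then obtain f where f: "\<And>E. E \<in> T \<Longrightarrow> f E \<in> \<U> \<and> cl E \<subseteq> f E" by metis
  have TB: "T \<subseteq> \<B>" using T(1) by (auto simp: \<G>_def)
  then have "\<Union>T \<in> \<B>" using T by auto
  then have "X \<subseteq> (\<Union>E\<in>T. cl E)"
    using cl_mono_iff[of C "\<Union>T"] cl_finite_UN[OF T(2) TB] T(3) by simp
  then have "topspace \<tau> \<subseteq> \<Union>(f ` T)" using f by fastforce
  then show "\<exists>\<F>. finite \<F> \<and> \<F> \<subseteq> \<U> \<and> topspace \<tau> \<subseteq> \<Union>\<F>"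
    using f T(2) by (intro exI[of _ "f ` T"]) auto
qed

lemma Hausdorff_space_\<tau>: "Hausdorff_space \<tau>"
  unfolding Hausdorff_space_def
proof (intro allI impI)
  fix p q assume pq: "p \<in> topspace \<tau> \<and> q \<in> topspace \<tau> \<and> p \<noteq> q"
  then obtain E where E: "E \<in> \<B>" "\<not> (E \<in> U p \<longleftrightarrow> E \<in> U q)" using point_eqI by auto
  have "disjnt (cl E) (cl (C - E))" "cl (C - E) = X - cl E"
    using cl_Diff[of C E] E by (auto simp: disjnt_def)
  moreover have "openin \<tau> (cl E)" "openin \<tau> (cl (C - E))"
    using openin_cl compl_sets E(1) by auto
  moreover have "p \<in> cl E \<and> q \<in> cl (C - E) \<or> p \<in> cl (C - E) \<and> q \<in> cl E"
    unfolding \<open>cl (C - E) = X - cl E\<close> using E(2) pq by (auto simp: cl_def)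
  ultimately show "\<exists>V W. openin \<tau> V \<and> openin \<tau> W \<and> p \<in> V \<and> q \<in> W \<and> disjnt V W"
    by (metis disjnt_sym)
qed

text \<open>Because of this a regular measure is determined by its values on clopen sets.\<close>
lemma compact_cl_between:
  assumes K: "compactin \<tau> K" and V: "openin \<tau> V" and KV: "K \<subseteq> V"
  shows "\<exists>E\<in>\<B>. K \<subseteq> cl E \<and> cl E \<subseteq> V"
proof -
  define \<G> where "\<G> = {E \<in> \<B>. cl E \<subseteq> V}"
  have "K \<subseteq> \<Union>(cl ` \<G>)"
  proof
    fix p assume p: "p \<in> K"
    then obtain E where "E \<in> U p" "cl E \<subseteq> V" "p \<in> X" using KV V openin_\<tau> by blast
    then show "p \<in> \<Union>(cl ` \<G>)" using U_sub by (auto simp: \<G>_def cl_def)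
  qed
  moreover have "Ball (cl ` \<G>) (openin \<tau>)" by (auto simp: \<G>_def openin_cl)
  ultimately obtain \<F> where F: "finite \<F>" "\<F> \<subseteq> cl ` \<G>" "K \<subseteq> \<Union>\<F>"
    using K unfolding compactin_def by meson
  from finite_subset_image[OF F(1,2)]
  obtain T where T: "T \<subseteq> \<G>" "finite T" "\<F> = cl ` T" by blast
  then have "\<Union>T \<in> \<B>" "cl (\<Union>T) = (\<Union>E\<in>T. cl E)"
    using cl_finite_UN[of T] by (auto simp: \<G>_def)
  then show ?thesis using T F(3) by (intro bexI[of _ "\<Union>T"]) (auto simp: \<G>_def)
qed

end

section \<open>Regular Borel measures on Stone spaces\<close>

lemma sets_borel_of_top: "sets (borel_of_top T) = sigma_sets (topspace T) {V. openin T V}"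
  unfolding borel_of_top_def by (rule sets_measure_of) (auto dest: openin_subset)

lemma space_borel_of_top [simp]: "space (borel_of_top T) = topspace T"
  unfolding borel_of_top_def by (rule space_measure_of) (auto dest: openin_subset)

lemma openin_borel_of_top: "openin T V \<Longrightarrow> V \<in> sets (borel_of_top T)"
  by (simp add: sets_borel_of_top)

lemma closedin_borel_of_top: "closedin T K \<Longrightarrow> K \<in> sets (borel_of_top T)"
  using sets.compl_sets[OF openin_borel_of_top, of T "topspace T - K"]
  by (simp add: closedin_def double_diff)

locale stone_content = stone_space C \<B> X U for C :: "'c set" and \<B> and X :: "'x set" and U +
  fixes m :: "'c set \<Rightarrow> real"
  assumes m_nonneg: "E \<in> \<B> \<Longrightarrow> 0 \<le> m E"
    and m_space: "m C = 1"
    and m_add: "E \<in> \<B> \<Longrightarrow> F \<in> \<B> \<Longrightarrow> E \<inter> F = {} \<Longrightarrow> m (E \<union> F) = m E + m F"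
begin

lemma m_empty: "m {} = 0"
  using m_add[of "{}" "{}"] by simp

lemma m_diff: "E \<in> \<B> \<Longrightarrow> F \<in> \<B> \<Longrightarrow> E \<subseteq> F \<Longrightarrow> m (F - E) = m F - m E"
  using m_add[of E "F - E"] Diff[of F E] by (auto simp: Un_absorb1)

lemma m_mono: "E \<in> \<B> \<Longrightarrow> F \<in> \<B> \<Longrightarrow> E \<subseteq> F \<Longrightarrow> m E \<le> m F"
  using m_diff[of E F] m_nonneg[of "F - E"] Diff[of F E] by auto

lemma m_Un_le: "E \<in> \<B> \<Longrightarrow> F \<in> \<B> \<Longrightarrow> m (E \<union> F) \<le> m E + m F"
  using m_add[of E "F - E"] m_mono[of "F - E" F] Diff[of F E] by auto

lemma m_finite_UN_le:
  "finite I \<Longrightarrow> (\<And>i. i \<in> I \<Longrightarrow> E i \<in> \<B>) \<Longrightarrow> m (\<Union>i\<in>I. E i) \<le> (\<Sum>i\<in>I. m (E i))"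
proof (induction I rule: finite_induct)
  case (insert i I)
  have "(\<Union>i\<in>I. E i) \<in> \<B>" using insert by auto
  then show ?case using m_Un_le[of "E i" "\<Union>i\<in>I. E i"] insert by auto
qed (simp add: m_empty)

text \<open>The outer measure below is built from open sets and not from countable covers by clopen sets.
  In a Stone space with uncountably many clopen sets the latter would only reach the Baire sets.\<close>
definition open_content :: "'x set \<Rightarrow> ennreal" where
  "open_content V = (SUP E\<in>{E \<in> \<B>. cl E \<subseteq> V}. ennreal (m E))"

definition outer :: "'x set \<Rightarrow> ennreal" where
  "outer A = (INF V\<in>{V. openin \<tau> V \<and> A \<subseteq> V}. open_content V)"

lemma open_content_upper: "E \<in> \<B> \<Longrightarrow> cl E \<subseteq> V \<Longrightarrow> ennreal (m E) \<le> open_content V"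
  unfolding open_content_def by (rule SUP_upper) simp

lemma open_content_mono: "V \<subseteq> W \<Longrightarrow> open_content V \<le> open_content W"
  unfolding open_content_def by (rule SUP_subset_mono) auto

lemma open_content_cl: "E \<in> \<B> \<Longrightarrow> open_content (cl E) = ennreal (m E)"
  unfolding open_content_def
  by (rule antisym, rule SUP_least) (auto simp: cl_mono_iff intro!: SUP_upper m_mono ennreal_leI)

lemma outer_open: "openin \<tau> V \<Longrightarrow> outer V = open_content V"
  unfolding outer_def by (rule antisym, rule INF_lower) (auto intro: INF_greatest open_content_mono)

lemma outer_mono: "A \<subseteq> A' \<Longrightarrow> outer A \<le> outer A'"
  unfolding outer_def by (rule INF_superset_mono) auto

text \<open>Countable subadditivity on open sets holds by compactness: a clopen subset of the union is
  already covered by finitely many clopen sets, each inside one of the open sets.\<close>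
lemma open_content_UN:
  fixes V :: "nat \<Rightarrow> 'x set"
  assumes V: "\<And>i. openin \<tau> (V i)"
  shows "open_content (\<Union>i. V i) \<le> (\<Sum>i. open_content (V i))"
  unfolding open_content_def[of "\<Union>i. V i"]
proof (rule SUP_least)
  fix E assume "E \<in> {E \<in> \<B>. cl E \<subseteq> (\<Union>i. V i)}"
  then have E: "E \<in> \<B>" "cl E \<subseteq> (\<Union>i. V i)" by auto
  define \<G> where "\<G> = {F \<in> \<B>. \<exists>i. cl F \<subseteq> V i}"
  have "cl E \<subseteq> (\<Union>F\<in>\<G>. cl F)"
  proof
    fix p assume p: "p \<in> cl E"
    then obtain i where "p \<in> V i" using E by blast
    then obtain F where "F \<in> U p" "cl F \<subseteq> V i" using V openin_\<tau> by blast
    moreover have "p \<in> X" using p cl_sub by blast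
    ultimately show "p \<in> (\<Union>F\<in>\<G>. cl F)" using U_sub by (auto simp: \<G>_def cl_def)
  qed
  then obtain T where T: "T \<subseteq> \<G>" "finite T" "E \<subseteq> \<Union>T"
    using cl_compact[OF E(1), of \<G>] by (auto simp: \<G>_def)
  have "\<forall>F\<in>T. \<exists>i. cl F \<subseteq> V i" using T(1) by (auto simp: \<G>_def)
  then obtain f where f: "\<And>F. F \<in> T \<Longrightarrow> cl F \<subseteq> V (f F)" by metis
  define D where "D i = \<Union>{F \<in> T. f F = i}" for i
  have TB: "{F \<in> T. f F = i} \<subseteq> \<B>" "finite {F \<in> T. f F = i}" for i
    using T by (auto simp: \<G>_def)
  have D: "D i \<in> \<B>" "cl (D i) \<subseteq> V i" for i
    using TB[of i] cl_finite_UN[OF TB(2,1), of i] f by (auto simp: D_def)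
  have "\<Union>T \<subseteq> (\<Union>i\<in>f ` T. D i)" unfolding D_def by blast
  then have "E \<subseteq> (\<Union>i\<in>f ` T. D i)" using T(3) by blast
  then have "m E \<le> m (\<Union>i\<in>f ` T. D i)" using E(1) D(1) T(2) by (intro m_mono) auto
  also have "\<dots> \<le> (\<Sum>i\<in>f ` T. m (D i))" using T(2) D(1) by (intro m_finite_UN_le) auto
  finally have "ennreal (m E) \<le> ennreal (\<Sum>i\<in>f ` T. m (D i))" by (rule ennreal_leI)
  also have "\<dots> = (\<Sum>i\<in>f ` T. ennreal (m (D i)))"
    using D(1) m_nonneg by (simp add: sum_ennreal)
  also have "\<dots> \<le> (\<Sum>i\<in>f ` T. open_content (V i))"
    using D by (intro sum_mono open_content_upper)
  also have "\<dots> \<le> (\<Sum>i. open_content (V i))"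
    using T(2) by (intro sum_le_suminf) auto
  finally show "ennreal (m E) \<le> (\<Sum>i. open_content (V i))" .
qed

lemma outer_countably_subadditive: "countably_subadditive (Pow X) outer"
  unfolding countably_subadditive_def
proof (intro allI impI)
  fix A :: "nat \<Rightarrow> 'x set"
  assume A: "range A \<subseteq> Pow X"
  show "outer (\<Union>i. A i) \<le> (\<Sum>n. outer (A n))"
  proof (rule ennreal_le_epsilon)
    fix e :: real assume e: "0 < e" and "(\<Sum>n. outer (A n)) < top_class.top"
    then have *: "outer (A n) < outer (A n) + e * (1/2)^Suc n" for n
      by (auto simp add: less_top dest!: ennreal_suminf_lessD)
    have "\<exists>V. openin \<tau> V \<and> A n \<subseteq> V \<and> open_content V < outer (A n) + e * (1/2)^Suc n" for n
      using *[of n] unfolding outer_def[of "A n"] INF_less_iff by auto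
    then obtain V where V: "\<And>n. openin \<tau> (V n)" "\<And>n. A n \<subseteq> V n"
      "\<And>n. open_content (V n) < outer (A n) + e * (1/2)^Suc n" by metis
    have "outer (\<Union>i. A i) \<le> outer (\<Union>i. V i)" using V(2) by (intro outer_mono) blast
    also have "\<dots> = open_content (\<Union>i. V i)" using V(1) by (intro outer_open) auto
    also have "\<dots> \<le> (\<Sum>i. open_content (V i))" using V(1) by (rule open_content_UN)
    also have "\<dots> \<le> (\<Sum>n. outer (A n) + e * (1/2) ^ Suc n)"
      using V(3) by (intro suminf_le allI less_imp_le) auto
    also have "... = (\<Sum>n. outer (A n)) + (\<Sum>n. ennreal e * ennreal ((1/2) ^ Suc n))"
      using e by (subst suminf_add[symmetric])
        (auto simp del: ennreal_suminf_cmult simp add: ennreal_mult[symmetric])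
    also have "\<dots> = (\<Sum>n. outer (A n)) + e"
      unfolding ennreal_suminf_cmult
      by (subst suminf_ennreal_eq[OF zero_le_power power_half_series]) auto
    finally show "outer (\<Union>i. A i) \<le> (\<Sum>n. outer (A n)) + e" .
  qed
qed

lemma outer_measure_space_outer: "outer_measure_space (Pow X) outer"
proof -
  have "outer {} = 0" using outer_open[of "{}"] open_content_cl[of "{}"] m_empty by simp
  then show ?thesis
    using outer_countably_subadditive outer_mono
    by (simp add: outer_measure_space_def positive_def increasing_def)
qed

lemma outer_Un_le: assumes "A \<subseteq> X" "A' \<subseteq> X" shows "outer (A \<union> A') \<le> outer A + outer A'"
proof -
  interpret P: sigma_algebra X "Pow X" by (rule sigma_algebra_Pow)
  have "subadditive (Pow X) outer"
    using outer_measure_space_outer P.countably_subadditive_subadditive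
    by (auto simp: outer_measure_space_def)
  then have "outer (A \<union> (A' - A)) \<le> outer A + outer (A' - A)"
    using assms unfolding subadditive_def by blast
  also have "\<dots> \<le> outer A + outer A'" by (intro add_left_mono outer_mono) auto
  finally show ?thesis by simp
qed

text \<open>A clopen \<open>E\<close> inside \<open>W \<inter> V\<close> and a clopen set inside \<open>W - cl E\<close> are disjoint and lie in \<open>W\<close>;
  take suprema first over the second and then over \<open>E\<close>.\<close>
lemma open_splits_open:
  assumes V: "openin \<tau> V" and W: "openin \<tau> W"
  shows "outer (W \<inter> V) + outer (W - V) \<le> outer W"
proof -
  have "ennreal (m E) + outer (W - V) \<le> outer W" if E: "E \<in> \<B>" "cl E \<subseteq> W \<inter> V" for E
  proof -
    have op: "openin \<tau> (W - cl E)" using W closedin_cl[OF E(1)] by (rule openin_diff)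
    have "outer (W - V) \<le> outer (W - cl E)" using E by (intro outer_mono) auto
    also have "\<dots> = open_content (W - cl E)" by (rule outer_open[OF op])
    finally have "ennreal (m E) + outer (W - V) \<le> ennreal (m E) + open_content (W - cl E)"
      by (intro add_left_mono)
    also have "\<dots> = (SUP F\<in>{F \<in> \<B>. cl F \<subseteq> W - cl E}. ennreal (m E) + ennreal (m F))"
      unfolding open_content_def by (rule ennreal_SUP_add_right) (auto intro!: exI[of _ "{}"])
    also have "\<dots> \<le> open_content W"
    proof (rule SUP_least)
      fix F assume "F \<in> {F \<in> \<B>. cl F \<subseteq> W - cl E}"
      then have F: "F \<in> \<B>" "cl F \<subseteq> W - cl E" by auto
      then have "cl (E \<inter> F) \<subseteq> cl {}" using E(1) by (auto simp: cl_Int)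
      then have "E \<inter> F = {}" using cl_mono_iff[of "E \<inter> F" "{}"] E(1) F(1) by auto
      then have "ennreal (m E) + ennreal (m F) = ennreal (m (E \<union> F))"
        using E(1) F(1) by (simp add: m_add m_nonneg ennreal_plus)
      also have "\<dots> \<le> open_content W"
        using E F by (intro open_content_upper) (auto simp: cl_Un)
      finally show "ennreal (m E) + ennreal (m F) \<le> open_content W" .
    qed
    finally show ?thesis using outer_open[OF W] by simp
  qed
  then have "(SUP E\<in>{E \<in> \<B>. cl E \<subseteq> W \<inter> V}. ennreal (m E) + outer (W - V)) \<le> outer W"
    by (intro SUP_least) auto
  moreover have "(SUP E\<in>{E \<in> \<B>. cl E \<subseteq> W \<inter> V}. ennreal (m E) + outer (W - V)) =
      outer (W \<inter> V) + outer (W - V)"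
    unfolding outer_open[OF openin_Int[OF W V]] open_content_def
    by (rule ennreal_SUP_add_left) (auto intro!: exI[of _ "{}"])
  ultimately show ?thesis by simp
qed

lemma open_in_lambda_system:
  assumes V: "openin \<tau> V"
  shows "V \<in> lambda_system X (Pow X) outer"
proof -
  interpret P: sigma_algebra X "Pow X" by (rule sigma_algebra_Pow)
  have VX: "V \<subseteq> X" using openin_subset[OF V] by simp
  have "outer (A \<inter> V) + outer (A - V) = outer A" if A: "A \<subseteq> X" for A
  proof (rule antisym)
    show "outer (A \<inter> V) + outer (A - V) \<le> outer A"
      unfolding outer_def[of A]
    proof (rule INF_greatest)
      fix W assume "W \<in> {W. openin \<tau> W \<and> A \<subseteq> W}"
      then have W: "openin \<tau> W" "A \<subseteq> W" by auto
      have "outer (A \<inter> V) + outer (A - V) \<le> outer (W \<inter> V) + outer (W - V)"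
        using W(2) by (intro add_mono outer_mono) auto
      also have "\<dots> \<le> outer W" by (rule open_splits_open[OF V W(1)])
      finally show "outer (A \<inter> V) + outer (A - V) \<le> open_content W"
        using outer_open[OF W(1)] by simp
    qed
    have "outer ((A \<inter> V) \<union> (A - V)) \<le> outer (A \<inter> V) + outer (A - V)"
      using A by (intro outer_Un_le) auto
    then show "outer A \<le> outer (A \<inter> V) + outer (A - V)" by (simp add: Int_Diff_Un)
  qed
  then show ?thesis using VX by (auto simp: P.lambda_system_eq)
qed

lemma ex_regular_borel:
  "\<exists>P. regular_borel_prob \<tau> P \<and> (\<forall>E\<in>\<B>. measure P (cl E) = m E)"
proof -
  interpret P: sigma_algebra X "Pow X" by (rule sigma_algebra_Pow)
  let ?L = "lambda_system X (Pow X) outer" and ?S = "sigma_sets X {V. openin \<tau> V}"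
  define P where "P = measure_of X ?S outer"
  have ms: "measure_space X ?L outer"
    by (rule P.caratheodory_lemma[OF outer_measure_space_outer])
  interpret L: sigma_algebra X ?L using ms by (simp add: measure_space_def)
  have SL: "?S \<subseteq> ?L" using open_in_lambda_system by (intro L.sigma_sets_subset) auto
  have S: "sigma_algebra X ?S"
    by (rule sigma_algebra_sigma_sets) (use openin_subset in force)
  interpret S: sigma_algebra X ?S by (rule S)
  have ca: "countably_additive ?S outer"
    using ms SL unfolding measure_space_def countably_additive_def by (meson order_trans subsetD)
  have pos: "positive ?S outer" using ms by (simp add: measure_space_def positive_def)
  have em: "emeasure P A = outer A" if "A \<in> ?S" for A
    unfolding P_def by (rule emeasure_measure_of_sigma[OF S pos ca that])
  have sets: "sets P = ?S" "space P = X"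
    unfolding P_def by (auto simp: S.sets_measure_of_eq S.space_measure_of_eq)
  have cl: "emeasure P (cl E) = ennreal (m E)" if "E \<in> \<B>" for E
    using em[of "cl E"] openin_cl[OF that] outer_open open_content_cl[OF that] by auto
  interpret prob_space P
    by (rule prob_spaceI) (use cl[of C] in \<open>simp add: sets m_space\<close>)
  have approx: "\<exists>V. openin \<tau> V \<and> B \<subseteq> V \<and> measure P V < measure P B + e"
    if B: "B \<in> ?S" and e: "e > 0" for B e
  proof -
    have "outer B < emeasure P B + ennreal e"
      using em[OF B, symmetric] e by (simp add: emeasure_eq_measure ennreal_less_iff flip: ennreal_plus)
    then obtain V where V: "openin \<tau> V" "B \<subseteq> V" "open_content V < emeasure P B + ennreal e"
      unfolding outer_def INF_less_iff by auto
    have "emeasure P V < emeasure P B + ennreal e"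
      using V em[of V] outer_open[OF V(1)] by auto
    then show ?thesis
      using V e by (auto simp: emeasure_eq_measure ennreal_less_iff simp flip: ennreal_plus)
  qed
  have "regular_borel_prob \<tau> P"
    unfolding regular_borel_prob_def
  proof (intro conjI ballI allI impI)
    fix B and e :: real assume B: "B \<in> sets P" and e: "0 < e"
    then have B': "B \<in> ?S" "X - B \<in> ?S" using sets by auto
    obtain V where V: "openin \<tau> V" "B \<subseteq> V" "measure P V < measure P B + e/2"
      using approx[OF B'(1), of "e/2"] e by auto
    obtain W where W: "openin \<tau> W" "X - B \<subseteq> W" "measure P W < measure P (X - B) + e/2"
      using approx[OF B'(2), of "e/2"] e by auto
    have WX: "W \<subseteq> X" using openin_subset[OF W(1)] by simp
    have Wm: "W \<in> sets P" using W(1) sets by auto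
    have "measure P (X - W) = 1 - measure P W" "measure P (X - B) = 1 - measure P B"
      using prob_compl[OF Wm] prob_compl[OF B] sets by simp_all
    then have "measure P V - measure P (X - W) < e" using V(3) W(3) by simp
    moreover have "compactin \<tau> (X - W)"
      by (rule closedin_compact_space[OF compact_space_\<tau>])
        (simp add: closedin_def double_diff WX W(1))
    moreover have "X - W \<in> sets P" using Wm sets sets.compl_sets by metis
    moreover have "X - W \<subseteq> B" using W(2) by auto
    ultimately show "\<exists>K V. compactin \<tau> K \<and> K \<in> sets P \<and> openin \<tau> V \<and> K \<subseteq> B \<and> B \<subseteq> V \<and>
        measure P V - measure P K < e"
      using V by blast
  qed (use sets in \<open>simp_all add: prob_space_axioms sets_borel_of_top\<close>)
  moreover have "measure P (cl E) = m E" if "E \<in> \<B>" for E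
    using cl[OF that] m_nonneg[OF that] by (simp add: measure_def)
  ultimately show ?thesis by blast
qed

text \<open>Both measures agree on a clopen set between a compact subset of \<open>V\<close> of almost full measure
  and \<open>V\<close> itself.\<close>
lemma regular_borel_open_le:
  assumes P: "regular_borel_prob \<tau> P" "\<forall>E\<in>\<B>. measure P (cl E) = m E"
    and Q: "regular_borel_prob \<tau> Q" "\<forall>E\<in>\<B>. measure Q (cl E) = m E"
    and V: "openin \<tau> V"
  shows "measure P V \<le> measure Q V"
proof (rule field_le_epsilon)
  fix e :: real assume e: "0 < e"
  interpret P: prob_space P using P by (simp add: regular_borel_prob_def)
  interpret Q: prob_space Q using Q by (simp add: regular_borel_prob_def)
  have sets: "sets P = sets (borel_of_top \<tau>)" "sets Q = sets (borel_of_top \<tau>)"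
    using P Q by (simp_all add: regular_borel_prob_def)
  have op: "W \<in> sets P" "W \<in> sets Q" if "openin \<tau> W" for W
    using sets openin_borel_of_top[OF that] by auto
  obtain K W where K: "compactin \<tau> K" "K \<in> sets P" "openin \<tau> W" "K \<subseteq> V" "V \<subseteq> W"
    "measure P W - measure P K < e"
    using P(1) op(1)[OF V] e unfolding regular_borel_prob_def by blast
  obtain E where E: "E \<in> \<B>" "K \<subseteq> cl E" "cl E \<subseteq> V"
    using compact_cl_between[OF K(1) V K(4)] by blast
  have "measure P V \<le> measure P W" using K op by (intro P.finite_measure_mono) auto
  also have "\<dots> \<le> measure P K + e" using K(6) by simp
  also have "measure P K \<le> measure P (cl E)"
    using E op[OF openin_cl] by (intro P.finite_measure_mono) auto
  also have "measure P (cl E) = measure Q (cl E)" using P(2) Q(2) E(1) by simp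
  also have "\<dots> \<le> measure Q V" using E op V by (intro Q.finite_measure_mono) auto
  finally show "measure P V \<le> measure Q V + e" by simp
qed

lemma regular_borel_unique:
  assumes P: "regular_borel_prob \<tau> P" "\<forall>E\<in>\<B>. measure P (cl E) = m E"
    and Q: "regular_borel_prob \<tau> Q" "\<forall>E\<in>\<B>. measure Q (cl E) = m E"
  shows "P = Q"
proof -
  interpret P: prob_space P using P by (simp add: regular_borel_prob_def)
  interpret Q: prob_space Q using Q by (simp add: regular_borel_prob_def)
  have "measure P V = measure Q V" if "openin \<tau> V" for V
    using regular_borel_open_le[OF P Q that] regular_borel_open_le[OF Q P that] by simp
  moreover have "sets P = sigma_sets X {V. openin \<tau> V}" "sets Q = sigma_sets X {V. openin \<tau> V}"
    using P(1) Q(1) by (simp_all add: regular_borel_prob_def sets_borel_of_top)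
  moreover have "openin \<tau> X" using openin_topspace[of \<tau>] by simp
  ultimately show ?thesis
    by (intro measure_eqI_generator_eq[where E="{V. openin \<tau> V}" and \<Omega>=X and A="\<lambda>_. X"])
      (use openin_subset in \<open>force simp: Int_stable_def P.emeasure_eq_measure Q.emeasure_eq_measure\<close>)+
qed

definition supp :: "'x set" where
  "supp = {p \<in> X. \<forall>E\<in>U p. m E > 0}"

lemma closedin_supp: "closedin \<tau> supp"
proof -
  have "openin \<tau> (X - supp)"
    unfolding openin_\<tau>
  proof (intro conjI ballI)
    fix p assume "p \<in> X - supp"
    then obtain E where E: "E \<in> U p" "m E \<le> 0" "E \<in> \<B>"
      using U_sub by (auto simp: supp_def not_less)
    then have "cl E \<subseteq> X - supp" by (auto simp: cl_def supp_def not_less)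
    then show "\<exists>E\<in>U p. cl E \<subseteq> X - supp" using E by blast
  qed auto
  then show ?thesis by (auto simp: closedin_def supp_def)
qed

text \<open>The complement of the support is a union of clopen null sets.  A compact part of it is covered by
  finitely many of them, and regularity does the rest.\<close>
lemma AE_supp:
  assumes P: "regular_borel_prob \<tau> P" "\<forall>E\<in>\<B>. measure P (cl E) = m E"
  shows "AE p in P. p \<in> supp"
proof -
  interpret P: prob_space P using P by (simp add: regular_borel_prob_def)
  have sets: "sets P = sets (borel_of_top \<tau>)" "space P = X"
    using P by (simp_all add: regular_borel_prob_def)
  have op: "openin \<tau> (X - supp)" using closedin_supp by (simp add: closedin_def)
  then have opm: "X - supp \<in> sets P" using sets openin_borel_of_top by auto
  have "measure P (X - supp) \<le> e" if e: "0 < e" for e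
  proof -
    obtain K W where K: "compactin \<tau> K" "K \<in> sets P" "openin \<tau> W" "K \<subseteq> X - supp" "X - supp \<subseteq> W"
      "measure P W - measure P K < e"
      using P(1) opm e unfolding regular_borel_prob_def by blast
    define \<G> where "\<G> = {E \<in> \<B>. m E = 0}"
    have "K \<subseteq> \<Union>(cl ` \<G>)"
    proof
      fix p assume "p \<in> K"
      then have "p \<in> X" "p \<notin> supp" using K(4) by auto
      then obtain E where "E \<in> U p" "m E \<le> 0" "E \<in> \<B>"
        using U_sub by (auto simp: supp_def not_less)
      then have "E \<in> \<G>" "p \<in> cl E"
        using m_nonneg[of E] \<open>p \<in> X\<close> by (auto simp: \<G>_def cl_def)
      then show "p \<in> \<Union>(cl ` \<G>)" by blast
    qed
    moreover have "Ball (cl ` \<G>) (openin \<tau>)" by (auto simp: \<G>_def openin_cl)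
    ultimately obtain \<F> where F: "finite \<F>" "\<F> \<subseteq> cl ` \<G>" "K \<subseteq> \<Union>\<F>"
      using K(1) unfolding compactin_def by meson
    from finite_subset_image[OF F(1,2)]
    obtain T where T: "T \<subseteq> \<G>" "finite T" "\<F> = cl ` T" by blast
    then have TB: "T \<subseteq> \<B>" "\<Union>T \<in> \<B>" by (auto simp: \<G>_def)
    have "K \<subseteq> cl (\<Union>T)" using F(3) T cl_finite_UN[OF T(2) TB(1)] by simp
    then have "measure P K \<le> measure P (cl (\<Union>T))"
      using openin_borel_of_top[OF openin_cl[OF TB(2)]] by (intro P.finite_measure_mono) (simp_all add: sets(1))
    also have "\<dots> = m (\<Union>E\<in>T. E)" using P(2) TB by simp
    also have "\<dots> \<le> (\<Sum>E\<in>T. m E)" using T(2) TB by (intro m_finite_UN_le) auto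
    also have "\<dots> = 0" using T(1) by (auto simp: \<G>_def intro: sum.neutral)
    finally have "measure P W < e" using K(6) by simp
    moreover have "measure P (X - supp) \<le> measure P W"
      using K sets openin_borel_of_top by (intro P.finite_measure_mono) auto
    ultimately show ?thesis by simp
  qed
  then have "measure P (X - supp) \<le> 0" by (rule field_le_epsilon) simp
  then have "emeasure P (X - supp) = 0"
    by (simp add: P.emeasure_eq_measure measure_le_0_iff)
  then show ?thesis
    using opm sets by (intro AE_I[of _ _ "X - supp"]) auto
qed

end

text \<open>Such a set is a union of atoms of the finite algebra generated by \<open>\<F>\<close>.\<close>
lemma (in algebra) pattern_determined_mem:
  assumes "S \<subseteq> \<Omega>" "finite \<F>" "\<F> \<subseteq> M"
    and "\<And>b b'. b \<in> \<Omega> \<Longrightarrow> b' \<in> \<Omega> \<Longrightarrow> \<forall>F\<in>\<F>. b \<in> F \<longleftrightarrow> b' \<in> F \<Longrightarrow> b \<in> S \<longleftrightarrow> b' \<in> S"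
  shows "S \<in> M"
proof -
  define pat where "pat c = {F \<in> \<F>. c \<in> F}" for c
  define atom where "atom T = \<Omega> \<inter> \<Inter>T - \<Union>(\<F> - T)" for T
  have atom: "atom T \<in> M" if "T \<subseteq> \<F>" for T
  proof -
    have "finite T" "T \<subseteq> M" "finite (\<F> - T)" "\<F> - T \<subseteq> M"
      using that assms finite_subset by auto
    then have "\<Union>(\<F> - T) \<in> M" "\<Omega> \<inter> \<Inter>T \<in> M"
      using finite_INT[of T "\<lambda>x. x"] sets_into_space by (cases "T = {}"; force)+
    then show ?thesis unfolding atom_def by (rule Diff[rotated])
  qed
  have mem: "c \<in> atom (pat c)" if "c \<in> \<Omega>" for c using that by (auto simp: atom_def pat_def)
  have same: "b \<in> S" if "b \<in> atom (pat c)" "c \<in> S" for b c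
  proof -
    have "\<forall>F\<in>\<F>. b \<in> F \<longleftrightarrow> c \<in> F" "b \<in> \<Omega>" "c \<in> \<Omega>"
      using that assms(1) by (auto simp: atom_def pat_def)
    then show ?thesis using assms(4) that by blast
  qed
  have "S = \<Union>(atom ` pat ` S)" using mem same assms(1) by blast
  moreover have "finite (pat ` S)" by (rule finite_subset[of _ "Pow \<F>"]) (auto simp: pat_def assms(2))
  then have "\<Union>(atom ` pat ` S) \<in> M" using atom by (intro finite_Union) (auto simp: pat_def)
  ultimately show ?thesis by simp
qed

lemma finite_representatives:
  assumes "finite \<F>"
  shows "\<exists>A\<subseteq>C. finite A \<and> (\<forall>c\<in>C. \<exists>a\<in>A. \<forall>F\<in>\<F>. a \<in> F \<longleftrightarrow> c \<in> F)"
proof -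
  define pat where "pat c = {F \<in> \<F>. c \<in> F}" for c
  have "finite (pat ` C)" by (rule finite_subset[of _ "Pow \<F>"]) (auto simp: pat_def assms)
  from finite_subset_image[OF this order_refl]
  obtain A where A: "A \<subseteq> C" "finite A" "pat ` C = pat ` A" by blast
  have "\<exists>a\<in>A. \<forall>F\<in>\<F>. a \<in> F \<longleftrightarrow> c \<in> F" if "c \<in> C" for c
  proof -
    have "pat c \<in> pat ` A" using A(3) that by blast
    then obtain a where a: "pat c = pat a" "a \<in> A" by (rule imageE)
    then have "\<forall>F\<in>\<F>. a \<in> F \<longleftrightarrow> c \<in> F" unfolding pat_def by blast
    then show ?thesis using a by blast
  qed
  then show ?thesis using A by blast
qed

context stone_space
begin

lemma point_pattern:
  assumes "p \<in> X" "finite \<F>" "\<F> \<subseteq> \<B>"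
  shows "\<exists>c\<in>C. \<forall>F\<in>\<F>. c \<in> F \<longleftrightarrow> F \<in> U p"
proof -
  define \<S> where "\<S> = {F \<in> \<F>. F \<in> U p} \<union> (\<lambda>F. C - F) ` {F \<in> \<F>. F \<notin> U p}"
  have "finite \<S>" "\<S> \<subseteq> U p" using assms U_Diff by (auto simp: \<S>_def)
  then obtain c where "c \<in> C" "\<forall>S\<in>\<S>. c \<in> S" using U_fin assms(1) by blast
  then show ?thesis by (intro bexI[of _ c]) (auto simp: \<S>_def)
qed

lemma U_finite_Inter:
  assumes "p \<in> X" "finite T" "T \<subseteq> U p"
  shows "C \<inter> \<Inter>T \<in> U p"
  using assms(2,3)
proof (induction T rule: finite_induct)
  case empty
  then show ?case using U_space[OF assms(1)] by simp
next
  case (insert E T)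
  then have "C \<inter> \<Inter>T \<in> \<B>" "E \<in> \<B>" "C \<inter> \<Inter>T \<in> U p" "E \<in> U p"
    using U_sub[OF assms(1)] by auto
  then have "E \<inter> (C \<inter> \<Inter>T) \<in> U p" using U_Int[OF assms(1)] by blast
  moreover have "C \<inter> \<Inter>(insert E T) = E \<inter> (C \<inter> \<Inter>T)" by auto
  ultimately show ?case by simp
qed

lemma continuous_map_real:
  assumes "\<And>p e. p \<in> X \<Longrightarrow> e > 0 \<Longrightarrow> \<exists>D\<in>U p. \<forall>q\<in>cl D. \<bar>f q - f p\<bar> \<le> (e::real)"
  shows "continuous_map \<tau> euclideanreal f"
  unfolding continuous_map_def
proof (intro conjI allI impI)
  fix V :: "real set" assume "openin euclideanreal V"
  then have V: "open V" by simp
  show "openin \<tau> {p \<in> topspace \<tau>. f p \<in> V}"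
    unfolding openin_\<tau>
  proof (intro conjI ballI)
    fix p assume p: "p \<in> {p \<in> topspace \<tau>. f p \<in> V}"
    then obtain e where e: "e > 0" "\<And>y. \<bar>y - f p\<bar> < e \<Longrightarrow> y \<in> V"
      using V by (auto simp: open_dist dist_real_def)
    obtain D where "D \<in> U p" "\<forall>q\<in>cl D. \<bar>f q - f p\<bar> \<le> e/2" using assms[of p "e/2"] p e by auto
    then show "\<exists>D\<in>U p. cl D \<subseteq> {p \<in> topspace \<tau>. f p \<in> V}"
      using e cl_sub by (intro bexI[of _ D]) force+
  qed auto
qed auto

lemma continuous_map_\<tau>:
  assumes "\<And>V. V \<in> cl ` \<B> \<Longrightarrow> openin T (f -` V \<inter> topspace T)"
    and "f ` topspace T \<subseteq> \<Union> (cl ` \<B>)"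
  shows "continuous_map T \<tau> f"
  unfolding \<tau>_def using assms by (rule continuous_on_generated_topo)

lemma closed_attains_sup:
  assumes "closedin \<tau> K" "K \<noteq> {}" "continuous_map \<tau> euclideanreal f"
  shows "\<exists>p\<in>K. \<forall>q\<in>K. f q \<le> f p"
proof -
  have "compactin \<tau> K" using closedin_compact_space[OF compact_space_\<tau> assms(1)] .
  then have "compact (f ` K)" using image_compactin[OF _ assms(3)] by simp
  then show ?thesis using compact_attains_sup[of "f ` K"] assms(2) by auto
qed

lemma continuous_map_measurable:
  assumes "continuous_map \<tau> euclideanreal f"
  shows "f \<in> borel_measurable (borel_of_top \<tau>)"
proof (rule borel_measurableI)
  fix S :: "real set" assume "open S"
  then have "openin \<tau> {p \<in> topspace \<tau>. f p \<in> S}" using assms by (simp add: continuous_map_def)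
  moreover have "{p \<in> topspace \<tau>. f p \<in> S} = f -` S \<inter> space (borel_of_top \<tau>)" by auto
  ultimately show "f -` S \<inter> space (borel_of_top \<tau>) \<in> sets (borel_of_top \<tau>)"
    using openin_borel_of_top by metis
qed

end

definition sym_diff_set :: "'c set \<Rightarrow> 'c set \<Rightarrow> 'c set" where
  "sym_diff_set E F = (E - F) \<union> (F - E)"

context stone_content
begin

lemma sym_diff_mem: "E \<in> \<B> \<Longrightarrow> F \<in> \<B> \<Longrightarrow> sym_diff_set E F \<in> \<B>"
  by (auto simp: sym_diff_set_def)

lemma U_sym_diff:
  "p \<in> X \<Longrightarrow> E \<in> \<B> \<Longrightarrow> F \<in> \<B> \<Longrightarrow> sym_diff_set E F \<in> U p \<longleftrightarrow> (E \<in> U p \<longleftrightarrow> F \<notin> U p)"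
  unfolding sym_diff_set_def by (subst U_Un) (auto simp: U_diff)

lemma m_sym_diff_triangle:
  assumes "E \<in> \<B>" "F \<in> \<B>" "H \<in> \<B>"
  shows "m (sym_diff_set E H) \<le> m (sym_diff_set E F) + m (sym_diff_set F H)"
proof -
  have "m (sym_diff_set E H) \<le> m (sym_diff_set E F \<union> sym_diff_set F H)"
    using assms sym_diff_mem by (intro m_mono) (auto simp: sym_diff_set_def)
  also have "\<dots> \<le> m (sym_diff_set E F) + m (sym_diff_set F H)"
    using assms sym_diff_mem by (intro m_Un_le) auto
  finally show ?thesis .
qed

lemma m_sym_diff_commute: "m (sym_diff_set E F) = m (sym_diff_set F E)"
  by (simp add: sym_diff_set_def Un_commute)

lemma abs_m_diff_le:
  assumes "E \<in> \<B>" "F \<in> \<B>"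
  shows "\<bar>m E - m F\<bar> \<le> m (sym_diff_set E F)"
proof -
  have *: "m E \<le> m F + m (sym_diff_set E F)" if "E \<in> \<B>" "F \<in> \<B>" for E F
  proof -
    have "m E \<le> m (F \<union> sym_diff_set E F)"
      using that sym_diff_mem by (intro m_mono) (auto simp: sym_diff_set_def)
    also have "\<dots> \<le> m F + m (sym_diff_set E F)"
      using that sym_diff_mem by (intro m_Un_le) auto
    finally show ?thesis .
  qed
  from *[OF assms] *[OF assms(2,1)] show ?thesis using m_sym_diff_commute[of E F] by linarith
qed

text \<open>The limit superior of the corresponding clopen sets has measure at least \<open>\<epsilon>\<close> for the regular
  Borel extension of \<open>m\<close>, so it is not empty.\<close>
lemma ex_point_infinitely_often:
  fixes E :: "nat \<Rightarrow> 'c set"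
  assumes E: "\<And>n. E n \<in> \<B>" "\<And>n. \<epsilon> \<le> m (E n)" and "\<epsilon> > 0"
  shows "\<exists>p\<in>X. infinite {n. E n \<in> U p}"
proof -
  obtain P where P: "regular_borel_prob \<tau> P" "\<forall>E\<in>\<B>. measure P (cl E) = m E"
    using ex_regular_borel by blast
  interpret P: prob_space P using P by (simp add: regular_borel_prob_def)
  have sets: "sets P = sets (borel_of_top \<tau>)" using P by (simp add: regular_borel_prob_def)
  define V where "V n = (\<Union>k\<in>{n..}. cl (E k))" for n
  have cl: "cl (E n) \<in> sets P" for n using sets openin_borel_of_top[OF openin_cl[OF E(1)]] by simp
  have V: "V n \<in> sets P" for n using cl unfolding V_def by (intro sets.countable_UN'') auto
  have "decseq V" unfolding decseq_def V_def by (auto intro: order_trans)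
  then have "(\<lambda>n. measure P (V n)) \<longlonglongrightarrow> measure P (\<Inter>n. V n)"
    using V by (intro P.finite_Lim_measure_decseq) auto
  moreover have "\<epsilon> \<le> measure P (V n)" for n
  proof -
    have "\<epsilon> \<le> measure P (cl (E n))" using E P(2) by simp
    also have "\<dots> \<le> measure P (V n)" using V by (intro P.finite_measure_mono) (auto simp: V_def)
    finally show ?thesis .
  qed
  ultimately have "\<epsilon> \<le> measure P (\<Inter>n. V n)" by (intro LIMSEQ_le_const) auto
  then have "(\<Inter>n. V n) \<noteq> {}" using \<open>\<epsilon> > 0\<close> by auto
  then obtain p where p: "\<And>n. p \<in> V n" by blast
  have "p \<in> X" using p[of 0] cl_sub by (auto simp: V_def)
  moreover have "infinite {n. E n \<in> U p}"
    unfolding infinite_nat_iff_unbounded_le using p by (fastforce simp: V_def cl_def)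
  ultimately show ?thesis by blast
qed

text \<open>A finite intersection of members of \<open>\<S>\<close> is not covered by finitely many null sets, so \<open>\<S>\<close>
  together with the complements of the null sets lies in an ultrafilter.\<close>
lemma ex_point_supp:
  assumes "\<S> \<subseteq> \<B>" "\<And>\<F>. finite \<F> \<Longrightarrow> \<F> \<subseteq> \<S> \<Longrightarrow> m (C \<inter> \<Inter>\<F>) > 0"
  shows "\<exists>p\<in>supp. \<S> \<subseteq> U p"
proof -
  define \<N> where "\<N> = {E \<in> \<B>. m E = 0}"
  have "\<exists>p\<in>X. \<S> \<union> (\<lambda>E. C - E) ` \<N> \<subseteq> U p"
  proof (rule ex_point_fip)
    show "\<S> \<union> (\<lambda>E. C - E) ` \<N> \<subseteq> \<B>" using assms(1) by (auto simp: \<N>_def)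
    fix \<F> assume F: "finite \<F>" "\<F> \<subseteq> \<S> \<union> (\<lambda>E. C - E) ` \<N>"
    define \<F>1 where "\<F>1 = \<F> \<inter> \<S>"
    have "finite (\<F> - \<S>)" "\<F> - \<S> \<subseteq> (\<lambda>E. C - E) ` \<N>" using F by auto
    from finite_subset_image[OF this]
    obtain T where T: "T \<subseteq> \<N>" "finite T" "\<F> - \<S> = (\<lambda>E. C - E) ` T" by blast
    then have TB: "\<Union>T \<in> \<B>" "T \<subseteq> \<B>" by (auto simp: \<N>_def)
    have "m (\<Union>E\<in>T. E) \<le> (\<Sum>E\<in>T. m E)" using T(2) TB by (intro m_finite_UN_le) auto
    also have "\<dots> = 0" using T(1) by (auto simp: \<N>_def intro: sum.neutral)
    finally have 0: "m (\<Union>T) \<le> 0" by simp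
    have F1: "finite \<F>1" "\<F>1 \<subseteq> \<S>" using F by (auto simp: \<F>1_def)
    have "C \<inter> \<Inter>\<F>1 \<in> \<B>"
    proof (cases "\<F>1 = {}")
      case False
      then have "\<Inter>\<F>1 \<in> \<B>" using finite_INT[of \<F>1 "\<lambda>x. x"] F1 assms(1) by auto
      then show ?thesis by blast
    qed auto
    from m_mono[OF this TB(1)] have "\<not> C \<inter> \<Inter>\<F>1 \<subseteq> \<Union>T"
      using assms(2)[OF F1] 0 by linarith
    then obtain c where c: "c \<in> C" "c \<in> \<Inter>\<F>1" "c \<notin> \<Union>T" by blast
    have "c \<in> D" if D: "D \<in> \<F>" for D
    proof (cases "D \<in> \<S>")
      case False
      then have "D \<in> (\<lambda>E. C - E) ` T" using T(3) D by blast
      then show ?thesis using c by auto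
    qed (use c D in \<open>auto simp: \<F>1_def\<close>)
    then show "\<exists>c\<in>C. \<forall>E\<in>\<F>. c \<in> E" using c by blast
  qed
  then obtain p where p: "p \<in> X" "\<S> \<subseteq> U p" "\<And>E. E \<in> \<N> \<Longrightarrow> C - E \<in> U p" by auto
  have "m E > 0" if "E \<in> U p" for E
  proof -
    have "E \<in> \<B>" using U_sub p(1) that by blast
    then have "E \<notin> \<N>" using p(1,3) U_Diff that by blast
    then show ?thesis using m_nonneg[OF \<open>E \<in> \<B>\<close>] \<open>E \<in> \<B>\<close> by (auto simp: \<N>_def)
  qed
  then show ?thesis using p by (intro bexI[of _ p]) (auto simp: supp_def)
qed

end


section \<open>Products of types in stable abelian groups\<close>

text \<open>The algebra of definable subsets of a stable abelian group, reduced to what the argument about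
  measures uses: invariance under translation and absence of ladders.\<close>
locale stable_group = comm_group \<Gamma> + stone_content "carrier \<Gamma>" \<B> X U m
  for \<Gamma> :: "'c monoid" (structure) and \<B> and X :: "'x set" and U and m +
  assumes translate: "a \<in> carrier \<Gamma> \<Longrightarrow> E \<in> \<B> \<Longrightarrow> {b \<in> carrier \<Gamma>. a \<otimes> b \<in> E} \<in> \<B>"
    and stable: "E \<in> \<B> \<Longrightarrow> stable_rel (carrier \<Gamma>) (carrier \<Gamma>) (\<lambda>a b. a \<otimes> b \<in> E)"
begin

abbreviation C where "C \<equiv> carrier \<Gamma>"

definition shift :: "'c \<Rightarrow> 'c set \<Rightarrow> 'c set" where
  "shift a E = {b \<in> C. a \<otimes> b \<in> E}"

text \<open>The definition of the type \<open>p\<close> for the relation \<open>a \<otimes> b \<in> E\<close>, written \<open>d\<^sub>p E\<close> in the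
  introduction.\<close>
definition dfn :: "'c set \<Rightarrow> 'x \<Rightarrow> 'c set" where
  "dfn E p = {a \<in> C. shift a E \<in> U p}"

lemma shift_mem: "a \<in> C \<Longrightarrow> E \<in> \<B> \<Longrightarrow> shift a E \<in> \<B>"
  unfolding shift_def by (rule translate)

lemma shift_shift: "a \<in> C \<Longrightarrow> b \<in> C \<Longrightarrow> shift b (shift a E) = shift (a \<otimes> b) E"
  by (auto simp: shift_def m_assoc)

text \<open>Definability of types: by \<open>ultra_definable\<close>, membership of \<open>b\<close> in \<open>dfn E p\<close> depends only on which
  of finitely many translates of \<open>E\<close> contain \<open>b\<close>.\<close>
lemma dfn_mem:
  assumes E: "E \<in> \<B>" and p: "p \<in> X"
  shows "dfn E p \<in> \<B>"
proof -
  obtain F where F: "ultra F" "\<forall>\<^sub>F a in F. a \<in> C" "\<forall>D\<in>\<B>. D \<in> U p \<longleftrightarrow> (\<forall>\<^sub>F a in F. a \<in> D)"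
    using point_ultra[OF p] by blast
  obtain A where A: "A \<subseteq> C" "finite A" and def: "\<forall>b\<in>C. \<forall>b'\<in>C.
      (\<forall>a\<in>A. a \<otimes> b \<in> E \<longleftrightarrow> a \<otimes> b' \<in> E) \<longrightarrow>
      ((\<forall>\<^sub>F a in F. a \<otimes> b \<in> E) \<longleftrightarrow> (\<forall>\<^sub>F a in F. a \<otimes> b' \<in> E))"
    using ultra_definable[OF stable[OF E] F(1,2)] by blast
  have dfn: "b \<in> dfn E p \<longleftrightarrow> (\<forall>\<^sub>F a in F. a \<otimes> b \<in> E)" if b: "b \<in> C" for b
  proof -
    have "b \<in> dfn E p \<longleftrightarrow> (\<forall>\<^sub>F a in F. a \<in> shift b E)" using F(3) shift_mem[OF b E] b by (simp add: dfn_def)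
    also have "\<dots> \<longleftrightarrow> (\<forall>\<^sub>F a in F. a \<otimes> b \<in> E)"
      by (rule eventually_subst, rule eventually_mono[OF F(2)]) (use b in \<open>auto simp: shift_def m_comm\<close>)
    finally show ?thesis .
  qed
  show ?thesis
  proof (rule pattern_determined_mem)
    show "dfn E p \<subseteq> C" by (auto simp: dfn_def)
    show "finite ((\<lambda>a. shift a E) ` A)" using A by simp
    show "(\<lambda>a. shift a E) ` A \<subseteq> \<B>" using A E shift_mem by auto
    show "b \<in> dfn E p \<longleftrightarrow> b' \<in> dfn E p"
      if b: "b \<in> C" "b' \<in> C" and eq: "\<forall>F\<in>(\<lambda>a. shift a E) ` A. b \<in> F \<longleftrightarrow> b' \<in> F" for b b'
    proof -
      have "\<forall>a\<in>A. a \<otimes> b \<in> E \<longleftrightarrow> a \<otimes> b' \<in> E" using eq b by (simp add: shift_def)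
      then show ?thesis using def b unfolding dfn[OF b(1)] dfn[OF b(2)] by blast
    qed
  qed
qed

text \<open>The interchange of two limits; commutativity of the group identifies \<open>a \<otimes> b\<close> with \<open>b \<otimes> a\<close>.\<close>
lemma dfn_commute:
  assumes E: "E \<in> \<B>" and p: "p \<in> X" and q: "q \<in> X"
  shows "dfn E p \<in> U q \<longleftrightarrow> dfn E q \<in> U p"
proof -
  have *: "dfn E p \<in> U q \<longleftrightarrow> (\<forall>\<^sub>F b in H. \<forall>\<^sub>F a in F. b \<otimes> a \<in> E)"
    if p: "p \<in> X" and q: "q \<in> X"
      and F: "\<forall>\<^sub>F a in F. a \<in> C" "\<forall>D\<in>\<B>. D \<in> U p \<longleftrightarrow> (\<forall>\<^sub>F a in F. a \<in> D)"
      and H: "\<forall>\<^sub>F a in H. a \<in> C" "\<forall>D\<in>\<B>. D \<in> U q \<longleftrightarrow> (\<forall>\<^sub>F a in H. a \<in> D)" for p q F H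
  proof -
    have "dfn E p \<in> U q \<longleftrightarrow> (\<forall>\<^sub>F b in H. b \<in> dfn E p)" using H(2) dfn_mem[OF E p] by simp
    also have "\<dots> \<longleftrightarrow> (\<forall>\<^sub>F b in H. \<forall>\<^sub>F a in F. b \<otimes> a \<in> E)"
    proof (rule eventually_subst, rule eventually_mono[OF H(1)])
      fix b assume b: "b \<in> C"
      have "b \<in> dfn E p \<longleftrightarrow> (\<forall>\<^sub>F a in F. a \<in> shift b E)"
        using F(2) shift_mem[OF b E] b by (simp add: dfn_def)
      also have "\<dots> \<longleftrightarrow> (\<forall>\<^sub>F a in F. b \<otimes> a \<in> E)"
        by (rule eventually_subst, rule eventually_mono[OF F(1)]) (auto simp: shift_def)
      finally show "b \<in> dfn E p \<longleftrightarrow> (\<forall>\<^sub>F a in F. b \<otimes> a \<in> E)" .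
    qed
    finally show ?thesis .
  qed
  obtain F where F: "ultra F" "\<forall>\<^sub>F a in F. a \<in> C" "\<forall>D\<in>\<B>. D \<in> U p \<longleftrightarrow> (\<forall>\<^sub>F a in F. a \<in> D)"
    using point_ultra[OF p] by blast
  obtain H where H: "ultra H" "\<forall>\<^sub>F a in H. a \<in> C" "\<forall>D\<in>\<B>. D \<in> U q \<longleftrightarrow> (\<forall>\<^sub>F a in H. a \<in> D)"
    using point_ultra[OF q] by blast
  have "(\<forall>\<^sub>F a in F. \<forall>\<^sub>F b in H. a \<otimes> b \<in> E) \<longleftrightarrow> (\<forall>\<^sub>F a in F. \<forall>\<^sub>F b in H. b \<otimes> a \<in> E)"
  proof (rule eventually_subst, rule eventually_mono[OF F(2)])
    fix a assume a: "a \<in> C"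
    show "(\<forall>\<^sub>F b in H. a \<otimes> b \<in> E) \<longleftrightarrow> (\<forall>\<^sub>F b in H. b \<otimes> a \<in> E)"
      by (rule eventually_subst, rule eventually_mono[OF H(2)]) (use a in \<open>simp add: m_comm\<close>)
  qed
  then show ?thesis
    using *[OF p q F(2,3) H(2,3)] *[OF q p H(2,3) F(2,3)]
      double_limit[OF stable[OF E] H(1) F(1) H(2) F(2)] by simp
qed

lemma dfn_diff: "E \<in> \<B> \<Longrightarrow> F \<in> \<B> \<Longrightarrow> p \<in> X \<Longrightarrow> dfn (E - F) p = dfn E p - dfn F p"
proof -
  assume *: "E \<in> \<B>" "F \<in> \<B>" "p \<in> X"
  have "shift a (E - F) = shift a E - shift a F" for a by (auto simp: shift_def)
  then show ?thesis using * by (auto simp: dfn_def U_diff shift_mem)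
qed

lemma dfn_Int: "E \<in> \<B> \<Longrightarrow> F \<in> \<B> \<Longrightarrow> p \<in> X \<Longrightarrow> dfn (E \<inter> F) p = dfn E p \<inter> dfn F p"
proof -
  assume *: "E \<in> \<B>" "F \<in> \<B>" "p \<in> X"
  have "shift a (E \<inter> F) = shift a E \<inter> shift a F" for a by (auto simp: shift_def)
  then show ?thesis using * by (auto simp: dfn_def U_Int shift_mem)
qed

lemma dfn_Un: "E \<in> \<B> \<Longrightarrow> F \<in> \<B> \<Longrightarrow> p \<in> X \<Longrightarrow> dfn (E \<union> F) p = dfn E p \<union> dfn F p"
proof -
  assume *: "E \<in> \<B>" "F \<in> \<B>" "p \<in> X"
  have "shift a (E \<union> F) = shift a E \<union> shift a F" for a by (auto simp: shift_def)
  then show ?thesis using * by (auto simp: dfn_def U_Un shift_mem)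
qed

lemma dfn_space: "p \<in> X \<Longrightarrow> dfn C p = C"
proof -
  assume "p \<in> X"
  moreover have "shift a C = C" if "a \<in> C" for a using that by (auto simp: shift_def)
  ultimately show ?thesis by (auto simp: dfn_def U_space)
qed

lemma dfn_sym_diff: "E \<in> \<B> \<Longrightarrow> F \<in> \<B> \<Longrightarrow> p \<in> X \<Longrightarrow>
    dfn (sym_diff_set E F) p = sym_diff_set (dfn E p) (dfn F p)"
  unfolding sym_diff_set_def by (simp add: dfn_Un dfn_diff Diff)

text \<open>The product of two types: \<open>E\<close> belongs to it iff for \<open>p\<close>-most \<open>a\<close> and \<open>q\<close>-most \<open>b\<close> the element
  \<open>a \<otimes> b\<close> lies in \<open>E\<close>.\<close>
definition is_prod :: "'x \<Rightarrow> 'x \<Rightarrow> 'x \<Rightarrow> bool" where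
  "is_prod p q r \<longleftrightarrow> r \<in> X \<and> (\<forall>E\<in>\<B>. E \<in> U r \<longleftrightarrow> dfn E q \<in> U p)"

lemma is_prod_unique: "is_prod p q r \<Longrightarrow> is_prod p q r' \<Longrightarrow> r = r'"
  unfolding is_prod_def by (intro point_eqI) auto

lemma is_prod_exists: "p \<in> X \<Longrightarrow> q \<in> X \<Longrightarrow> \<exists>r. is_prod p q r"
  unfolding is_prod_def Bex_def[symmetric]
  by (rule ex_point) (simp_all add: dfn_space U_space dfn_diff dfn_Int U_Diff U_Int dfn_mem)

definition mul :: "'x \<Rightarrow> 'x \<Rightarrow> 'x" where
  "mul p q = (THE r. is_prod p q r)"

lemma mul_is_prod: "p \<in> X \<Longrightarrow> q \<in> X \<Longrightarrow> is_prod p q (mul p q)"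
  unfolding mul_def using is_prod_exists is_prod_unique by (metis theI)

lemma mul_closed: "p \<in> X \<Longrightarrow> q \<in> X \<Longrightarrow> mul p q \<in> X"
  using mul_is_prod by (simp add: is_prod_def)

lemma U_mul: "p \<in> X \<Longrightarrow> q \<in> X \<Longrightarrow> E \<in> \<B> \<Longrightarrow> E \<in> U (mul p q) \<longleftrightarrow> dfn E q \<in> U p"
  using mul_is_prod by (simp add: is_prod_def)

lemma mul_commute: "p \<in> X \<Longrightarrow> q \<in> X \<Longrightarrow> mul p q = mul q p"
  by (rule point_eqI) (simp_all add: mul_closed U_mul dfn_commute)

lemma dfn_dfn:
  assumes "E \<in> \<B>" "p \<in> X" "q \<in> X"
  shows "dfn (dfn E p) q = dfn E (mul p q)"
proof -
  have "a \<in> dfn (dfn E p) q \<longleftrightarrow> a \<in> dfn E (mul p q)" if a: "a \<in> C" for a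
  proof -
    have "x \<in> shift a (dfn E p) \<longleftrightarrow> x \<in> dfn (shift a E) p" if x: "x \<in> C" for x
    proof -
      have "x \<in> shift a (dfn E p) \<longleftrightarrow> shift (a \<otimes> x) E \<in> U p"
        unfolding shift_def[of a "dfn E p"] using a x by (simp add: dfn_def)
      also have "\<dots> \<longleftrightarrow> x \<in> dfn (shift a E) p" using a x by (simp add: dfn_def shift_shift)
      finally show ?thesis .
    qed
    moreover have "shift a (dfn E p) \<subseteq> C" "dfn (shift a E) p \<subseteq> C" by (auto simp: shift_def dfn_def)
    ultimately have "shift a (dfn E p) = dfn (shift a E) p" by blast
    then show ?thesis
      using a assms shift_mem[OF a] by (simp add: dfn_def[of "dfn E p"] dfn_def[of E "mul p q"] U_mul dfn_commute)
  qed
  then show ?thesis by (auto simp: dfn_def)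
qed

lemma mul_assoc:
  assumes "p \<in> X" "q \<in> X" "r \<in> X"
  shows "mul (mul p q) r = mul p (mul q r)"
proof (rule point_eqI)
  fix E assume E: "E \<in> \<B>"
  have "E \<in> U (mul (mul p q) r) \<longleftrightarrow> dfn (dfn E r) q \<in> U p"
    using assms E by (simp add: U_mul mul_closed dfn_mem)
  also have "dfn (dfn E r) q = dfn E (mul q r)"
    using assms E by (simp add: dfn_dfn mul_commute)
  finally show "E \<in> U (mul (mul p q) r) \<longleftrightarrow> E \<in> U (mul p (mul q r))"
    using assms E by (simp add: U_mul mul_closed)
qed (use assms in \<open>simp_all add: mul_closed\<close>)

text \<open>If this fails, there are \<open>P\<^sub>n\<close> and \<open>Q\<^sub>n\<close> whose definitions differ by more than \<open>\<epsilon>\<close> in measure but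
  agree on a finite set \<open>A\<^sub>n\<close>, where \<open>A\<^sub>n\<^sub>+\<^sub>1\<close> represents all elements of the group with respect to the
  sets \<open>dfn E P\<^sub>i\<close> and \<open>dfn E Q\<^sub>i\<close> for \<open>i \<le> n\<close>.  Since the differences have measure bounded from below,
  some point \<open>r\<close> lies in infinitely many of them, say for \<open>n \<in> I\<close>.  Let \<open>a\<^sub>n \<in> A\<^sub>n\<^sub>+\<^sub>1\<close> imitate \<open>r\<close> on the
  sets with \<open>i \<le> n\<close>; on the later ones \<open>a\<^sub>n\<close> cannot distinguish \<open>P\<^sub>i\<close> from \<open>Q\<^sub>i\<close>.  For the limits
  \<open>p\<close>, \<open>q\<close>, \<open>s\<close> of \<open>P\<close>, \<open>Q\<close>, \<open>a\<close> along an ultrafilter that contains \<open>I\<close>, the two orders of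
  evaluating \<open>E\<close> at \<open>s\<close> and \<open>p\<close> or \<open>q\<close> contradict each other.\<close>
lemma dfn_approx:
  assumes E: "E \<in> \<B>" and e: "\<epsilon> > 0"
  shows "\<exists>A\<subseteq>C. finite A \<and> (\<forall>p\<in>X. \<forall>q\<in>X. (\<forall>a\<in>A. a \<in> dfn E p \<longleftrightarrow> a \<in> dfn E q) \<longrightarrow>
           m (sym_diff_set (dfn E p) (dfn E q)) \<le> \<epsilon>)"
proof (rule ccontr)
  assume no: "\<not> ?thesis"
  have "\<forall>A. \<exists>p q. A \<subseteq> C \<longrightarrow> finite A \<longrightarrow> p \<in> X \<and> q \<in> X \<and>
      (\<forall>a\<in>A. a \<in> dfn E p \<longleftrightarrow> a \<in> dfn E q) \<and> \<epsilon> < m (sym_diff_set (dfn E p) (dfn E q))"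
    using no by (meson not_le)
  then obtain f g where fg: "\<And>A. A \<subseteq> C \<Longrightarrow> finite A \<Longrightarrow> f A \<in> X \<and> g A \<in> X \<and>
      (\<forall>a\<in>A. a \<in> dfn E (f A) \<longleftrightarrow> a \<in> dfn E (g A)) \<and> \<epsilon> < m (sym_diff_set (dfn E (f A)) (dfn E (g A)))"
    by metis
  have "\<forall>\<F>. \<exists>A. finite \<F> \<longrightarrow> A \<subseteq> C \<and> finite A \<and> (\<forall>c\<in>C. \<exists>a\<in>A. \<forall>F\<in>\<F>. a \<in> F \<longleftrightarrow> c \<in> F)"
    using finite_representatives by meson
  then obtain rep where rep: "\<And>\<F>. finite \<F> \<Longrightarrow> rep \<F> \<subseteq> C \<and> finite (rep \<F>) \<and>
      (\<forall>c\<in>C. \<exists>a\<in>rep \<F>. \<forall>F\<in>\<F>. a \<in> F \<longleftrightarrow> c \<in> F)"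
    by metis
  define step where "step s = (case s of (A, \<F>) \<Rightarrow>
     let \<F>' = insert (dfn E (f A)) (insert (dfn E (g A)) \<F>) in (A \<union> rep \<F>', \<F>'))" for s
  define A where "A n = fst ((step ^^ n) ({}, {}))" for n
  define \<F> where "\<F> n = snd ((step ^^ n) ({}, {}))" for n
  have step_Suc: "A (Suc n) = A n \<union> rep (\<F> (Suc n))"
    "\<F> (Suc n) = insert (dfn E (f (A n))) (insert (dfn E (g (A n))) (\<F> n))" for n
    by (simp_all add: A_def \<F>_def step_def Let_def split_beta)
  have fin: "finite (\<F> n) \<and> A n \<subseteq> C \<and> finite (A n)" for n
  proof (induction n)
    case 0
    then show ?case by (simp add: A_def \<F>_def)
  next
    case (Suc n)
    then show ?case using rep[of "\<F> (Suc n)"] by (simp add: step_Suc)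
  qed
  define P Q where "P n = f (A n)" and "Q n = g (A n)" for n
  have PQ: "P n \<in> X" "Q n \<in> X" "\<epsilon> \<le> m (sym_diff_set (dfn E (P n)) (dfn E (Q n)))"
    "\<forall>a\<in>A n. a \<in> dfn E (P n) \<longleftrightarrow> a \<in> dfn E (Q n)" for n
    using fg[of "A n"] fin[of n] by (auto simp: P_def Q_def)
  have dB: "dfn E (P n) \<in> \<B>" "dfn E (Q n) \<in> \<B>" for n using PQ dfn_mem[OF E] by auto
  have A_mono: "A n \<subseteq> A k" if "n \<le> k" for n k
    using that by (induction rule: dec_induct) (auto simp: step_Suc)
  have F_mem: "dfn E (P n) \<in> \<F> k" "dfn E (Q n) \<in> \<F> k" if "n < k" for n k
    using that by (induction k) (auto simp: step_Suc less_Suc_eq P_def Q_def)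
  have FB: "\<F> n \<subseteq> \<B>" for n
  proof (induction n)
    case 0
    then show ?case by (simp add: \<F>_def)
  next
    case (Suc n)
    then show ?case using dB[of n] by (simp add: step_Suc P_def Q_def)
  qed
  obtain r where r: "r \<in> X" "infinite {n. sym_diff_set (dfn E (P n)) (dfn E (Q n)) \<in> U r}"
    using ex_point_infinitely_often[of "\<lambda>n. sym_diff_set (dfn E (P n)) (dfn E (Q n))" \<epsilon>]
      sym_diff_mem dB PQ(3) e by blast
  define I where "I = {n. sym_diff_set (dfn E (P n)) (dfn E (Q n)) \<in> U r}"
  have "\<exists>a\<in>A (Suc n). \<forall>F\<in>\<F> (Suc n). a \<in> F \<longleftrightarrow> F \<in> U r" for n
  proof -
    have "finite (\<F> (Suc n))" using fin by blast
    then obtain c where "c \<in> C" "\<forall>F\<in>\<F> (Suc n). c \<in> F \<longleftrightarrow> F \<in> U r"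
      using point_pattern[OF r(1) _ FB] by blast
    moreover obtain a where "a \<in> rep (\<F> (Suc n))" "\<forall>F\<in>\<F> (Suc n). a \<in> F \<longleftrightarrow> c \<in> F"
      using rep \<open>finite (\<F> (Suc n))\<close> \<open>c \<in> C\<close> by blast
    ultimately show ?thesis by (intro bexI[of _ a]) (simp_all add: step_Suc(1))
  qed
  then obtain a where a: "\<And>n. a n \<in> A (Suc n)" "\<And>n. \<forall>F\<in>\<F> (Suc n). a n \<in> F \<longleftrightarrow> F \<in> U r"
    by metis
  have aC: "a n \<in> C" for n using a(1)[of n] fin[of "Suc n"] by blast
  have before: "a n \<in> dfn E (P i) \<longleftrightarrow> dfn E (P i) \<in> U r" "a n \<in> dfn E (Q i) \<longleftrightarrow> dfn E (Q i) \<in> U r"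
    if "i \<le> n" for i n
    using a(2)[of n] F_mem[of i "Suc n"] that by auto
  have after: "a n \<in> dfn E (P i) \<longleftrightarrow> a n \<in> dfn E (Q i)" if "n < i" for i n
    using a(1)[of n] A_mono[of "Suc n" i] PQ(4)[of i] that by auto
  have "inf sequentially (principal I) \<noteq> bot"
    using r(2) unfolding trivial_limit_def eventually_inf_principal eventually_sequentially
    by (auto simp: I_def[symmetric] infinite_nat_iff_unbounded_le)
  then obtain W where W: "ultra W" "W \<le> inf sequentially (principal I)"
    using ultra_exists by blast
  have WI: "\<forall>\<^sub>F i in W. i \<in> I" and Wgt: "\<forall>\<^sub>F i in W. n < i" and Wge: "\<forall>\<^sub>F i in W. n \<le> i" for n
    using W(2) eventually_gt_at_top[of n] eventually_ge_at_top[of n]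
    by (auto simp: le_inf_iff le_principal intro: filter_leD)
  obtain p where p: "p \<in> X" "\<forall>D\<in>\<B>. D \<in> U p \<longleftrightarrow> (\<forall>\<^sub>F i in W. D \<in> U (P i))"
    using ex_point_lim[of W P, OF W(1) PQ(1)] by blast
  obtain q where q: "q \<in> X" "\<forall>D\<in>\<B>. D \<in> U q \<longleftrightarrow> (\<forall>\<^sub>F i in W. D \<in> U (Q i))"
    using ex_point_lim[of W Q, OF W(1) PQ(2)] by blast
  obtain s where s: "s \<in> X" "\<forall>D\<in>\<B>. D \<in> U s \<longleftrightarrow> (\<forall>\<^sub>F n in W. a n \<in> D)"
    using ex_point_of_ultra[OF ultra_filtermap[OF W(1), of a]] aC by (auto simp: eventually_filtermap)
  \<comment> \<open>Evaluated at \<open>a\<^sub>n\<close> first, the limits of \<open>P\<close> and \<open>Q\<close> cannot be told apart.\<close>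
  have "dfn E p \<in> U s \<longleftrightarrow> dfn E q \<in> U s"
  proof -
    have "a n \<in> dfn E p \<longleftrightarrow> a n \<in> dfn E q" for n
    proof -
      have "a n \<in> dfn E p \<longleftrightarrow> (\<forall>\<^sub>F i in W. a n \<in> dfn E (P i))"
        using p(2) aC shift_mem[OF aC E] by (simp add: dfn_def)
      also have "\<dots> \<longleftrightarrow> (\<forall>\<^sub>F i in W. a n \<in> dfn E (Q i))"
        by (rule eventually_subst, rule eventually_mono[OF Wgt[of n]]) (rule after)
      also have "\<dots> \<longleftrightarrow> a n \<in> dfn E q"
        using q(2) aC shift_mem[OF aC E] by (simp add: dfn_def)
      finally show ?thesis .
    qed
    then show ?thesis using s(2) dfn_mem[OF E] p(1) q(1) by simp
  qed
  \<comment> \<open>In the other order, \<open>s\<close> behaves like \<open>r\<close>, which separates \<open>P\<^sub>i\<close> from \<open>Q\<^sub>i\<close> for \<open>i \<in> I\<close>.\<close>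
  moreover have "dfn E p \<in> U s \<longleftrightarrow> \<not> dfn E q \<in> U s"
  proof -
    have sr: "dfn E s \<in> U (P i) \<longleftrightarrow> dfn E (P i) \<in> U r" "dfn E s \<in> U (Q i) \<longleftrightarrow> dfn E (Q i) \<in> U r" for i
    proof -
      have "(\<forall>\<^sub>F n in W. a n \<in> dfn E (P i)) \<longleftrightarrow> (\<forall>\<^sub>F n in W. dfn E (P i) \<in> U r)"
        by (rule eventually_subst, rule eventually_mono[OF Wge[of i]]) (rule before)
      moreover have "(\<forall>\<^sub>F n in W. a n \<in> dfn E (Q i)) \<longleftrightarrow> (\<forall>\<^sub>F n in W. dfn E (Q i) \<in> U r)"
        by (rule eventually_subst, rule eventually_mono[OF Wge[of i]]) (rule before)
      ultimately show "dfn E s \<in> U (P i) \<longleftrightarrow> dfn E (P i) \<in> U r" "dfn E s \<in> U (Q i) \<longleftrightarrow> dfn E (Q i) \<in> U r"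
        using dfn_commute[OF E s(1)] PQ(1,2) s(2) dB ultra_nonbot[OF W(1)]
        by (auto simp: eventually_const)
    qed
    have "dfn E p \<in> U s \<longleftrightarrow> (\<forall>\<^sub>F i in W. dfn E s \<in> U (P i))"
      using dfn_commute[OF E p(1) s(1)] p(2) dfn_mem[OF E s(1)] by simp
    also have "\<dots> \<longleftrightarrow> (\<forall>\<^sub>F i in W. \<not> dfn E s \<in> U (Q i))"
    proof (rule eventually_subst, rule eventually_mono[OF WI])
      fix i assume "i \<in> I"
      then show "dfn E s \<in> U (P i) \<longleftrightarrow> \<not> dfn E s \<in> U (Q i)"
        unfolding sr by (simp add: I_def U_sym_diff[OF r(1) dB])
    qed
    also have "\<dots> \<longleftrightarrow> \<not> (\<forall>\<^sub>F i in W. dfn E s \<in> U (Q i))" by (rule ultra_not[OF W(1)])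
    also have "(\<forall>\<^sub>F i in W. dfn E s \<in> U (Q i)) \<longleftrightarrow> dfn E q \<in> U s"
      using dfn_commute[OF E q(1) s(1)] q(2) dfn_mem[OF E s(1)] by simp
    finally show ?thesis .
  qed
  ultimately show False by blast
qed

text \<open>Agreement with \<open>p\<close> on the finite set of \<open>dfn_approx\<close> is a clopen condition.\<close>
lemma dfn_continuous:
  assumes E: "E \<in> \<B>" and e: "\<epsilon> > 0" and p: "p \<in> X"
  shows "\<exists>D\<in>U p. \<forall>q\<in>cl D. m (sym_diff_set (dfn E q) (dfn E p)) \<le> \<epsilon>"
proof -
  obtain A where A: "A \<subseteq> C" "finite A" and ap: "\<forall>p\<in>X. \<forall>q\<in>X. (\<forall>a\<in>A. a \<in> dfn E p \<longleftrightarrow> a \<in> dfn E q) \<longrightarrow>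
      m (sym_diff_set (dfn E p) (dfn E q)) \<le> \<epsilon>"
    using dfn_approx[OF E e] by blast
  define T where "T = (\<lambda>a. if a \<in> dfn E p then shift a E else C - shift a E) ` A"
  have trB: "a \<in> A \<Longrightarrow> shift a E \<in> \<B>" for a using A(1) shift_mem[OF _ E] by blast
  have aC: "a \<in> A \<Longrightarrow> a \<in> C" for a using A(1) by blast
  have T: "finite T" "T \<subseteq> U p"
    using A(2) trB U_Diff[OF p] aC by (auto simp: T_def dfn_def)
  define D where "D = C \<inter> \<Inter>T"
  have D: "D \<in> U p" unfolding D_def by (rule U_finite_Inter[OF p T])
  have "m (sym_diff_set (dfn E q) (dfn E p)) \<le> \<epsilon>" if q: "q \<in> cl D" for q
  proof -
    have qX: "q \<in> X" "D \<in> U q" using q by (auto simp: cl_def)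
    have "a \<in> dfn E q \<longleftrightarrow> a \<in> dfn E p" if a: "a \<in> A" for a
    proof (cases "a \<in> dfn E p")
      case True
      then have "D \<subseteq> shift a E" using a by (auto simp: D_def T_def)
      then have "shift a E \<in> U q" using U_mono[OF qX _ trB[OF a]] by blast
      then show ?thesis using True aC[OF a] by (simp add: dfn_def)
    next
      case False
      then have "C - shift a E \<in> T" unfolding T_def using a by (intro image_eqI[of _ _ a]) simp_all
      then have "D \<subseteq> C - shift a E" unfolding D_def by blast
      then have "C - shift a E \<in> U q" using U_mono[OF qX _ compl_sets[OF trB[OF a]]] by blast
      then have "shift a E \<notin> U q" using U_Diff[OF qX(1) trB[OF a]] by blast
      then show ?thesis using False by (simp add: dfn_def)
    qed
    then show ?thesis using ap qX(1) p by blast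
  qed
  then show ?thesis using D by blast
qed

lemma continuous_dfn_dist:
  assumes E: "E \<in> \<B>" and F: "F \<in> \<B>"
  shows "continuous_map \<tau> euclideanreal (\<lambda>p. m (sym_diff_set (dfn E p) F))"
proof (rule continuous_map_real)
  fix p and e :: real assume p: "p \<in> X" and e: "0 < e"
  obtain D where D: "D \<in> U p" "\<forall>q\<in>cl D. m (sym_diff_set (dfn E q) (dfn E p)) \<le> e"
    using dfn_continuous[OF E e p] by blast
  have "\<bar>m (sym_diff_set (dfn E q) F) - m (sym_diff_set (dfn E p) F)\<bar> \<le> e" if q: "q \<in> cl D" for q
  proof -
    have B: "dfn E q \<in> \<B>" "dfn E p \<in> \<B>" using q cl_sub dfn_mem[OF E] p by auto
    have "m (sym_diff_set (dfn E q) (dfn E p)) \<le> e" using D(2) q by blast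
    then show ?thesis
      using m_sym_diff_triangle[OF B(1,2) F] m_sym_diff_triangle[OF B(2,1) F]
        m_sym_diff_commute[of "dfn E p" "dfn E q"] by linarith
  qed
  then show "\<exists>D\<in>U p. \<forall>q\<in>cl D.
      \<bar>m (sym_diff_set (dfn E q) F) - m (sym_diff_set (dfn E p) F)\<bar> \<le> e"
    using D(1) by blast
qed

lemma continuous_m_dfn:
  assumes E: "E \<in> \<B>"
  shows "continuous_map \<tau> euclideanreal (\<lambda>p. m (dfn E p))"
  using continuous_dfn_dist[OF E, of "{}"] by (simp add: sym_diff_set_def)

end

section \<open>The support of an idempotent measure\<close>

locale idempotent_stable_group = stable_group \<Gamma> \<B> X U m
  for \<Gamma> :: "'c monoid" (structure) and \<B> and X :: "'x set" and U and m +
  fixes P :: "'x measure"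
  assumes regular: "regular_borel_prob \<tau> P"
    and measure_cl: "E \<in> \<B> \<Longrightarrow> measure P (cl E) = m E"
    and idem: "E \<in> \<B> \<Longrightarrow> (LINT p|P. m (dfn E p)) = m E"
begin

sublocale P: prob_space P
  using regular by (simp add: regular_borel_prob_def)

lemma sets_P: "sets P = sets (borel_of_top \<tau>)" and space_P: "space P = X"
  using regular by (simp_all add: regular_borel_prob_def)

lemma AE_in_supp: "AE p in P. p \<in> supp"
  using AE_supp[OF regular] measure_cl by blast

lemma supp_X: "supp \<subseteq> X"
  by (auto simp: supp_def)

lemma ex_supp: "E \<in> \<B> \<Longrightarrow> m E > 0 \<Longrightarrow> \<exists>p\<in>supp. E \<in> U p"
proof -
  assume E: "E \<in> \<B>" "m E > 0"
  have "m (C \<inter> \<Inter>\<F>) > 0" if "finite \<F>" "\<F> \<subseteq> {E}" for \<F>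
  proof -
    have "\<F> = {} \<or> \<F> = {E}" using that by auto
    then show ?thesis using E sets_into_space[OF E(1)] by (auto simp: m_space Int_absorb1)
  qed
  then show ?thesis using ex_point_supp[of "{E}"] E by auto
qed

lemma continuous_integrable:
  assumes f: "continuous_map \<tau> euclideanreal f"
  shows "integrable P f"
proof -
  have "X \<noteq> {}" using P.not_empty space_P by simp
  moreover have "continuous_map \<tau> euclideanreal (\<lambda>x. \<bar>f x\<bar>)"
    using f by (rule continuous_map_real_abs)
  ultimately obtain p where "\<forall>q\<in>X. \<bar>f q\<bar> \<le> \<bar>f p\<bar>"
    using closed_attains_sup[of X "\<lambda>x. \<bar>f x\<bar>"] closedin_topspace[of \<tau>] by auto
  then show ?thesis
    using continuous_map_measurable[OF f] sets_P space_P
    by (intro P.integrable_const_bound[of _ "\<bar>f p\<bar>"]) (auto simp: measurable_cong_sets[OF sets_P refl])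
qed

text \<open>Near \<open>q\<close> the function is at least \<open>f q / 2\<close>, and neighbourhoods of points of the support have
  positive measure.\<close>
lemma integral_pos:
  assumes f: "continuous_map \<tau> euclideanreal f" and nn: "\<And>p. p \<in> supp \<Longrightarrow> 0 \<le> f p"
    and q: "q \<in> supp" "0 < f q"
  shows "0 < (LINT p|P. f p)"
proof -
  have "openin \<tau> {p \<in> topspace \<tau>. f p \<in> {f q / 2<..}}"
    using f open_greaterThan[of "f q / 2"]
    unfolding continuous_map_def open_openin[symmetric] by blast
  moreover have "q \<in> {p \<in> topspace \<tau>. f p \<in> {f q / 2<..}}" using q supp_X by auto
  ultimately obtain D where D: "D \<in> U q" "cl D \<subseteq> {p \<in> topspace \<tau>. f p \<in> {f q / 2<..}}"
    using openin_\<tau> by blast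
  have DB: "D \<in> \<B>" using D(1) U_sub q(1) supp_X by blast
  have cl: "cl D \<in> sets P" using openin_borel_of_top[OF openin_cl[OF DB]] sets_P by simp
  have "0 < f q / 2 * m D" using q D(1) by (simp add: supp_def)
  also have "\<dots> = (LINT p|P. f q / 2 * indicator (cl D) p)"
    using measure_cl[OF DB] cl sets.sets_into_space[OF cl] by (simp add: Int_absorb2)
  also have "\<dots> \<le> (LINT p|P. f p)"
  proof (rule integral_mono_AE)
    show "integrable P (\<lambda>p. f q / 2 * indicator (cl D) p)"
      using cl by (intro integrable_mult_right P.integrable_const_bound[of _ 1]) (auto simp: indicator_def)
    show "integrable P f" by (rule continuous_integrable[OF f])
    show "AE p in P. f q / 2 * indicator (cl D) p \<le> f p"
      using AE_in_supp by eventually_elim (use D nn in \<open>auto simp: indicator_def\<close>)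
  qed
  finally show ?thesis .
qed

text \<open>If \<open>E\<close> belongs to the product, then \<open>p \<mapsto> m (dfn E p)\<close> is positive at \<open>q\<close>, so its mean \<open>m E\<close> is
  positive.\<close>
lemma supp_mul_closed: assumes "p \<in> supp" "q \<in> supp" shows "mul p q \<in> supp"
proof -
  have X: "p \<in> X" "q \<in> X" using assms supp_X by auto
  have "m E > 0" if E: "E \<in> U (mul p q)" for E
  proof -
    have EB: "E \<in> \<B>" using E U_sub mul_closed[OF X] by blast
    have "dfn E q \<in> U p" using E U_mul[OF X EB] by blast
    then have "0 < m (dfn E q)" using assms(1) by (simp add: supp_def)
    then have "0 < (LINT p|P. m (dfn E p))"
      using integral_pos[OF continuous_m_dfn[OF EB] _ assms(2)] m_nonneg dfn_mem[OF EB] supp_X by blast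
    then show ?thesis using idem[OF EB] by simp
  qed
  then show ?thesis using mul_closed[OF X] by (simp add: supp_def)
qed

text \<open>A continuous function that stays on one side of its mean is equal to its mean.  The sign \<open>s\<close>
  allows one proof for both sides.\<close>
lemma constant_if_bounded:
  assumes E: "E \<in> \<B>" and s: "s = 1 \<or> s = (-1::real)"
    and le: "\<And>r. r \<in> supp \<Longrightarrow> s * m (dfn E r) \<le> s * m E" and q: "q \<in> supp"
  shows "m (dfn E q) = m E"
proof (rule ccontr)
  assume "m (dfn E q) \<noteq> m E"
  let ?f = "\<lambda>r. s * m E - s * m (dfn E r)"
  have cont: "continuous_map \<tau> euclideanreal ?f"
    by (intro continuous_map_diff continuous_map_real_mult_left continuous_m_dfn[OF E]) simp
  have "0 < ?f q" using le[OF q] s \<open>m (dfn E q) \<noteq> m E\<close> by auto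
  then have "0 < (LINT r|P. ?f r)" using integral_pos[OF cont _ q] le by auto
  moreover have "(LINT r|P. ?f r) = s * m E - s * (LINT r|P. m (dfn E r))"
    using continuous_integrable[OF continuous_m_dfn[OF E]] P.prob_space by simp
  ultimately show False using idem[OF E] by simp
qed

text \<open>A maximum principle.  For a point \<open>p\<close> where \<open>q \<mapsto> m (dfn E q)\<close> is maximal on the support, the
  function \<open>q \<mapsto> m (dfn (dfn E p) q)\<close>, whose mean is \<open>m (dfn E p)\<close>, is bounded by its mean; hence
  \<open>m (dfn E (mul p q))\<close> is maximal for all \<open>q\<close> in the support.  The same holds for a minimum, and the
  product of a maximum point and a minimum point is both.\<close>
lemma m_dfn_supp:
  assumes E: "E \<in> \<B>" and p: "p \<in> supp"
  shows "m (dfn E p) = m E"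
proof -
  have ne: "supp \<noteq> {}" using p by blast
  have ext: "\<exists>p\<in>supp. (\<forall>q\<in>supp. s * m (dfn E q) \<le> s * m (dfn E p)) \<and>
      (\<forall>q\<in>supp. m (dfn E (mul p q)) = m (dfn E p))" if s: "s = 1 \<or> s = -1" for s
  proof -
    have "continuous_map \<tau> euclideanreal (\<lambda>p. s * m (dfn E p))"
      by (intro continuous_map_real_mult_left continuous_m_dfn[OF E])
    then obtain p where p: "p \<in> supp" "\<forall>q\<in>supp. s * m (dfn E q) \<le> s * m (dfn E p)"
      using closed_attains_sup[OF closedin_supp ne] by blast
    have pX: "p \<in> X" using p supp_X by blast
    have "m (dfn E (mul p q)) = m (dfn E p)" if q: "q \<in> supp" for q
    proof -
      have "m (dfn (dfn E p) q) = m (dfn E p)"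
      proof (rule constant_if_bounded[OF dfn_mem[OF E pX] s _ q])
        show "s * m (dfn (dfn E p) r) \<le> s * m (dfn E p)" if r: "r \<in> supp" for r
          using p supp_mul_closed[OF p(1) r] dfn_dfn[OF E pX, of r] r supp_X by auto
      qed
      then show ?thesis using dfn_dfn[OF E pX, of q] q supp_X by auto
    qed
    then show ?thesis using p by blast
  qed
  from ext[of 1] obtain p1 where p1: "p1 \<in> supp" "\<forall>q\<in>supp. m (dfn E q) \<le> m (dfn E p1)"
    "\<forall>q\<in>supp. m (dfn E (mul p1 q)) = m (dfn E p1)" by auto
  from ext[of "-1"] obtain p2 where p2: "p2 \<in> supp" "\<forall>q\<in>supp. m (dfn E p2) \<le> m (dfn E q)"
    "\<forall>q\<in>supp. m (dfn E (mul p2 q)) = m (dfn E p2)" by auto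
  have "m (dfn E p1) = m (dfn E (mul p1 p2))" using p1 p2 by simp
  also have "\<dots> = m (dfn E (mul p2 p1))" using mul_commute p1(1) p2(1) supp_X by (simp add: subset_iff)
  also have "\<dots> = m (dfn E p2)" using p1 p2 by simp
  finally have const: "m (dfn E q) = m (dfn E p1)" if "q \<in> supp" for q
    using p1(2) p2(2) that by force
  have "m E = (LINT q|P. m (dfn E q))" using idem[OF E] by simp
  also have "\<dots> = (LINT q|P. m (dfn E p1))"
  proof (rule integral_cong_AE)
    show "AE q in P. m (dfn E q) = m (dfn E p1)" using AE_in_supp by eventually_elim (rule const)
  qed (use continuous_integrable[OF continuous_m_dfn[OF E]] in auto)
  finally show ?thesis using const[OF p] P.prob_space by simp
qed

text \<open>The sets \<open>dfn D p\<close> for \<open>D \<in> U r\<close> have positive measure by \<open>m_dfn_supp\<close> and are closed under finite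
  intersections, so some \<open>q\<close> in the support contains all of them; it solves the equation.\<close>
lemma supp_divisible:
  assumes p: "p \<in> supp" and r: "r \<in> supp"
  shows "\<exists>q\<in>supp. mul p q = r"
proof -
  have X: "p \<in> X" "r \<in> X" using p r supp_X by auto
  have RB: "D \<in> U r \<Longrightarrow> D \<in> \<B>" for D using U_sub X by blast
  have "\<exists>q\<in>supp. (\<lambda>D. dfn D p) ` U r \<subseteq> U q"
  proof (rule ex_point_supp)
    show "(\<lambda>D. dfn D p) ` U r \<subseteq> \<B>" using dfn_mem[OF RB X(1)] by blast
    fix \<F> assume "finite \<F>" "\<F> \<subseteq> (\<lambda>D. dfn D p) ` U r"
    from finite_subset_image[OF this]
    obtain T where T: "T \<subseteq> U r" "finite T" "\<F> = (\<lambda>D. dfn D p) ` T" by blast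
    define D where "D = C \<inter> \<Inter>T"
    have D: "D \<in> U r" unfolding D_def by (rule U_finite_Inter[OF X(2) T(2,1)])
    have "0 < m (dfn D p)" using m_dfn_supp[OF RB[OF D] p] D r by (simp add: supp_def)
    moreover have "dfn D p \<subseteq> dfn D' p" if "D' \<in> T" for D'
    proof -
      have D': "D' \<in> \<B>" using that T(1) RB by blast
      have "D = D \<inter> D'" using that by (auto simp: D_def)
      then have "dfn D p = dfn D p \<inter> dfn D' p" using dfn_Int[OF RB[OF D] D' X(1)] by metis
      then show ?thesis by blast
    qed
    then have "dfn D p \<subseteq> C \<inter> \<Inter>\<F>" unfolding T(3) by (auto simp: dfn_def)
    moreover have "C \<inter> \<Inter>\<F> \<in> \<B>"
    proof (cases "\<F> = {}")
      case False
      then have "\<Inter>\<F> \<in> \<B>"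
        using finite_INT[of \<F> "\<lambda>x. x"] T(2) dfn_mem[OF RB X(1)] T(1) unfolding T(3) by auto
      then show ?thesis by blast
    qed auto
    ultimately show "0 < m (C \<inter> \<Inter>\<F>)" using m_mono[OF dfn_mem[OF RB[OF D] X(1)]] by fastforce
  qed
  then obtain q where q: "q \<in> supp" "\<And>D. D \<in> U r \<Longrightarrow> dfn D p \<in> U q" by blast
  have qX: "q \<in> X" using q supp_X by blast
  have sub: "D \<in> U (mul p q)" if D: "D \<in> U r" for D
    using q(2)[OF D] U_mul[OF X(1) qX RB[OF D]] dfn_commute[OF RB[OF D] X(1) qX] by blast
  have "mul p q = r"
  proof (rule point_eqI)
    fix D assume D: "D \<in> \<B>"
    show "D \<in> U (mul p q) \<longleftrightarrow> D \<in> U r"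
      using sub[of D] sub[of "C - D"] U_Diff[OF X(2) D] U_Diff[OF mul_closed[OF X(1) qX] D] by blast
  qed (use X qX mul_closed in auto)
  then show ?thesis using q(1) by blast
qed

lemma ex_unit: "\<exists>u\<in>supp. \<forall>r\<in>supp. mul u r = r"
proof -
  obtain p0 where p0: "p0 \<in> supp" using ex_supp[OF top] m_space by auto
  obtain u where u: "u \<in> supp" "mul p0 u = p0" using supp_divisible[OF p0 p0] by blast
  have SX: "p \<in> supp \<Longrightarrow> p \<in> X" for p using supp_X by blast
  have "mul u r = r" if r: "r \<in> supp" for r
  proof -
    obtain q where q: "q \<in> supp" "mul p0 q = r" using supp_divisible[OF p0 r] by blast
    have "mul u (mul p0 q) = mul (mul p0 u) q"
      using u(1) p0 q(1) SX mul_assoc[of u p0 q] mul_commute[of u p0] by simp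
    then show ?thesis by (simp only: u(2) q(2))
  qed
  then show ?thesis using u by blast
qed

lemma supp_comm_group:
  assumes op: "\<And>p q. p \<in> supp \<Longrightarrow> q \<in> supp \<Longrightarrow> op p q = mul p q"
  shows "\<exists>u. comm_group \<lparr>carrier = supp, monoid.mult = op, one = u\<rparr>"
proof -
  obtain u where u: "u \<in> supp" and one: "\<And>r. r \<in> supp \<Longrightarrow> mul u r = r" using ex_unit by blast
  have SX: "p \<in> supp \<Longrightarrow> p \<in> X" for p using supp_X by blast
  have "comm_group \<lparr>carrier = supp, monoid.mult = op, one = u\<rparr>"
  proof (rule comm_groupI; simp)
    show "op p q \<in> supp" if "p \<in> supp" "q \<in> supp" for p q using that op supp_mul_closed by simp
    show "op (op p q) r = op p (op q r)" if "p \<in> supp" "q \<in> supp" "r \<in> supp" for p q r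
      using that by (simp add: op supp_mul_closed mul_assoc SX)
    show "op p q = op q p" if "p \<in> supp" "q \<in> supp" for p q
      using that by (simp add: op mul_commute SX)
    show "op u p = p" if "p \<in> supp" for p using that u by (simp add: op one)
    show "\<exists>q\<in>supp. op q p = u" if p: "p \<in> supp" for p
    proof -
      obtain q where "q \<in> supp" "mul p q = u" using supp_divisible[OF p u] by blast
      then show ?thesis using p by (intro bexI[of _ q]) (simp_all add: op mul_commute SX)
    qed
  qed (rule u)
  then show ?thesis by blast
qed

definition dfn_dist :: "'c set \<Rightarrow> 'x \<Rightarrow> 'x \<Rightarrow> real" where
  "dfn_dist E p q = m (sym_diff_set (dfn E p) (dfn E q))"

lemma dfn_dist_commute: "dfn_dist E p q = dfn_dist E q p"
  by (simp add: dfn_dist_def m_sym_diff_commute)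

lemma dfn_dist_triangle:
  "E \<in> \<B> \<Longrightarrow> p \<in> X \<Longrightarrow> q \<in> X \<Longrightarrow> r \<in> X \<Longrightarrow> dfn_dist E p r \<le> dfn_dist E p q + dfn_dist E q r"
  unfolding dfn_dist_def by (intro m_sym_diff_triangle dfn_mem)

text \<open>Multiplication by \<open>r\<close> replaces a set \<open>D\<close> by \<open>dfn D r\<close>, which does not change its measure.\<close>
lemma dfn_dist_invariant:
  assumes "E \<in> \<B>" "p \<in> X" "q \<in> X" "r \<in> supp"
  shows "dfn_dist E (mul p r) (mul q r) = dfn_dist E p q"
proof -
  have rX: "r \<in> X" using assms supp_X by blast
  have B: "dfn E p \<in> \<B>" "dfn E q \<in> \<B>" using assms dfn_mem by auto
  have "dfn_dist E (mul p r) (mul q r) = m (dfn (sym_diff_set (dfn E p) (dfn E q)) r)"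
    using assms rX B by (simp add: dfn_dist_def dfn_dfn dfn_sym_diff flip: dfn_dfn)
  also have "\<dots> = dfn_dist E p q"
    unfolding dfn_dist_def by (rule m_dfn_supp[OF sym_diff_mem[OF B] assms(4)])
  finally show ?thesis .
qed

lemma continuous_dfn_dist_point:
  "E \<in> \<B> \<Longrightarrow> p \<in> X \<Longrightarrow> continuous_map \<tau> euclideanreal (\<lambda>q. dfn_dist E q p)"
  unfolding dfn_dist_def by (intro continuous_dfn_dist dfn_mem)

text \<open>The symmetric difference of the two definitions belongs to the unit of the group, which is a point
  of the support.\<close>
lemma dfn_dist_separates:
  assumes "E \<in> \<B>" "p \<in> supp" "q \<in> supp" "E \<in> U p" "E \<notin> U q"
  shows "0 < dfn_dist E p q"
proof -
  obtain u where u: "u \<in> supp" and one: "\<And>r. r \<in> supp \<Longrightarrow> mul u r = r" using ex_unit by blast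
  have X: "p \<in> X" "q \<in> X" "u \<in> X" using assms u supp_X by auto
  have "dfn E p \<in> U u" "dfn E q \<notin> U u"
    using assms U_mul[OF X(3) X(1) assms(1)] U_mul[OF X(3) X(2) assms(1)] one by auto
  then have "sym_diff_set (dfn E p) (dfn E q) \<in> U u"
    using U_sym_diff X dfn_mem[OF assms(1)] by blast
  then show ?thesis using u by (simp add: dfn_dist_def supp_def)
qed

text \<open>On the compact set of those points of the support that omit \<open>E\<close>, the continuous function
  \<open>dfn_dist E \<cdot> p0\<close> is positive and attains its minimum \<open>\<eta>\<close>.  So the pseudometrics define the
  topology of the support.\<close>
lemma dfn_dist_uniform:
  assumes E: "E \<in> \<B>" and p0: "p0 \<in> supp" "E \<in> U p0"
  shows "\<exists>\<eta>>0. \<forall>p\<in>supp. dfn_dist E p p0 < \<eta> \<longrightarrow> E \<in> U p"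
proof (cases "supp \<inter> cl (C - E) = {}")
  case True
  then have "\<forall>p\<in>supp. E \<in> U p" using U_Diff[OF _ E] supp_X by (auto simp: cl_def)
  then show ?thesis by (intro exI[of _ 1]) auto
next
  case False
  have X: "p0 \<in> X" using p0 supp_X by blast
  have "closedin \<tau> (supp \<inter> cl (C - E))"
    using closedin_supp closedin_cl[OF compl_sets[OF E]] by (rule closedin_Int)
  moreover have "continuous_map \<tau> euclideanreal (\<lambda>q. - dfn_dist E q p0)"
    using continuous_dfn_dist_point[OF E X] by (simp add: continuous_map_minus)
  ultimately obtain q where q: "q \<in> supp \<inter> cl (C - E)"
    "\<forall>p\<in>supp \<inter> cl (C - E). - dfn_dist E p p0 \<le> - dfn_dist E q p0"
    using closed_attains_sup[OF _ False] by blast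
  have "E \<notin> U q" using q(1) U_Diff[OF _ E] by (auto simp: cl_def)
  then have "0 < dfn_dist E p0 q" using dfn_dist_separates[OF E p0(1) _ p0(2)] q(1) by blast
  then have "0 < dfn_dist E q p0" by (simp add: dfn_dist_commute)
  moreover have "E \<in> U p" if p: "p \<in> supp" "dfn_dist E p p0 < dfn_dist E q p0" for p
  proof (rule ccontr)
    assume "E \<notin> U p"
    then have "p \<in> supp \<inter> cl (C - E)" using p U_Diff[OF _ E] supp_X by (auto simp: cl_def)
    then show False using q(2) p(2) by force
  qed
  ultimately show ?thesis by blast
qed

text \<open>For invariant pseudometrics, the distance of two products is at most the sum of the distances of
  the factors, and taking inverses is an isometry.\<close>
lemma supp_topological_group:
  assumes op: "\<And>p q. p \<in> supp \<Longrightarrow> q \<in> supp \<Longrightarrow> op p q = mul p q"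
    and grp: "comm_group \<lparr>carrier = supp, monoid.mult = op, one = u\<rparr>"
  shows "topological_group \<lparr>carrier = supp, monoid.mult = op, one = u\<rparr> (subtopology \<tau> supp)"
proof -
  let ?H = "\<lparr>carrier = supp, monoid.mult = op, one = u\<rparr>"
  let ?T = "subtopology \<tau> supp"
  interpret H: comm_group ?H by (rule grp)
  have SX: "p \<in> supp \<Longrightarrow> p \<in> X" for p using supp_X by blast
  have tsp: "topspace ?T = supp" using supp_X by auto
  have cl: "op p q \<in> supp" if "p \<in> supp" "q \<in> supp" for p q using that op supp_mul_closed by simp
  have icl: "inv\<^bsub>?H\<^esub> p \<in> supp" if "p \<in> supp" for p using H.inv_closed[of p] that by simp
  have ball: "openin ?T {p \<in> supp. dfn_dist E p p0 < \<eta>}" if "E \<in> \<B>" "p0 \<in> supp" for E p0 \<eta>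
  proof -
    have "openin \<tau> {p \<in> topspace \<tau>. dfn_dist E p p0 \<in> {..<\<eta>}}"
      using continuous_dfn_dist_point[OF that(1) SX[OF that(2)]] open_lessThan[of \<eta>]
      unfolding continuous_map_def open_openin[symmetric] by blast
    moreover have "{p \<in> supp. dfn_dist E p p0 < \<eta>} = {p \<in> topspace \<tau>. dfn_dist E p p0 \<in> {..<\<eta>}} \<inter> supp"
      using supp_X by auto
    ultimately show ?thesis unfolding openin_subtopology by blast
  qed
  have self: "dfn_dist E p p = 0" for E p by (simp add: dfn_dist_def sym_diff_set_def m_empty)
  have inv: "dfn_dist E (op p r) (op q r) = dfn_dist E p q"
    if "E \<in> \<B>" "p \<in> supp" "q \<in> supp" "r \<in> supp" for E p q r
    using that dfn_dist_invariant SX by (simp add: op)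
  have comm: "op p q = op q p" if "p \<in> supp" "q \<in> supp" for p q using that H.m_comm by simp
  have "continuous_map (prod_topology ?T ?T) \<tau> (\<lambda>(a, b). op a b)"
  proof (rule continuous_map_\<tau>)
    fix V assume "V \<in> cl ` \<B>"
    then obtain E where E: "E \<in> \<B>" "V = cl E" by blast
    show "openin (prod_topology ?T ?T) ((\<lambda>(a, b). op a b) -` V \<inter> topspace (prod_topology ?T ?T))"
      unfolding openin_prod_topology_alt
    proof (intro allI impI)
      fix p0 q0
      assume "(p0, q0) \<in> (\<lambda>(a, b). op a b) -` V \<inter> topspace (prod_topology ?T ?T)"
      then have pq: "p0 \<in> supp" "q0 \<in> supp" "E \<in> U (op p0 q0)" by (auto simp: tsp E cl_def)
      obtain \<eta> where \<eta>: "\<eta> > 0" "\<forall>p\<in>supp. dfn_dist E p (op p0 q0) < \<eta> \<longrightarrow> E \<in> U p"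
        using dfn_dist_uniform[OF E(1) cl[OF pq(1,2)] pq(3)] by blast
      let ?V = "{p \<in> supp. dfn_dist E p p0 < \<eta>/2}" and ?W = "{q \<in> supp. dfn_dist E q q0 < \<eta>/2}"
      have "op p q \<in> cl E" if p: "p \<in> ?V" and q: "q \<in> ?W" for p q
      proof -
        have "dfn_dist E (op p q) (op p0 q0) \<le> dfn_dist E (op p q) (op p0 q) + dfn_dist E (op p0 q) (op p0 q0)"
          using p q pq cl SX by (intro dfn_dist_triangle E) auto
        also have "\<dots> = dfn_dist E p p0 + dfn_dist E q q0"
          using p q pq inv[OF E(1), of p p0 q] inv[OF E(1), of q q0 p0] comm by simp
        also have "\<dots> < \<eta>" using p q by simp
        finally show ?thesis using \<eta>(2) p q cl SX by (auto simp: cl_def)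
      qed
      then have "?V \<times> ?W \<subseteq> (\<lambda>(a, b). op a b) -` V \<inter> topspace (prod_topology ?T ?T)"
        using SX by (auto simp: tsp E)
      moreover have "p0 \<in> ?V" "q0 \<in> ?W" using pq \<eta>(1) by (simp_all add: self)
      ultimately show "\<exists>V' W. openin ?T V' \<and> openin ?T W \<and> p0 \<in> V' \<and> q0 \<in> W \<and>
          V' \<times> W \<subseteq> (\<lambda>(a, b). op a b) -` V \<inter> topspace (prod_topology ?T ?T)"
        using ball[OF E(1) pq(1)] ball[OF E(1) pq(2)] by blast
    qed
  next
    show "(\<lambda>(a, b). op a b) ` topspace (prod_topology ?T ?T) \<subseteq> \<Union> (cl ` \<B>)"
      using cl SX cl_space by (force simp: tsp)
  qed
  moreover have "continuous_map ?T \<tau> (\<lambda>a. inv\<^bsub>?H\<^esub> a)"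
  proof (rule continuous_map_\<tau>)
    fix V assume "V \<in> cl ` \<B>"
    then obtain E where E: "E \<in> \<B>" "V = cl E" by blast
    show "openin ?T ((\<lambda>a. inv\<^bsub>?H\<^esub> a) -` V \<inter> topspace ?T)"
    proof (subst openin_subopen, intro ballI)
      fix p0 assume "p0 \<in> (\<lambda>a. inv\<^bsub>?H\<^esub> a) -` V \<inter> topspace ?T"
      then have p0: "p0 \<in> supp" "E \<in> U (inv\<^bsub>?H\<^esub> p0)" by (auto simp: tsp E cl_def)
      obtain \<eta> where \<eta>: "\<eta> > 0" "\<forall>p\<in>supp. dfn_dist E p (inv\<^bsub>?H\<^esub> p0) < \<eta> \<longrightarrow> E \<in> U p"
        using dfn_dist_uniform[OF E(1) icl[OF p0(1)] p0(2)] by blast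
      let ?V = "{p \<in> supp. dfn_dist E p p0 < \<eta>}"
      have "inv\<^bsub>?H\<^esub> p \<in> cl E" if p: "p \<in> ?V" for p
      proof -
        have pS: "p \<in> supp" using p by simp
        \<comment> \<open>Multiplying both inverses by \<open>p p\<^sub>0\<close> interchanges the two points.\<close>
        have 1: "op (inv\<^bsub>?H\<^esub> p) (op p p0) = p0"
          using H.m_assoc[of "inv\<^bsub>?H\<^esub> p" p p0] H.l_inv[of p] H.l_one[of p0] pS p0 icl by simp
        have 2: "op (inv\<^bsub>?H\<^esub> p0) (op p p0) = p"
          using H.m_assoc[of "inv\<^bsub>?H\<^esub> p0" p0 p] H.l_inv[of p0] H.l_one[of p] comm[of p p0]
            pS p0 icl by simp
        have "dfn_dist E (inv\<^bsub>?H\<^esub> p) (inv\<^bsub>?H\<^esub> p0) = dfn_dist E p0 p"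
          using inv[OF E(1) icl[OF pS] icl[OF p0(1)] cl[OF pS p0(1)]] unfolding 1 2 by simp
        then have "dfn_dist E (inv\<^bsub>?H\<^esub> p) (inv\<^bsub>?H\<^esub> p0) < \<eta>"
          using p dfn_dist_commute[of E p0 p] by simp
        then show ?thesis using \<eta>(2) icl[OF pS] SX by (auto simp: cl_def)
      qed
      then have "?V \<subseteq> (\<lambda>a. inv\<^bsub>?H\<^esub> a) -` V \<inter> topspace ?T" using SX by (auto simp: tsp E)
      moreover have "p0 \<in> ?V" using p0 \<eta>(1) by (simp add: self)
      ultimately show "\<exists>V'. openin ?T V' \<and> p0 \<in> V' \<and> V' \<subseteq> (\<lambda>a. inv\<^bsub>?H\<^esub> a) -` V \<inter> topspace ?T"
        using ball[OF E(1) p0(1)] by blast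
    qed
  next
    show "(\<lambda>a. inv\<^bsub>?H\<^esub> a) ` topspace ?T \<subseteq> \<Union> (cl ` \<B>)"
      using icl SX cl_space by (force simp: tsp)
  qed
  ultimately show ?thesis
    unfolding topological_group_def continuous_map_in_subtopology
    using H.group_axioms tsp cl icl by (auto simp: tsp)
qed

theorem supp_compact_group:
  assumes op: "\<And>p q. p \<in> supp \<Longrightarrow> q \<in> supp \<Longrightarrow> is_prod p q (op p q)"
  shows "\<exists>u. let H = \<lparr>carrier = supp, monoid.mult = op, one = u\<rparr>; T = subtopology \<tau> supp
             in comm_group H \<and> topological_group H T \<and> compact_space T \<and> Hausdorff_space T"
proof -
  have op_mul: "op p q = mul p q" if "p \<in> supp" "q \<in> supp" for p q
    using op[OF that] mul_is_prod is_prod_unique that supp_X by blast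
  obtain u where u: "comm_group \<lparr>carrier = supp, monoid.mult = op, one = u\<rparr>"
    using supp_comm_group[OF op_mul] by blast
  have "compact_space (subtopology \<tau> supp)"
    using closedin_compact_space[OF compact_space_\<tau> closedin_supp]
    by (rule compact_space_subtopology)
  then show ?thesis
    using u supp_topological_group[OF op_mul u] Hausdorff_space_subtopology[OF Hausdorff_space_\<tau>]
    by (auto simp: Let_def)
qed

end

section \<open>Substitution, parameters and elementary substructures\<close>

lemma eval_cong: "(\<And>v. v \<in> tm_vars t \<Longrightarrow> e v = e' v) \<Longrightarrow> eval M e t = eval M e' t"
proof (induction t)
  case (Fn f ts)
  then have "map (eval M e) ts = map (eval M e') ts" by (intro map_cong refl) (simp, blast)
  then show ?case by (simp only: eval.simps)
qed simp_all

lemma sat_cong: "(\<And>v. v \<in> fv \<phi> \<Longrightarrow> e v = e' v) \<Longrightarrow> sat M e \<phi> \<longleftrightarrow> sat M e' \<phi>"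
proof (induction \<phi> arbitrary: e e')
  case (Eq t u)
  then have "eval M e t = eval M e' t" "eval M e u = eval M e' u" by (auto intro!: eval_cong)
  then show ?case by simp
next
  case (Rel r ts)
  then have "map (eval M e) ts = map (eval M e') ts"
    by (intro map_cong refl eval_cong) (simp, blast)
  then show ?case by (simp only: sat.simps)
next
  case (Imp \<phi> \<psi>)
  have "sat M e \<phi> = sat M e' \<phi>" by (rule Imp.IH) (simp add: Imp.prems)
  moreover have "sat M e \<psi> = sat M e' \<psi>" by (rule Imp.IH) (simp add: Imp.prems)
  ultimately show ?case by simp
next
  case (All v \<phi>)
  have "sat M (e(v := a)) \<phi> = sat M (e'(v := a)) \<phi>" for a
    by (rule All.IH) (simp add: All.prems)
  then show ?case by simp
qed auto

lemma eval_subst_tm: "eval M e (subst_tm \<sigma> t) = eval M (\<lambda>v. eval M e (\<sigma> v)) t"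
  by (induction t) (auto intro!: arg_cong[where f="fint M _"])

text \<open>The hypothesis excludes capture: no variable of \<open>\<phi>\<close>, free or bound, is put in place of another
  one.\<close>
lemma sat_subst:
  assumes "\<And>w. tm_vars (\<sigma> w) \<inter> fm_vars \<phi> \<subseteq> {w}"
  shows "sat M e (subst \<sigma> \<phi>) \<longleftrightarrow> sat M (\<lambda>v. eval M e (\<sigma> v)) \<phi>"
  using assms
proof (induction \<phi> arbitrary: e \<sigma>)
  case (Rel r ts)
  then show ?case by (simp add: eval_subst_tm comp_def)
next
  case (Imp \<phi> \<psi>)
  have "tm_vars (\<sigma> w) \<inter> fm_vars \<phi> \<subseteq> {w}" "tm_vars (\<sigma> w) \<inter> fm_vars \<psi> \<subseteq> {w}" for w
    using Imp.prems[of w] by auto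
  then show ?case using Imp.IH by simp
next
  case (All v \<phi>)
  have 1: "tm_vars ((\<sigma>(v := Var v)) w) \<inter> fm_vars \<phi> \<subseteq> {w}" for w
    using All.prems[of w] by auto
  have "(\<lambda>w. eval M (e(v := a)) ((\<sigma>(v := Var v)) w)) = (\<lambda>w. eval M e (\<sigma> w))(v := a)" for a
  proof (rule ext)
    fix w
    have "eval M (e(v := a)) (\<sigma> w) = eval M e (\<sigma> w)" if "w \<noteq> v"
      using All.prems[of w] that by (intro eval_cong) auto
    then show "eval M (e(v := a)) ((\<sigma>(v := Var v)) w) = ((\<lambda>w. eval M e (\<sigma> w))(v := a)) w" by simp
  qed
  then have "sat M (e(v := a)) (subst (\<sigma>(v := Var v)) \<phi>) \<longleftrightarrow>
      sat M ((\<lambda>w. eval M e (\<sigma> w))(v := a)) \<phi>" for a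
    using All.IH[OF 1, of "e(v := a)"] by (simp only:)
  then show ?case by (simp only: sat.simps subst.simps)
qed (simp_all add: eval_subst_tm)

lemma tm_vars_subst_tm: "tm_vars (subst_tm \<sigma> t) = (\<Union>v\<in>tm_vars t. tm_vars (\<sigma> v))"
  by (induction t) auto

lemma tm_pars_subst_tm: "tm_pars (subst_tm \<sigma> t) = tm_pars t \<union> (\<Union>v\<in>tm_vars t. tm_pars (\<sigma> v))"
  by (induction t) auto

lemma fv_subst: "fv (subst \<sigma> \<phi>) \<subseteq> (\<Union>v\<in>fv \<phi>. tm_vars (\<sigma> v))"
proof (induction \<phi> arbitrary: \<sigma>)
  case (All v \<phi>)
  have "(\<Union>w\<in>fv \<phi>. tm_vars ((\<sigma>(v := Var v)) w)) \<subseteq> insert v (\<Union>w\<in>fv \<phi> - {v}. tm_vars (\<sigma> w))"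
    by (auto split: if_splits)
  from order_trans[OF All[of "\<sigma>(v := Var v)"] this] show ?case
    unfolding subst.simps fv.simps by blast
qed (force simp: tm_vars_subst_tm)+

lemma pars_subst: "pars (subst \<sigma> \<phi>) \<subseteq> pars \<phi> \<union> (\<Union>v\<in>fv \<phi>. tm_pars (\<sigma> v))"
proof (induction \<phi> arbitrary: \<sigma>)
  case (All v \<phi>)
  have "(\<Union>w\<in>fv \<phi>. tm_pars ((\<sigma>(v := Var v)) w)) \<subseteq> (\<Union>w\<in>fv \<phi> - {v}. tm_pars (\<sigma> w))"
    by (auto split: if_splits)
  with All[of "\<sigma>(v := Var v)"] show ?case
    unfolding subst.simps fv.simps fm.set by blast
qed (force simp: tm_pars_subst_tm)+

lemma wf_subst_tm:
  assumes "wf_tm L t" "\<And>v. v \<in> tm_vars t \<Longrightarrow> wf_tm L (\<sigma> v) \<and> sort_of L (\<sigma> v) = fst v"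
  shows "wf_tm L (subst_tm \<sigma> t) \<and> sort_of L (subst_tm \<sigma> t) = sort_of L t"
  using assms
proof (induction t)
  case (Fn f ts)
  have *: "wf_tm L (subst_tm \<sigma> t) \<and> sort_of L (subst_tm \<sigma> t) = sort_of L t" if "t \<in> set ts" for t
    by (rule Fn.IH[OF that]) (use Fn.prems that in \<open>simp, fastforce\<close>)
  then have "map (sort_of L \<circ> subst_tm \<sigma>) ts = map (sort_of L) ts" by (intro map_cong) auto
  then have "map (sort_of L \<circ> subst_tm \<sigma>) ts = fdom L f" using Fn.prems(1) by (simp only: wf_tm.simps)
  then show ?case using Fn.prems * by simp
qed auto

lemma wf_subst:
  assumes "wf_fm L \<phi>" "\<And>v. v \<in> fv \<phi> \<Longrightarrow> wf_tm L (\<sigma> v) \<and> sort_of L (\<sigma> v) = fst v"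
  shows "wf_fm L (subst \<sigma> \<phi>)"
  using assms
proof (induction \<phi> arbitrary: \<sigma>)
  case (Eq t u)
  then show ?case using wf_subst_tm[of L t \<sigma>] wf_subst_tm[of L u \<sigma>] by simp
next
  case (Rel r ts)
  have *: "wf_tm L (subst_tm \<sigma> t) \<and> sort_of L (subst_tm \<sigma> t) = sort_of L t" if "t \<in> set ts" for t
    using Rel that by (intro wf_subst_tm) auto
  then have "map (sort_of L \<circ> subst_tm \<sigma>) ts = map (sort_of L) ts" by (intro map_cong) auto
  then have "map (sort_of L \<circ> subst_tm \<sigma>) ts = rdom L r" using Rel.prems(1) by (simp only: wf_fm.simps)
  then show ?case using Rel.prems * by simp
next
  case (All v \<phi>)
  then show ?case by auto
qed auto

lemma wf_fv_sorts:
  fixes \<phi> :: "('s, 'f, 'r, 'a) form"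
  shows "wf_fm L \<phi> \<Longrightarrow> v \<in> fv \<phi> \<Longrightarrow> fst v \<in> sorts L"
proof -
  have tm: "wf_tm L t \<Longrightarrow> v \<in> tm_vars t \<Longrightarrow> fst v \<in> sorts L" for t :: "('s, 'f, 'a) term'"
    by (induction t) auto
  show "wf_fm L \<phi> \<Longrightarrow> v \<in> fv \<phi> \<Longrightarrow> fst v \<in> sorts L" by (induction \<phi>) (auto dest: tm)
qed

lemma finite_tm: "finite (tm_vars t)" "finite (tm_pars t)"
  by (induction t) auto

lemma finite_fm: "finite (fm_vars \<phi>)" "finite (pars \<phi>)" "finite (fv \<phi>)"
  by (induction \<phi>) (auto simp: finite_tm)

lemma fv_fm_vars: "fv \<phi> \<subseteq> fm_vars \<phi>"
  by (induction \<phi>) auto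

lemma fmls_mono: "V \<subseteq> V' \<Longrightarrow> A \<subseteq> A' \<Longrightarrow> fmls L V A \<subseteq> fmls L V' A'"
  by (auto simp: fmls_def)

lemma fmls_Neg [simp]: "Neg \<phi> \<in> fmls L V A \<longleftrightarrow> \<phi> \<in> fmls L V A"
  by (auto simp: fmls_def)

lemma fmls_Disj: "\<phi> \<in> fmls L V A \<Longrightarrow> \<psi> \<in> fmls L V A \<Longrightarrow> Disj \<phi> \<psi> \<in> fmls L V A"
  by (auto simp: fmls_def)

lemma ex_conj:
  assumes "finite \<Phi>" "\<Phi> \<subseteq> fmls L V A"
  shows "\<exists>\<zeta>\<in>fmls L V A. \<forall>M e. sat M e \<zeta> \<longleftrightarrow> (\<forall>\<phi>\<in>\<Phi>. sat M e \<phi>)"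
  using assms
proof (induction \<Phi> rule: finite_induct)
  case empty
  show ?case by (intro bexI[of _ "Neg Falsum"]) (auto simp: fmls_def)
next
  case (insert \<phi> \<Phi>)
  then obtain \<zeta> where "\<zeta> \<in> fmls L V A" "\<forall>M e. sat M e \<zeta> \<longleftrightarrow> (\<forall>\<phi>\<in>\<Phi>. sat M e \<phi>)" by auto
  then show ?case using insert.prems
    by (intro bexI[of _ "Neg (Imp \<phi> (Neg \<zeta>))"]) (auto simp: fmls_def)
qed

lemma inst_fmls:
  assumes "\<phi> \<in> fmls L V A" "V \<subseteq> insert x F" "\<And>v. v \<in> F \<Longrightarrow> v \<in> fv \<phi> \<Longrightarrow> (fst v, c v) \<in> B" "A \<subseteq> B"
  shows "inst x c \<phi> \<in> fmls L {x} B"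
proof -
  have wf: "wf_fm L \<phi>" "fv \<phi> \<subseteq> insert x F" "pars \<phi> \<subseteq> B" using assms by (auto simp: fmls_def)
  have "wf_fm L (inst x c \<phi>)"
    unfolding inst_def using wf wf_fv_sorts[OF wf(1)] by (intro wf_subst) auto
  moreover have "fv (inst x c \<phi>) \<subseteq> {x}"
    unfolding inst_def using fv_subst by (fastforce split: if_splits)
  moreover have "pars (inst x c \<phi>) \<subseteq> B"
  proof -
    have "tm_pars (if v = x then Var x else Par (fst v, c v)) \<subseteq> B" if "v \<in> fv \<phi>" for v
      using that wf(2) assms(3)[of v] by auto
    with pars_subst[of "\<lambda>v. if v = x then Var x else Par (fst v, c v)" \<phi>]
    show ?thesis unfolding inst_def using wf(3) by blast
  qed
  ultimately show ?thesis by (simp add: fmls_def)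
qed

lemma sat_inst: "sat M e (inst x c \<phi>) \<longleftrightarrow> sat M (c(x := e x)) \<phi>"
proof -
  have "sat M e (inst x c \<phi>) \<longleftrightarrow> sat M (\<lambda>v. eval M e (if v = x then Var x else Par (fst v, c v))) \<phi>"
    unfolding inst_def by (rule sat_subst) auto
  also have "(\<lambda>v. eval M e (if v = x then Var x else Par (fst v, c v))) = c(x := e x)" by auto
  finally show ?thesis .
qed

lemma holds_at_inst: "holds_at M a (inst x c \<phi>) \<longleftrightarrow> sat M (c(x := a)) \<phi>"
  by (simp add: holds_at_def sat_inst)

lemma holds_at_sat: "\<phi> \<in> fmls L {x} A \<Longrightarrow> e x = a \<Longrightarrow> holds_at M a \<phi> \<longleftrightarrow> sat M e \<phi>"
  unfolding holds_at_def by (rule sat_cong) (auto simp: fmls_def)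

fun unpar_tm :: "('c \<Rightarrow> 'v) \<Rightarrow> ('v, 'f, 'c) tm \<Rightarrow> ('v, 'f, 'c) tm" where
  "unpar_tm \<rho> (Var v) = Var v"
| "unpar_tm \<rho> (Par c) = Var (\<rho> c)"
| "unpar_tm \<rho> (Fn f ts) = Fn f (map (unpar_tm \<rho>) ts)"

fun unpar :: "('c \<Rightarrow> 'v) \<Rightarrow> ('v, 'f, 'r, 'c) fm \<Rightarrow> ('v, 'f, 'r, 'c) fm" where
  "unpar \<rho> Falsum = Falsum"
| "unpar \<rho> (Eq t u) = Eq (unpar_tm \<rho> t) (unpar_tm \<rho> u)"
| "unpar \<rho> (Rel r ts) = Rel r (map (unpar_tm \<rho>) ts)"
| "unpar \<rho> (Imp \<phi> \<psi>) = Imp (unpar \<rho> \<phi>) (unpar \<rho> \<psi>)"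
| "unpar \<rho> (All v \<phi>) = All v (unpar \<rho> \<phi>)"

lemma unpar_tm_vars: "tm_vars (unpar_tm \<rho> t) = tm_vars t \<union> \<rho> ` tm_pars t"
  by (induction t) auto

lemma unpar_tm_pars: "tm_pars (unpar_tm \<rho> t) = {}"
  by (induction t) auto

lemma unpar_pars: "pars (unpar \<rho> \<phi>) = {}"
  by (induction \<phi>) (auto simp: unpar_tm_pars)

lemma unpar_vars: "fm_vars (unpar \<rho> \<phi>) = fm_vars \<phi> \<union> \<rho> ` pars \<phi>"
  by (induction \<phi>) (auto simp: unpar_tm_vars)

lemma unpar_fv: "fv (unpar \<rho> \<phi>) \<subseteq> fv \<phi> \<union> \<rho> ` pars \<phi>"
  by (induction \<phi>) (auto simp: unpar_tm_vars)

lemma unpar_wf_tm: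
  assumes "wf_tm L t" "\<And>c. c \<in> tm_pars t \<Longrightarrow> fst (\<rho> c) = fst c"
  shows "wf_tm L (unpar_tm \<rho> t) \<and> sort_of L (unpar_tm \<rho> t) = sort_of L t"
  using assms
proof (induction t)
  case (Fn f ts)
  have *: "wf_tm L (unpar_tm \<rho> t) \<and> sort_of L (unpar_tm \<rho> t) = sort_of L t" if "t \<in> set ts" for t
    by (rule Fn.IH[OF that]) (use Fn.prems that in \<open>simp, fastforce\<close>)
  then have "map (sort_of L \<circ> unpar_tm \<rho>) ts = map (sort_of L) ts" by (intro map_cong) auto
  then have "map (sort_of L \<circ> unpar_tm \<rho>) ts = fdom L f" using Fn.prems(1) by (simp only: wf_tm.simps)
  then show ?case using Fn.prems * by simp
qed auto

lemma unpar_wf: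
  assumes "wf_fm L \<phi>" "\<And>c. c \<in> pars \<phi> \<Longrightarrow> fst (\<rho> c) = fst c"
  shows "wf_fm L (unpar \<rho> \<phi>)"
  using assms
proof (induction \<phi>)
  case (Eq t u)
  then show ?case using unpar_wf_tm[of L t \<rho>] unpar_wf_tm[of L u \<rho>] by simp
next
  case (Rel r ts)
  have *: "wf_tm L (unpar_tm \<rho> t) \<and> sort_of L (unpar_tm \<rho> t) = sort_of L t" if "t \<in> set ts" for t
    using Rel that by (intro unpar_wf_tm) auto
  then have "map (sort_of L \<circ> unpar_tm \<rho>) ts = map (sort_of L) ts" by (intro map_cong) auto
  then have "map (sort_of L \<circ> unpar_tm \<rho>) ts = rdom L r" using Rel.prems(1) by (simp only: wf_fm.simps)
  then show ?case using Rel.prems * by simp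
qed auto

lemma eval_unpar_tm:
  "(\<And>c. c \<in> tm_pars t \<Longrightarrow> e (\<rho> c) = snd c) \<Longrightarrow> eval M e (unpar_tm \<rho> t) = eval M e t"
proof (induction t)
  case (Fn f ts)
  have "eval M e (unpar_tm \<rho> u) = eval M e u" if u: "u \<in> set ts" for u
    by (rule Fn.IH[OF u], rule Fn.prems) (use u in \<open>simp, blast\<close>)
  then have "map (eval M e) (map (unpar_tm \<rho>) ts) = map (eval M e) ts" by simp
  then show ?case by (simp only: eval.simps unpar_tm.simps)
qed simp_all

lemma sat_unpar:
  assumes "\<And>c. c \<in> pars \<phi> \<Longrightarrow> e (\<rho> c) = snd c \<and> \<rho> c \<notin> fm_vars \<phi>"
  shows "sat M e (unpar \<rho> \<phi>) \<longleftrightarrow> sat M e \<phi>"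
  using assms
proof (induction \<phi> arbitrary: e)
  case (Eq t u)
  then show ?case by (simp add: eval_unpar_tm)
next
  case (Rel r ts)
  have "eval M e (unpar_tm \<rho> u) = eval M e u" if u: "u \<in> set ts" for u
  proof (rule eval_unpar_tm)
    fix c assume "c \<in> tm_pars u"
    then have "c \<in> pars (Rel r ts)" using u by auto
    then show "e (\<rho> c) = snd c" using Rel.prems by blast
  qed
  then have "map (eval M e) (map (unpar_tm \<rho>) ts) = map (eval M e) ts" by simp
  then show ?case by (simp only: sat.simps unpar.simps)
next
  case (All v \<phi>)
  have "sat M (e(v := a)) (unpar \<rho> \<phi>) \<longleftrightarrow> sat M (e(v := a)) \<phi>" for a
    using All.prems by (intro All.IH) auto
  then show ?case by simp
qed auto

text \<open>Elementarity, the order property and invariance speak of formulas without parameters; this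
  lemma transfers them to formulas with parameters.  The variables in \<open>F\<close> are fresh names for the parameters of \<open>\<phi>\<close>, and \<open>c\<close> assigns to them the
  parameters that they name.\<close>
lemma parameters_as_variables:
  fixes \<phi> :: "('s, 'f, 'r, 'a) form"
  assumes \<phi>: "\<phi> \<in> fmls L V A" and W: "finite W"
  shows "\<exists>\<phi>0 F c. \<phi>0 \<in> fmls L (V \<union> F) {} \<and> finite F \<and> F \<inter> W = {} \<and> F \<inter> fm_vars \<phi> = {} \<and>
    fm_vars \<phi>0 \<subseteq> fm_vars \<phi> \<union> F \<and> (\<forall>v\<in>F. (fst v, c v) \<in> pars \<phi>) \<and>
    (\<forall>M e. (\<forall>v\<in>F. e v = c v) \<longrightarrow> (sat M e \<phi> \<longleftrightarrow> sat M e \<phi>0))"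
proof -
  obtain g :: "'s \<times> 'a \<Rightarrow> nat" where g: "inj_on g (pars \<phi>)"
    using finite_imp_inj_to_nat_seg[OF finite_fm(2), of \<phi>] by blast
  define k where "k = Suc (Max (insert 0 (snd ` (W \<union> fm_vars \<phi>))))"
  define \<rho> where "\<rho> c = (fst c, k + g c)" for c :: "'s \<times> 'a"
  define F where "F = \<rho> ` pars \<phi>"
  define c where "c v = snd (the_inv_into (pars \<phi>) \<rho> v)" for v
  have inj: "inj_on \<rho> (pars \<phi>)" using g by (auto simp: inj_on_def \<rho>_def)
  have "snd v < k" if "v \<in> W \<union> fm_vars \<phi>" for v
  proof -
    have "snd v \<le> Max (insert 0 (snd ` (W \<union> fm_vars \<phi>)))"
      using that W finite_fm(1)[of \<phi>] by (intro Max_ge) auto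
    then show ?thesis by (simp add: k_def)
  qed
  then have fresh: "\<rho> d \<notin> W \<union> fm_vars \<phi>" for d by (force simp: \<rho>_def)
  have c: "c (\<rho> d) = snd d" if "d \<in> pars \<phi>" for d
    using the_inv_into_f_f[OF inj that] by (simp add: c_def)
  have wf: "wf_fm L (unpar \<rho> \<phi>)" using \<phi> by (intro unpar_wf) (auto simp: fmls_def \<rho>_def)
  have "unpar \<rho> \<phi> \<in> fmls L (V \<union> F) {}"
    using \<phi> wf unpar_fv[of \<rho> \<phi>] unpar_pars[of \<rho> \<phi>] by (auto simp: fmls_def F_def)
  moreover have "finite F" "F \<inter> W = {}" "F \<inter> fm_vars \<phi> = {}"
    using fresh finite_fm(2)[of \<phi>] by (auto simp: F_def)
  moreover have "fm_vars (unpar \<rho> \<phi>) \<subseteq> fm_vars \<phi> \<union> F" by (simp add: unpar_vars F_def)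
  moreover have "\<forall>v\<in>F. (fst v, c v) \<in> pars \<phi>"
    using c by (auto simp: F_def) (simp add: \<rho>_def)
  moreover have "\<forall>M e. (\<forall>v\<in>F. e v = c v) \<longrightarrow> (sat M e \<phi> \<longleftrightarrow> sat M e (unpar \<rho> \<phi>))"
    using fresh c by (auto simp: F_def sat_unpar)
  ultimately show ?thesis by blast
qed

lemma ex_assign: "is_struct L M \<Longrightarrow> \<exists>e. e \<in> assign L M"
proof -
  assume "is_struct L M"
  then have "\<forall>s. \<exists>a. s \<in> sorts L \<longrightarrow> a \<in> univ M s" by (auto simp: is_struct_def)
  then obtain f where "\<forall>s. s \<in> sorts L \<longrightarrow> f s \<in> univ M s" by metis
  then show ?thesis by (intro exI[of _ "\<lambda>v. f (fst v)"]) (auto simp: assign_def)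
qed

lemma assign_upd: "e \<in> assign L M \<Longrightarrow> a \<in> univ M (fst x) \<Longrightarrow> e(x := a) \<in> assign L M"
  by (auto simp: assign_def)

lemma elem_sub_assign: "elem_sub L N M \<Longrightarrow> e \<in> assign L N \<Longrightarrow> e \<in> assign L M"
  by (auto simp: elem_sub_def assign_def)

lemma elem_sub_elems: "elem_sub L N M \<Longrightarrow> elems L N \<subseteq> elems L M"
  by (auto simp: elem_sub_def elems_def)

lemma elem_sub_univ: "elem_sub L N M \<Longrightarrow> s \<in> sorts L \<Longrightarrow> univ N s \<subseteq> univ M s"
  by (auto simp: elem_sub_def)

lemma elem_sub_sat:
  assumes NM: "elem_sub L N M" and \<phi>: "\<phi> \<in> fmls L UNIV (elems L N)" and e: "e \<in> assign L N"
  shows "sat N e \<phi> \<longleftrightarrow> sat M e \<phi>"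
proof -
  obtain \<phi>0 F c where \<phi>0: "\<phi>0 \<in> fmls L (UNIV \<union> F) {}" "F \<inter> fm_vars \<phi> = {}"
    "\<forall>v\<in>F. (fst v, c v) \<in> pars \<phi>"
    "\<forall>M e. (\<forall>v\<in>F. e v = c v) \<longrightarrow> (sat M e \<phi> \<longleftrightarrow> sat M e \<phi>0)"
    using parameters_as_variables[OF \<phi> finite.emptyI] by blast
  define e' where "e' = override_on e c F"
  have ce: "sat K e \<phi> \<longleftrightarrow> sat K e' \<phi>" for K
    using \<phi>0(2) fv_fm_vars[of \<phi>] by (intro sat_cong) (auto simp: e'_def override_on_def)
  have pN: "pars \<phi> \<subseteq> elems L N" using \<phi> by (simp add: fmls_def)
  then have "e' \<in> assign L N"
    using e \<phi>0(3) unfolding e'_def override_on_def assign_def by (auto simp: elems_def)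
  then have "sat N e' \<phi>0 \<longleftrightarrow> sat M e' \<phi>0" using NM \<phi>0(1) by (auto simp: elem_sub_def)
  then show ?thesis using ce \<phi>0(4) by (simp add: e'_def)
qed

lemma elem_sub_struct: "elem_sub L N M \<Longrightarrow> is_struct L N \<and> is_struct L M"
  by (simp add: elem_sub_def)

lemma elem_sub_holds_at:
  assumes NM: "elem_sub L N M" and \<phi>: "\<phi> \<in> fmls L {x} (elems L N)" and a: "a \<in> univ N (fst x)"
  shows "holds_at N a \<phi> \<longleftrightarrow> holds_at M a \<phi>"
proof -
  obtain e where "e \<in> assign L N" using ex_assign elem_sub_struct[OF NM] by blast
  then have "e(x := a) \<in> assign L N" using a by (rule assign_upd)
  then have "sat N (e(x := a)) \<phi> \<longleftrightarrow> sat M (e(x := a)) \<phi>"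
    using \<phi> fmls_mono[of "{x}" UNIV] by (intro elem_sub_sat[OF NM]) blast+
  then show ?thesis using holds_at_sat[OF \<phi>, of "e(x := a)" a] by simp
qed

lemma stable_rel_formula:
  fixes \<phi> :: "('s, 'f, 'r, 'a) form"
  assumes T: "stable_theory L T" "model_of L T M" and \<phi>: "\<phi> \<in> fmls L UNIV (elems L M)"
  shows "stable_rel (univ M (fst x)) (assign L M) (\<lambda>a c. sat M (c(x := a)) \<phi>)"
proof -
  have no: "\<not> (\<exists>a b. range a \<subseteq> univ M (fst x) \<and> range b \<subseteq> assign L M \<and>
      (\<forall>i j::nat. sat M ((b j)(x := a i)) \<phi> \<longleftrightarrow> i < j))" if \<phi>: "\<phi> \<in> fmls L UNIV (elems L M)" for \<phi>
  proof
    assume "\<exists>a b. range a \<subseteq> univ M (fst x) \<and> range b \<subseteq> assign L M \<and>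
      (\<forall>i j::nat. sat M ((b j)(x := a i)) \<phi> \<longleftrightarrow> i < j)"
    then obtain a b where "range a \<subseteq> univ M (fst x)" "range b \<subseteq> assign L M"
      and ij: "\<forall>i j::nat. sat M ((b j)(x := a i)) \<phi> \<longleftrightarrow> i < j" by (elim exE conjE) (rule that)
    then have ab: "a i \<in> univ M (fst x)" "b i \<in> assign L M"
      "sat M ((b j)(x := a i)) \<phi> \<longleftrightarrow> i < j" for i j
      by (simp_all add: range_subsetD)
    obtain \<phi>0 F c where \<phi>0: "\<phi>0 \<in> fmls L (UNIV \<union> F) {}" "F \<inter> {x} = {}" "F \<inter> fm_vars \<phi> = {}"
      "\<forall>v\<in>F. (fst v, c v) \<in> pars \<phi>"
      "\<forall>M e. (\<forall>v\<in>F. e v = c v) \<longrightarrow> (sat M e \<phi> \<longleftrightarrow> sat M e \<phi>0)"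
      using parameters_as_variables[OF \<phi> finite.insertI[OF finite.emptyI, of x]]
      by (elim exE conjE) (rule that; assumption)
    define b' where "b' j = override_on (b j) c F" for j
    define a' where "a' i = (b 0)(x := a i)" for i
    have pM: "pars \<phi> \<subseteq> elems L M" using \<phi> by (simp add: fmls_def)
    have "b' j \<in> assign L M" "a' i \<in> assign L M" for i j
      using ab \<phi>0(4) pM unfolding b'_def override_on_def assign_def a'_def by (auto simp: elems_def)
    moreover have "sat M (override_on (b' j) (a' i) {x}) \<phi>0 \<longleftrightarrow> i < j" for i j
    proof -
      have "sat M (override_on (b' j) (a' i) {x}) \<phi>0 \<longleftrightarrow> sat M (override_on (b' j) (a' i) {x}) \<phi>"
        using \<phi>0(2,5) by (auto simp: b'_def override_on_def)
      also have "\<dots> \<longleftrightarrow> sat M ((b j)(x := a i)) \<phi>"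
        using \<phi>0(3) fv_fm_vars[of \<phi>]
        by (intro sat_cong) (auto simp: b'_def a'_def override_on_def)
      finally show ?thesis using ab(3) by simp
    qed
    ultimately have "order_property L M \<phi>0 {x}"
      unfolding order_property_def by (intro exI[of _ a'] exI[of _ b']) auto
    then show False using T \<phi>0(1) by (auto simp: stable_theory_def)
  qed
  from no[OF \<phi>] no[of "Neg \<phi>"] \<phi> show ?thesis unfolding stable_rel_def by simp
qed

section \<open>Types and ultrafilters\<close>

text \<open>A type over any parameter set is induced by an ultrafilter on the model itself, because it is finitely
  satisfiable there.  Conversely every ultrafilter on the model induces types over all parameter
  sets; over a larger model this is the coheir.\<close>
lemma types_ultra:
  assumes p: "p \<in> types L M x A"
  shows "\<exists>U. ultra U \<and> (\<forall>\<^sub>F a in U. a \<in> univ M (fst x)) \<and>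
           (\<forall>\<phi>\<in>fmls L {x} A. \<phi> \<in> p \<longleftrightarrow> (\<forall>\<^sub>F a in U. holds_at M a \<phi>))"
proof -
  define D where "D \<phi> = {a \<in> univ M (fst x). holds_at M a \<phi>}" for \<phi>
  have "\<exists>U. ultra U \<and> (\<forall>S\<in>insert (univ M (fst x)) (D ` p). \<forall>\<^sub>F a in U. a \<in> S)"
  proof (rule ultra_of_fip)
    fix \<F> assume F: "finite \<F>" "\<F> \<subseteq> insert (univ M (fst x)) (D ` p)"
    then have "finite (\<F> - {univ M (fst x)})" "\<F> - {univ M (fst x)} \<subseteq> D ` p" by auto
    from finite_subset_image[OF this]
    obtain \<Phi> where \<Phi>: "\<Phi> \<subseteq> p" "finite \<Phi>" "\<F> - {univ M (fst x)} = D ` \<Phi>" by blast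
    then obtain a where a: "a \<in> univ M (fst x)" "\<forall>\<phi>\<in>\<Phi>. holds_at M a \<phi>"
      using p unfolding types_def by blast
    have "a \<in> S" if S: "S \<in> \<F>" for S
    proof (cases "S = univ M (fst x)")
      case False
      then have "S \<in> D ` \<Phi>" using \<Phi>(3) S by blast
      then show ?thesis using a by (auto simp: D_def)
    qed (use a in simp)
    then show "\<Inter>\<F> \<noteq> {}" by blast
  qed
  then obtain U where U: "ultra U" "\<forall>\<^sub>F a in U. a \<in> univ M (fst x)"
    "\<And>\<phi>. \<phi> \<in> p \<Longrightarrow> \<forall>\<^sub>F a in U. a \<in> D \<phi>" by blast
  have ev: "\<forall>\<^sub>F a in U. holds_at M a \<phi>" if "\<phi> \<in> p" for \<phi>
    using U(3)[OF that] by (rule eventually_mono) (simp add: D_def)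
  have "\<phi> \<in> p" if \<phi>: "\<phi> \<in> fmls L {x} A" "\<forall>\<^sub>F a in U. holds_at M a \<phi>" for \<phi>
  proof (rule ccontr)
    assume "\<phi> \<notin> p"
    then have "Neg \<phi> \<in> p" using p \<phi>(1) by (auto simp: types_def)
    from ev[OF this] have "\<forall>\<^sub>F a in U. \<not> holds_at M a \<phi>" by (simp add: holds_at_def)
    then show False using \<phi>(2) ultra_not[OF U(1)] by blast
  qed
  then show ?thesis using U ev by blast
qed

lemma ultra_types:
  assumes U: "ultra U" "\<forall>\<^sub>F a in U. a \<in> univ M (fst x)"
  shows "{\<phi> \<in> fmls L {x} A. \<forall>\<^sub>F a in U. holds_at M a \<phi>} \<in> types L M x A"
proof -
  have "\<forall>\<^sub>F a in U. holds_at M a (Neg \<phi>)" if "\<not> (\<forall>\<^sub>F a in U. holds_at M a \<phi>)" for \<phi>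
    using that ultra_not[OF U(1), of "\<lambda>a. holds_at M a \<phi>"] by (simp add: holds_at_def)
  moreover have "\<exists>a\<in>univ M (fst x). \<forall>\<phi>\<in>\<Phi>. holds_at M a \<phi>"
    if "finite \<Phi>" "\<Phi> \<subseteq> {\<phi> \<in> fmls L {x} A. \<forall>\<^sub>F a in U. holds_at M a \<phi>}" for \<Phi>
  proof -
    have "\<forall>\<^sub>F a in U. \<forall>\<phi>\<in>\<Phi>. holds_at M a \<phi>"
      using that by (intro eventually_ball_finite) auto
    from ultra_ex[OF U(1) eventually_conj[OF U(2) this]] show ?thesis by blast
  qed
  ultimately show ?thesis by (auto simp: types_def)
qed

lemma types_equiv:
  assumes "p \<in> types L M x A" "\<phi> \<in> fmls L {x} A" "\<psi> \<in> fmls L {x} A"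
    and "\<And>a. a \<in> univ M (fst x) \<Longrightarrow> holds_at M a \<phi> \<longleftrightarrow> holds_at M a \<psi>"
  shows "\<phi> \<in> p \<longleftrightarrow> \<psi> \<in> p"
proof -
  obtain U where U: "ultra U" "\<forall>\<^sub>F a in U. a \<in> univ M (fst x)"
    "\<forall>\<phi>\<in>fmls L {x} A. \<phi> \<in> p \<longleftrightarrow> (\<forall>\<^sub>F a in U. holds_at M a \<phi>)"
    using types_ultra[OF assms(1)] by blast
  have "(\<forall>\<^sub>F a in U. holds_at M a \<phi>) \<longleftrightarrow> (\<forall>\<^sub>F a in U. holds_at M a \<psi>)"
    by (rule eventually_subst, rule eventually_mono[OF U(2)]) (rule assms(4))
  then show ?thesis using U(3) assms by blast
qed

lemma types_Neg: "p \<in> types L M x A \<Longrightarrow> \<phi> \<in> fmls L {x} A \<Longrightarrow> Neg \<phi> \<in> p \<longleftrightarrow> \<phi> \<notin> p"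
proof -
  assume p: "p \<in> types L M x A" "\<phi> \<in> fmls L {x} A"
  have "\<not> (\<phi> \<in> p \<and> Neg \<phi> \<in> p)"
  proof
    assume "\<phi> \<in> p \<and> Neg \<phi> \<in> p"
    moreover have "\<forall>\<Phi>. finite \<Phi> \<and> \<Phi> \<subseteq> p \<longrightarrow> (\<exists>a\<in>univ M (fst x). \<forall>\<psi>\<in>\<Phi>. holds_at M a \<psi>)"
      using p(1) by (simp add: types_def)
    from this[rule_format, of "{\<phi>, Neg \<phi>}"] calculation
    obtain a where "holds_at M a \<phi>" "holds_at M a (Neg \<phi>)" by auto
    then show False by (simp add: holds_at_def)
  qed
  moreover have "\<phi> \<in> p \<or> Neg \<phi> \<in> p" using p by (simp add: types_def)
  ultimately show ?thesis by blast
qed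

lemma types_sub: "p \<in> types L M x A \<Longrightarrow> p \<subseteq> fmls L {x} A"
  by (simp add: types_def)

lemma types_restrict:
  assumes "p \<in> types L M x A" "B \<subseteq> A"
  shows "p \<inter> fmls L {x} B \<in> types L M x B"
proof -
  have "fmls L {x} B \<subseteq> fmls L {x} A" using assms(2) by (intro fmls_mono) auto
  then show ?thesis using assms(1) by (auto simp: types_def subset_iff)
qed

lemma realizes_iff:
  assumes "p \<in> types L M x A" "realizes M x a p" "\<phi> \<in> fmls L {x} A"
  shows "\<phi> \<in> p \<longleftrightarrow> holds_at M a \<phi>"
proof
  assume "holds_at M a \<phi>"
  then have "Neg \<phi> \<notin> p" using assms(2) by (auto simp: realizes_def holds_at_def)
  then show "\<phi> \<in> p" using types_Neg[OF assms(1,3)] by blast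
qed (use assms in \<open>simp add: realizes_def\<close>)

lemma tp_types:
  assumes "a \<in> univ M (fst x)"
  shows "tp L M x a A \<in> types L M x A"
  using assms by (auto simp: types_def tp_def holds_at_def)

lemma types_extend_eq:
  assumes "p \<in> types L M x A" "p' \<in> types L M x B" "A \<subseteq> B" "p \<subseteq> p'" "\<phi> \<in> fmls L {x} A"
  shows "\<phi> \<in> p' \<longleftrightarrow> \<phi> \<in> p"
proof -
  have "\<phi> \<in> fmls L {x} B" using assms(3,5) fmls_mono[of "{x}" "{x}" A B] by blast
  then show ?thesis using types_Neg[OF assms(1,5)] types_Neg[OF assms(2), of \<phi>] assms(4) by blast
qed

text \<open>Finite satisfiability is expressed by an existential formula.\<close>
lemma types_elem_sub:
  assumes NM: "elem_sub L N M" and A: "A \<subseteq> elems L N" and x: "fst x \<in> sorts L"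
  shows "types L N x A = types L M x A"
proof -
  have eq: "(\<exists>a\<in>univ N (fst x). \<forall>\<phi>\<in>\<Phi>. holds_at N a \<phi>) \<longleftrightarrow> (\<exists>a\<in>univ M (fst x). \<forall>\<phi>\<in>\<Phi>. holds_at M a \<phi>)"
    if \<Phi>: "finite \<Phi>" "\<Phi> \<subseteq> fmls L {x} A" for \<Phi>
  proof -
    obtain \<zeta> where \<zeta>: "\<zeta> \<in> fmls L {x} A" "\<And>M e. sat M e \<zeta> \<longleftrightarrow> (\<forall>\<phi>\<in>\<Phi>. sat M e \<phi>)"
      using ex_conj[OF \<Phi>] by blast
    obtain e where e: "e \<in> assign L N" using ex_assign elem_sub_struct[OF NM] by blast
    let ?\<theta> = "Neg (All x (Neg \<zeta>))"
    have h: "sat K (e(x := a)) \<zeta> \<longleftrightarrow> (\<forall>\<phi>\<in>\<Phi>. holds_at K a \<phi>)" for K a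
      using \<zeta>(2) \<Phi>(2) holds_at_sat[of _ L x A "e(x := a)" a K] by (simp add: subset_iff)
    have "?\<theta> \<in> fmls L UNIV (elems L N)" using \<zeta>(1) A x by (auto simp: fmls_def)
    from elem_sub_sat[OF NM this e] show ?thesis by (simp add: h)
  qed
  have "p \<in> types L N x A \<longleftrightarrow> p \<in> types L M x A" for p
  proof (cases "p \<subseteq> fmls L {x} A")
    case True
    have "(finite \<Phi> \<and> \<Phi> \<subseteq> p \<longrightarrow> (\<exists>a\<in>univ N (fst x). \<forall>\<phi>\<in>\<Phi>. holds_at N a \<phi>)) \<longleftrightarrow>
      (finite \<Phi> \<and> \<Phi> \<subseteq> p \<longrightarrow> (\<exists>a\<in>univ M (fst x). \<forall>\<phi>\<in>\<Phi>. holds_at M a \<phi>))" for \<Phi>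
      using eq[OF _ order_trans[OF _ True], of \<Phi>] by argo
    then show ?thesis by (simp only: types_def mem_Collect_eq)
  qed (simp add: types_def)
  then show ?thesis by blast
qed

section \<open>The downward Loewenheim-Skolem theorem\<close>

text \<open>To bound the number of formulas, terms and formulas are written as lists of tokens in Polish
  notation, which is a prefix code.\<close>
type_synonym ('s, 'f, 'r, 'a) token = "(nat + ('s + ('f + 'r))) + ('s \<times> 'a)"

abbreviation tokN :: "nat \<Rightarrow> ('s, 'f, 'r, 'a) token" where "tokN n \<equiv> Inl (Inl n)"
abbreviation tokS :: "'s \<Rightarrow> ('s, 'f, 'r, 'a) token" where "tokS s \<equiv> Inl (Inr (Inl s))"
abbreviation tokF :: "'f \<Rightarrow> ('s, 'f, 'r, 'a) token" where "tokF f \<equiv> Inl (Inr (Inr (Inl f)))"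
abbreviation tokR :: "'r \<Rightarrow> ('s, 'f, 'r, 'a) token" where "tokR r \<equiv> Inl (Inr (Inr (Inr r)))"
abbreviation tokP :: "'s \<times> 'a \<Rightarrow> ('s, 'f, 'r, 'a) token" where "tokP c \<equiv> Inr c"

fun enc_tm :: "('s, 'f, 'a) term' \<Rightarrow> ('s, 'f, 'r, 'a) token list" where
  "enc_tm (Var v) = [tokN 0, tokS (fst v), tokN (snd v)]"
| "enc_tm (Par c) = [tokN 1, tokP c]"
| "enc_tm (Fn f ts) = tokN 2 # tokF f # tokN (length ts) # concat (map enc_tm ts)"

fun enc_fm :: "('s, 'f, 'r, 'a) form \<Rightarrow> ('s, 'f, 'r, 'a) token list" where
  "enc_fm Falsum = [tokN 0]"
| "enc_fm (Eq t u) = tokN 1 # enc_tm t @ enc_tm u"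
| "enc_fm (Rel r ts) = tokN 2 # tokR r # tokN (length ts) # concat (map enc_tm ts)"
| "enc_fm (Imp \<phi> \<psi>) = tokN 3 # enc_fm \<phi> @ enc_fm \<psi>"
| "enc_fm (All v \<phi>) = tokN 4 # tokS (fst v) # tokN (snd v) # enc_fm \<phi>"

lemma enc_list_prefix:
  assumes "\<And>t u xs ys. t \<in> set ts \<Longrightarrow> enc t @ xs = enc u @ ys \<Longrightarrow> t = u \<and> xs = ys"
  shows "length ts = length us \<Longrightarrow> concat (map enc ts) @ xs = concat (map enc us) @ ys \<Longrightarrow>
    ts = us \<and> xs = ys"
  using assms
proof (induction ts arbitrary: us)
  case (Cons t ts)
  obtain u us' where us: "us = u # us'" using Cons.prems(1) by (cases us) auto
  have "enc t @ (concat (map enc ts) @ xs) = enc u @ (concat (map enc us') @ ys)"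
    using Cons.prems(2) us by simp
  then have "t = u" "concat (map enc ts) @ xs = concat (map enc us') @ ys"
    using Cons.prems(3)[of t] by auto
  moreover from this have "ts = us' \<and> xs = ys"
    using Cons.prems us by (intro Cons.IH) auto
  ultimately show ?case using us by simp
qed simp

lemma enc_tm_prefix: "enc_tm t @ xs = enc_tm u @ ys \<Longrightarrow> t = u \<and> xs = ys"
proof (induction t arbitrary: u xs ys)
  case (Var v)
  then show ?case by (cases u) (auto simp: prod_eq_iff)
next
  case (Par c)
  then show ?case by (cases u) auto
next
  case (Fn f ts)
  then show ?case
  proof (cases u)
    case (Fn g us)
    have "length ts = length us" "f = g" "concat (map enc_tm ts) @ xs = concat (map enc_tm us) @ ys"
      using Fn.prems Fn by simp_all
    then show ?thesis using enc_list_prefix[of ts enc_tm us xs ys] Fn.IH Fn by blast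
  qed auto
qed

lemma enc_fm_prefix: "enc_fm \<phi> @ xs = enc_fm \<psi> @ ys \<Longrightarrow> \<phi> = \<psi> \<and> xs = ys"
proof (induction \<phi> arbitrary: \<psi> xs ys)
  case Falsum
  then show ?case by (cases \<psi>) auto
next
  case (Eq t u)
  then show ?case
  proof (cases \<psi>)
    case (Eq t' u')
    then have "enc_tm t @ (enc_tm u @ xs) = enc_tm t' @ (enc_tm u' @ ys)" using Eq.prems by simp
    then have "t = t'" "enc_tm u @ xs = enc_tm u' @ ys" using enc_tm_prefix by blast+
    then show ?thesis using enc_tm_prefix Eq by blast
  qed auto
next
  case (Rel r ts)
  then show ?case
  proof (cases \<psi>)
    case (Rel q us)
    have "length ts = length us" "r = q" "concat (map enc_tm ts) @ xs = concat (map enc_tm us) @ ys"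
      using Rel.prems Rel by simp_all
    then show ?thesis using enc_list_prefix[of ts enc_tm us xs ys] enc_tm_prefix Rel by blast
  qed auto
next
  case (Imp \<phi>1 \<phi>2)
  note IH = Imp.IH and eq = Imp.prems
  show ?case
  proof (cases \<psi>)
    case (Imp \<psi>1 \<psi>2)
    have "enc_fm \<phi>1 @ (enc_fm \<phi>2 @ xs) = enc_fm \<psi>1 @ (enc_fm \<psi>2 @ ys)"
      using eq unfolding Imp by simp
    from IH(1)[OF this] have 1: "\<phi>1 = \<psi>1" and "enc_fm \<phi>2 @ xs = enc_fm \<psi>2 @ ys" by simp_all
    from IH(2)[OF this(2)] 1 Imp show ?thesis by simp
  qed (use eq in simp_all)
next
  case (All v \<phi>)
  note IH = All.IH and eq = All.prems
  show ?case
  proof (cases \<psi>)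
    case (All w \<psi>')
    have "enc_fm \<phi> @ xs = enc_fm \<psi>' @ ys" "fst v = fst w" "snd v = snd w"
      using eq unfolding All by simp_all
    then show ?thesis using IH[of xs \<psi>' ys] All by (simp add: prod_eqI)
  qed (use eq in simp_all)
qed

definition tokens :: "('s, 'f, 'r) lang \<Rightarrow> ('s, 'a) param set \<Rightarrow> ('s, 'f, 'r, 'a) token set" where
  "tokens L B = ((UNIV :: nat set) <+> (sorts L <+> (funs L <+> rels L))) <+> B"

lemma set_enc_tm: "wf_tm L t \<Longrightarrow> tm_pars t \<subseteq> B \<Longrightarrow> set (enc_tm t) \<subseteq> tokens L B"
  by (induction t) (auto simp: tokens_def)

lemma set_enc_fm: "wf_fm L \<phi> \<Longrightarrow> pars \<phi> \<subseteq> B \<Longrightarrow> set (enc_fm \<phi>) \<subseteq> tokens L B"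
proof (induction \<phi>)
  case (Eq t u)
  then show ?case using set_enc_tm[of L t B] set_enc_tm[of L u B] by (auto simp: tokens_def)
next
  case (Rel r ts)
  have "set (enc_tm t) \<subseteq> tokens L B" if "t \<in> set ts" for t
    using Rel that by (intro set_enc_tm) auto
  then show ?case using Rel by (auto simp: tokens_def)
qed (auto simp: tokens_def)

lemma lists_ordLeq:
  assumes "infinite K"
  shows "|lists K| \<le>o |K|"
proof -
  have "|{xs \<in> lists K. length xs = n}| \<le>o |K|" for n
  proof (induction n)
    case 0
    have "finite {xs \<in> lists K. length xs = 0}" by (rule finite_subset[of _ "{[]}"]) auto
    then have "|{xs \<in> lists K. length xs = 0}| <o |K|"
      using assms by (intro finite_ordLess_infinite[OF card_of_Well_order card_of_Well_order])
        (simp_all add: Field_card_of)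
    then show ?case by (rule ordLess_imp_ordLeq)
  next
    case (Suc n)
    let ?C = "(\<lambda>(x, xs). x # xs) ` (K \<times> {xs \<in> lists K. length xs = n})"
    have "ys \<in> ?C" if "ys \<in> {xs \<in> lists K. length xs = Suc n}" for ys
      using that by (cases ys) (auto intro!: image_eqI[of _ _ "(hd ys, tl ys)"])
    then have "|{xs \<in> lists K. length xs = Suc n}| \<le>o |?C|" by (intro card_of_mono1) blast
    also have "|?C| \<le>o |K \<times> {xs \<in> lists K. length xs = n}|" by (rule card_of_image)
    also have "|K \<times> {xs \<in> lists K. length xs = n}| \<le>o |K|"
      using assms Suc card_of_Card_order[of K] card_of_mono1[OF order_refl, of K]
      by (intro card_of_Times_ordLeq_infinite_Field) (simp_all only: Field_card_of, simp_all)
    finally show ?case .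
  qed
  then have "|\<Union>n\<in>(UNIV::nat set). {xs \<in> lists K. length xs = n}| \<le>o |K|"
    using assms by (intro card_of_UNION_ordLeq_infinite) (auto simp: infinite_iff_card_of_nat)
  moreover have "(\<Union>n\<in>(UNIV::nat set). {xs \<in> lists K. length xs = n}) = lists K" by auto
  ultimately show ?thesis by simp
qed

lemma fmls_ordLeq:
  assumes B: "|B| \<le>o |tokens L A|"
  shows "|fmls L V B| \<le>o |tokens L A|"
proof -
  have inf: "infinite (tokens L A)" "infinite (tokens L B)"
    by (auto simp: tokens_def)
  have "inj_on enc_fm (fmls L V B)"
    using enc_fm_prefix[of _ "[]" _ "[]"] by (auto intro!: inj_onI)
  moreover have "enc_fm ` fmls L V B \<subseteq> lists (tokens L B)"
  proof (intro image_subsetI)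
    fix \<phi> assume "\<phi> \<in> fmls L V B"
    then have "set (enc_fm \<phi>) \<subseteq> tokens L B" by (intro set_enc_fm) (simp_all add: fmls_def)
    then show "enc_fm \<phi> \<in> lists (tokens L B)" by (simp add: in_lists_conv_set subset_iff)
  qed
  ultimately have "|fmls L V B| \<le>o |lists (tokens L B)|" using card_of_ordLeq by blast
  also have "|lists (tokens L B)| \<le>o |tokens L B|" by (rule lists_ordLeq[OF inf(2)])
  also have "|tokens L B| \<le>o |tokens L A|"
    unfolding tokens_def[of L B]
  proof (rule card_of_Plus_ordLeq_infinite_Field[OF _ _ B])
    show "infinite (Field |tokens L A| )" using inf(1) by (simp add: Field_card_of)
    show "Card_order |tokens L A|" by (rule card_of_Card_order)
    show "|(UNIV::nat set) <+> (sorts L <+> (funs L <+> rels L))| \<le>o |tokens L A|"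
      unfolding tokens_def by (rule card_of_Plus1)
  qed
  finally show ?thesis .
qed

lemma tokens_param: "|A| \<le>o |tokens L A|"
  unfolding tokens_def by (rule card_of_Plus2)

lemma infinite_Field:
  assumes "natLeq <o \<kappa>" "Card_order \<kappa>"
  shows "infinite (Field \<kappa>)"
proof -
  have "natLeq \<le>o |Field \<kappa>|"
    using assms card_of_Field_ordIso ordIso_symmetric ordLess_imp_ordLeq ordLeq_ordIso_trans by metis
  then show ?thesis using infinite_iff_natLeq_ordLeq[of "Field \<kappa>"] by blast
qed

lemma small_tokens:
  assumes \<kappa>: "Card_order \<kappa>" "natLeq <o \<kappa>" "|sorts L <+> funs L <+> rels L| <o \<kappa>" and A: "small \<kappa> A"
  shows "|tokens L A| <o \<kappa>"
proof -
  have nat: "|UNIV :: nat set| <o \<kappa>" using \<kappa>(2) card_of_nat ordIso_ordLess_trans by blast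
  note Plus = card_of_Plus_ordLess_infinite_Field[OF infinite_Field[OF \<kappa>(2,1)] \<kappa>(1)]
  show ?thesis
    unfolding tokens_def by (rule Plus[OF Plus[OF nat \<kappa>(3)] A[unfolded small_def]])
qed

text \<open>The formula to be witnessed is passed in the form \<open>All v \<phi>\<close>, which carries the variable and its
  sort; the witness refutes \<open>\<phi>\<close>.\<close>
fun witness :: "('s, 'f, 'r, 'a) fo_struct \<Rightarrow> ('s, 'f, 'r, 'a) form \<Rightarrow> ('s, 'a) param" where
  "witness M (All v \<phi>) = (fst v, SOME a. a \<in> univ M (fst v) \<and> \<not> holds_at M a \<phi>)"
| "witness M _ = undefined"

definition skolem_step ::
  "('s, 'f, 'r) lang \<Rightarrow> ('s, 'f, 'r, 'a) fo_struct \<Rightarrow> ('s, 'a) param set \<Rightarrow> ('s, 'a) param set" where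
  "skolem_step L M B = B \<union> (witness M ` fmls L {} B \<inter> elems L M)"

lemma skolem_step_ordLeq:
  assumes "|B| \<le>o |tokens L A|"
  shows "|skolem_step L M B| \<le>o |tokens L A|"
proof -
  have inf: "infinite (tokens L A)" by (auto simp: tokens_def)
  have "|witness M ` fmls L {} B \<inter> elems L M| \<le>o |witness M ` fmls L {} B|"
    by (rule card_of_mono1) auto
  also have "|witness M ` fmls L {} B| \<le>o |fmls L {} B|" by (rule card_of_image)
  also have "|fmls L {} B| \<le>o |tokens L A|" by (rule fmls_ordLeq[OF assms])
  finally show ?thesis
    unfolding skolem_step_def using assms inf card_of_Card_order[of "tokens L A"]
    by (intro card_of_Un_ordLeq_infinite_Field) (simp_all only: Field_card_of, simp_all)
qed

definition skolem_hull ::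
  "('s, 'f, 'r) lang \<Rightarrow> ('s, 'f, 'r, 'a) fo_struct \<Rightarrow> ('s, 'a) param set \<Rightarrow> ('s, 'a) param set" where
  "skolem_hull L M A = (\<Union>n. (skolem_step L M ^^ n) A)"

lemma skolem_hull_ordLeq: "|skolem_hull L M A| \<le>o |tokens L A|"
proof -
  have "|(skolem_step L M ^^ n) A| \<le>o |tokens L A|" for n
    by (induction n) (simp_all add: tokens_param skolem_step_ordLeq)
  moreover have "infinite (tokens L A)" by (auto simp: tokens_def)
  ultimately show ?thesis
    unfolding skolem_hull_def
    by (intro card_of_UNION_ordLeq_infinite) (auto simp: infinite_iff_card_of_nat)
qed

lemma skolem_hull_base: "A \<subseteq> skolem_hull L M A"
  unfolding skolem_hull_def using UN_upper[of 0 UNIV "\<lambda>n. (skolem_step L M ^^ n) A"] by simp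

lemma skolem_hull_elems: "A \<subseteq> elems L M \<Longrightarrow> skolem_hull L M A \<subseteq> elems L M"
proof -
  assume A: "A \<subseteq> elems L M"
  have "(skolem_step L M ^^ n) A \<subseteq> elems L M" for n
    by (induction n) (auto simp: A skolem_step_def)
  then show ?thesis by (auto simp: skolem_hull_def)
qed

text \<open>A formula over the hull has finitely many parameters, so it is witnessed after finitely many
  steps.\<close>
lemma skolem_hull_witness:
  assumes \<phi>: "\<phi> \<in> fmls L {v} (skolem_hull L M A)" and v: "fst v \<in> sorts L"
    and a: "a \<in> univ M (fst v)" "holds_at M a \<phi>"
  shows "\<exists>a. (fst v, a) \<in> skolem_hull L M A \<and> a \<in> univ M (fst v) \<and> holds_at M a \<phi>"
proof -
  let ?S = "\<lambda>n. (skolem_step L M ^^ n) A"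
  have mono: "?S n \<subseteq> ?S k" if "n \<le> k" for n k
    using that by (induction rule: dec_induct) (auto simp: skolem_step_def)
  have fin: "\<exists>n. B \<subseteq> ?S n" if "finite B" "B \<subseteq> skolem_hull L M A" for B
    using that
  proof (induction B rule: finite_induct)
    case (insert b B)
    then obtain n k where "B \<subseteq> ?S n" "b \<in> ?S k" by (auto simp: skolem_hull_def)
    then show ?case using mono[of n "max n k"] mono[of k "max n k"]
      by (intro exI[of _ "max n k"]) auto
  qed simp
  have "pars \<phi> \<subseteq> skolem_hull L M A" using \<phi> by (simp add: fmls_def)
  from fin[OF finite_fm(2) this] obtain n where n: "pars \<phi> \<subseteq> ?S n" by (rule exE)
  let ?\<psi> = "All v (Neg \<phi>)"
  have \<psi>: "?\<psi> \<in> fmls L {} (?S n)" using \<phi> n v by (auto simp: fmls_def)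
  define b where "b = (SOME a. a \<in> univ M (fst v) \<and> \<not> holds_at M a (Neg \<phi>))"
  have b: "b \<in> univ M (fst v) \<and> \<not> holds_at M b (Neg \<phi>)"
    unfolding b_def by (rule someI[of _ a]) (use a in \<open>simp add: holds_at_def\<close>)
  have "witness M ?\<psi> = (fst v, b)" by (simp add: b_def)
  then have "(fst v, b) \<in> witness M ` fmls L {} (?S n)" using \<psi> by (metis imageI)
  moreover have "(fst v, b) \<in> elems L M" using b v by (simp add: elems_def)
  ultimately have "(fst v, b) \<in> ?S (Suc n)" by (simp add: skolem_step_def)
  then have "(fst v, b) \<in> skolem_hull L M A" unfolding skolem_hull_def by (rule UN_I[OF UNIV_I])
  moreover have "holds_at M b \<phi>" using b by (simp add: holds_at_def)
  ultimately show ?thesis using b by blast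
qed

text \<open>Constants and values of functions are covered by the Tarski-Vaught test as well, since they are
  the unique witnesses of atomic formulas.\<close>
lemma loewenheim_skolem:
  fixes M :: "('s, 'f, 'r, 'a) fo_struct"
  assumes L: "wf_lang L" and M: "is_struct L M" and A: "A \<subseteq> elems L M"
  shows "\<exists>N. elem_sub L N M \<and> A \<subseteq> elems L N \<and> |elems L N| \<le>o |tokens L A|"
proof -
  define B where "B = skolem_hull L M A"
  define N where "N = \<lparr>univ = \<lambda>s. {a. (s, a) \<in> B}, fint = fint M, rint = rint M\<rparr>"
  have N [simp]: "univ N s = {a. (s, a) \<in> B}" "fint N = fint M" "rint N = rint M" for s
    by (simp_all add: N_def)
  have BM: "B \<subseteq> elems L M" unfolding B_def by (rule skolem_hull_elems[OF A])
  have elN: "elems L N = B" using BM by (auto simp: elems_def)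
  have wit: "\<exists>a. (fst v, a) \<in> B \<and> a \<in> univ M (fst v) \<and> holds_at M a \<phi>"
    if "\<phi> \<in> fmls L {v} B" "fst v \<in> sorts L" "a \<in> univ M (fst v)" "holds_at M a \<phi>" for \<phi> v a
    using skolem_hull_witness[OF that(1)[unfolded B_def] that(2-4)] unfolding B_def .
  have ne: "univ N s \<noteq> {}" if s: "s \<in> sorts L" for s
  proof -
    have "univ M s \<noteq> {}" using M s by (simp add: is_struct_def)
    then obtain a where "a \<in> univ M s" by blast
    then show ?thesis
      using wit[of "Neg Falsum" "(s, 0)" a] s by (auto simp: fmls_def holds_at_def)
  qed
  have cl: "(fcod L f, fint M f as) \<in> B"
    if f: "f \<in> funs L" and as: "list_all2 (\<lambda>a s. a \<in> univ N s) as (fdom L f)" for f as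
  proof -
    define v where "v = (fcod L f, 0::nat)"
    define \<phi> :: "('s, 'f, 'r, 'a) form" where "\<phi> = Eq (Var v) (Fn f (map Par (zip (fdom L f) as)))"
    have len: "length as = length (fdom L f)" using as by (rule list_all2_lengthD)
    have inB: "(s, a) \<in> B" if "(s, a) \<in> set (zip (fdom L f) as)" for s a
      using as that len by (auto simp: list_all2_conv_all_nth set_zip)
    have srt: "fcod L f \<in> sorts L" "set (fdom L f) \<subseteq> sorts L" using L f by (auto simp: wf_lang_def)
    have "map (sort_of L \<circ> Par) (zip (fdom L f) as) = map fst (zip (fdom L f) as)" by simp
    also have "\<dots> = fdom L f" using len by simp
    finally have "map (sort_of L \<circ> Par) (zip (fdom L f) as) = fdom L f" .
    moreover have "fst c \<in> sorts L \<and> c \<in> B" if c: "c \<in> set (zip (fdom L f) as)" for c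
      using set_zip_leftD[of "fst c" "snd c" "fdom L f" as] inB[of "fst c" "snd c"] c srt(2) by auto
    ultimately have "wf_fm L \<phi>" "fv \<phi> \<subseteq> {v}" "pars \<phi> \<subseteq> B"
      unfolding \<phi>_def v_def using f srt(1) by (simp_all add: subset_iff)
    then have "\<phi> \<in> fmls L {v} B" by (simp add: fmls_def)
    moreover have "map (\<lambda>c. snd c) (zip (fdom L f) as) = as" using len by simp
    then have h: "holds_at M a \<phi> \<longleftrightarrow> a = fint M f as" for a
      unfolding holds_at_def \<phi>_def by (simp only: sat.simps eval.simps map_map comp_def)
    moreover have "list_all2 (\<lambda>a s. a \<in> univ M s) as (fdom L f)"
      using as BM by (auto elim!: list_all2_mono simp: elems_def)
    then have "fint M f as \<in> univ M (fcod L f)" using M f by (auto simp: is_struct_def)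
    ultimately show ?thesis using wit[of \<phi> v "fint M f as"] srt by (auto simp: v_def)
  qed
  have "is_struct L N" using ne cl unfolding is_struct_def by simp
  moreover have "\<forall>s\<in>sorts L. univ N s \<subseteq> univ M s" using BM by (auto simp: elems_def)
  moreover have "sat N e \<phi> \<longleftrightarrow> sat M e \<phi>" if "wf_fm L \<phi>" "pars \<phi> = {}" "e \<in> assign L N" for \<phi> e
    using that
  proof (induction \<phi> arbitrary: e)
    case (All v \<phi>)
    have v: "fst v \<in> sorts L" using All.prems by simp
    have IH: "sat N (e(v := a)) \<phi> \<longleftrightarrow> sat M (e(v := a)) \<phi>" if "a \<in> univ N (fst v)" for a
      using All.prems by (intro All.IH assign_upd[OF _ that]) auto
    have "\<exists>a\<in>univ N (fst v). \<not> sat M (e(v := a)) \<phi>"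
      if a: "a \<in> univ M (fst v)" "\<not> sat M (e(v := a)) \<phi>" for a
    proof -
      have "inst v e (Neg \<phi>) \<in> fmls L {v} B"
      proof (rule inst_fmls[where V=UNIV and F=UNIV])
        show "Neg \<phi> \<in> fmls L UNIV {}" using All.prems by (auto simp: fmls_def)
        show "(fst w, e w) \<in> B" if "w \<in> fv (Neg \<phi>)" for w
        proof -
          have "fst w \<in> sorts L" using wf_fv_sorts[of L \<phi> w] that All.prems(1) by simp
          then have "e w \<in> univ N (fst w)" using All.prems(3) unfolding assign_def by blast
          then show ?thesis by simp
        qed
      qed auto
      moreover have "holds_at M a (inst v e (Neg \<phi>))" using a by (simp add: holds_at_inst)
      ultimately obtain b where "(fst v, b) \<in> B" "holds_at M b (inst v e (Neg \<phi>))"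
        using wit v a(1) by blast
      then show ?thesis by (auto simp: holds_at_inst)
    qed
    moreover have "univ N (fst v) \<subseteq> univ M (fst v)" using BM v by (auto simp: elems_def)
    ultimately show ?case using IH by (simp del: N) blast
  next
    case (Eq t u)
    have "eval N e t = eval M e t" for t by (induction t) (auto intro: arg_cong[where f="fint M _"])
    then show ?case by simp
  next
    case (Rel r ts)
    have "eval N e t = eval M e t" for t by (induction t) (auto intro: arg_cong[where f="fint M _"])
    then have "map (eval N e) ts = map (eval M e) ts" by (intro map_cong refl)
    then show ?case by (simp only: sat.simps N)
  qed auto
  ultimately have "elem_sub L N M" using M unfolding elem_sub_def fmls_def by auto
  moreover have "A \<subseteq> elems L N" unfolding elN B_def by (rule skolem_hull_base)
  moreover have "|elems L N| \<le>o |tokens L A|" unfolding elN B_def by (rule skolem_hull_ordLeq)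
  ultimately show ?thesis by blast
qed

section \<open>Products of global types\<close>

definition ltranslate :: "'f \<Rightarrow> 's var \<Rightarrow> 'a \<Rightarrow> ('s, 'f, 'r, 'a) form \<Rightarrow> ('s, 'f, 'r, 'a) form" where
  "ltranslate m x d \<phi> = subst (Var(x := Fn m [Par (fst x, d), Var x])) \<phi>"

lemma assignD: "c \<in> assign L M \<Longrightarrow> fst v \<in> sorts L \<Longrightarrow> c v \<in> univ M (fst v)"
  unfolding assign_def by blast

lemma assignI: "(\<And>v. fst v \<in> sorts L \<Longrightarrow> c v \<in> univ M (fst v)) \<Longrightarrow> c \<in> assign L M"
  unfolding assign_def by blast

locale stable_monster =
  fixes L :: "('s, 'f, 'r) lang"
    and T :: "('s, 'f, 'r, 'a) form set"
    and G G' :: "('s, 'f, 'r, 'a) fo_struct"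
    and \<kappa> :: "'k rel" and \<kappa>' :: "'l rel"
    and m :: 'f and x :: "'s var"
  assumes L: "wf_lang L" and x: "fst x \<in> sorts L"
    and m: "m \<in> funs L" "fdom L m = [fst x, fst x]" "fcod L m = fst x"
    and T: "is_theory L T" "model_of L T G" "stable_theory L T"
    and G: "monster L \<kappa> G"
    and G': "monster L \<kappa>' G'" "elem_sub L G G'" "small \<kappa>' (elems L G)"
begin

abbreviation "S \<equiv> fst x"
abbreviation "gmul M a b \<equiv> fint M m [a, b]"

lemma struct: "is_struct L G" "is_struct L G'"
  using elem_sub_struct[OF G'(2)] by auto

lemma model_G': "model_of L T G'"
  unfolding model_of_def
proof (intro conjI ballI)
  fix \<sigma> e assume \<sigma>: "\<sigma> \<in> T" and e: "e \<in> assign L G'"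
  obtain e0 where e0: "e0 \<in> assign L G" using ex_assign struct(1) by blast
  have \<sigma>': "\<sigma> \<in> fmls L {} {}" using \<sigma> T(1) by (auto simp: is_theory_def)
  then have "\<sigma> \<in> fmls L UNIV (elems L G)" using fmls_mono[of "{}" UNIV "{}" "elems L G"] by blast
  then have "sat G' e0 \<sigma>"
    using elem_sub_sat[OF G'(2) _ e0] T(2) \<sigma> e0 by (auto simp: model_of_def)
  moreover have "sat G' e0 \<sigma> \<longleftrightarrow> sat G' e \<sigma>"
    using \<sigma>' by (intro sat_cong) (auto simp: fmls_def)
  ultimately show "sat G' e \<sigma>" by simp
qed (rule struct)

lemma small_Un: "small \<kappa> A \<Longrightarrow> small \<kappa> B \<Longrightarrow> small \<kappa> (A \<union> B)"
  using G infinite_Field[of \<kappa>] unfolding small_def monster_def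
  by (intro card_of_Un_ordLess_infinite_Field) auto

lemma small_finite: "finite A \<Longrightarrow> small \<kappa> A"
  using G unfolding small_def monster_def
  by (meson finite_iff_ordLess_natLeq ordLess_transitive)

lemma small_insert': "small \<kappa>' A \<Longrightarrow> small \<kappa>' (insert c A)"
proof -
  assume A: "small \<kappa>' A"
  have "small \<kappa>' {c}"
    using G'(1) unfolding small_def monster_def
    by (meson finite.intros finite_iff_ordLess_natLeq ordLess_transitive)
  then have "small \<kappa>' ({c} \<union> A)"
    using A G'(1) infinite_Field[of \<kappa>'] unfolding small_def monster_def
    by (intro card_of_Un_ordLess_infinite_Field) auto
  then show ?thesis by simp
qed

lemma small_model:
  assumes A: "A \<subseteq> elems L G" and s: "|A| \<le>o |tokens L B|" "small \<kappa> B"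
  shows "\<exists>N. elem_sub L N G \<and> small \<kappa> (elems L N) \<and> A \<subseteq> elems L N"
proof -
  have k: "Card_order \<kappa>" "natLeq <o \<kappa>" "|sorts L <+> funs L <+> rels L| <o \<kappa>"
    using G by (auto simp: monster_def)
  have "small \<kappa> A"
    using ordLeq_ordLess_trans[OF s(1) small_tokens[OF k s(2)]] by (simp add: small_def)
  obtain N where N: "elem_sub L N G" "A \<subseteq> elems L N" "|elems L N| \<le>o |tokens L A|"
    using loewenheim_skolem[OF L struct(1) A] by blast
  have "small \<kappa> (elems L N)"
    using ordLeq_ordLess_trans[OF N(3) small_tokens[OF k \<open>small \<kappa> A\<close>]] by (simp add: small_def)
  then show ?thesis using N by blast
qed

lemma gmul_closed:
  assumes "is_struct L M" "a \<in> univ M S" "b \<in> univ M S"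
  shows "gmul M a b \<in> univ M S"
  using assms m unfolding is_struct_def by force

lemma translate_fmls:
  assumes "\<phi> \<in> fmls L {x} A"
  shows "rtranslate m x d \<phi> \<in> fmls L {x} (insert (S, d) A)"
    and "ltranslate m x d \<phi> \<in> fmls L {x} (insert (S, d) A)"
proof -
  have \<phi>: "wf_fm L \<phi>" "fv \<phi> \<subseteq> {x}" "pars \<phi> \<subseteq> A" using assms by (auto simp: fmls_def)
  have "subst (Var(x := t)) \<phi> \<in> fmls L {x} (insert (S, d) A)"
    if t: "wf_tm L t" "sort_of L t = S" "tm_vars t \<subseteq> {x}" "tm_pars t \<subseteq> {(S, d)}" for t
  proof -
    have "wf_fm L (subst (Var(x := t)) \<phi>)"
      using \<phi> t wf_fv_sorts[OF \<phi>(1)] by (intro wf_subst) auto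
    moreover have "fv (subst (Var(x := t)) \<phi>) \<subseteq> {x}"
      using fv_subst[of "Var(x := t)" \<phi>] \<phi>(2) t(3) by (fastforce split: if_splits)
    moreover have "pars (subst (Var(x := t)) \<phi>) \<subseteq> insert (S, d) A"
      using pars_subst[of "Var(x := t)" \<phi>] \<phi>(2,3) t(4) by (fastforce split: if_splits)
    ultimately show ?thesis by (simp add: fmls_def)
  qed
  then show "rtranslate m x d \<phi> \<in> fmls L {x} (insert (S, d) A)"
    and "ltranslate m x d \<phi> \<in> fmls L {x} (insert (S, d) A)"
    unfolding rtranslate_def ltranslate_def using m x by auto
qed

lemma holds_at_translate:
  assumes "\<phi> \<in> fmls L {x} A"
  shows "holds_at M a (rtranslate m x d \<phi>) \<longleftrightarrow> holds_at M (gmul M a d) \<phi>"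
    and "holds_at M a (ltranslate m x d \<phi>) \<longleftrightarrow> holds_at M (gmul M d a) \<phi>"
proof -
  have "holds_at M a (rtranslate m x d \<phi>) \<longleftrightarrow>
      sat M (\<lambda>v. eval M (\<lambda>_. a) ((Var(x := Fn m [Var x, Par (fst x, d)])) v)) \<phi>"
    unfolding holds_at_def rtranslate_def by (rule sat_subst) auto
  also have "\<dots> \<longleftrightarrow> holds_at M (gmul M a d) \<phi>"
    by (rule holds_at_sat[OF assms, symmetric]) simp
  finally show "holds_at M a (rtranslate m x d \<phi>) \<longleftrightarrow> holds_at M (gmul M a d) \<phi>" .
  have "holds_at M a (ltranslate m x d \<phi>) \<longleftrightarrow>
      sat M (\<lambda>v. eval M (\<lambda>_. a) ((Var(x := Fn m [Par (fst x, d), Var x])) v)) \<phi>"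
    unfolding holds_at_def ltranslate_def by (rule sat_subst) auto
  also have "\<dots> \<longleftrightarrow> holds_at M (gmul M d a) \<phi>"
    by (rule holds_at_sat[OF assms, symmetric]) simp
  finally show "holds_at M a (ltranslate m x d \<phi>) \<longleftrightarrow> holds_at M (gmul M d a) \<phi>" .
qed

lemma univ_GG': "a \<in> univ G S \<Longrightarrow> a \<in> univ G' S"
  using elem_sub_univ[OF G'(2) x] by blast

lemma elems_iff: "(S, a) \<in> elems L M \<longleftrightarrow> a \<in> univ M S"
  using x by (simp add: elems_def)

lemma holds_at_GG': "\<phi> \<in> fmls L {x} (elems L G) \<Longrightarrow> a \<in> univ G S \<Longrightarrow> holds_at G a \<phi> \<longleftrightarrow> holds_at G' a \<phi>"
  by (rule elem_sub_holds_at[OF G'(2)])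

lemma inst_fmls_assign:
  assumes "\<phi> \<in> fmls L UNIV {}" "c \<in> assign L M"
  shows "inst y c \<phi> \<in> fmls L {y} (elems L M)"
proof (rule inst_fmls[OF assms(1), where F=UNIV])
  fix v assume "v \<in> fv \<phi>"
  then have "fst v \<in> sorts L" using wf_fv_sorts[of L \<phi> v] assms(1) by (simp add: fmls_def)
  then show "(fst v, c v) \<in> elems L M" using assignD[OF assms(2)] by (simp add: elems_def)
qed auto

text \<open>The type of \<open>U\<close> is definable over \<open>A\<close>: for each formula, elements of \<open>A\<close> decide which of its
  instances belong to the type.  Assignments range over the larger model, so that the
  definition governs the extension of the type to \<open>G'\<close> as well.\<close>
definition definable_by :: "'a filter \<Rightarrow> ('s, 'a) param set \<Rightarrow> bool" where
  "definable_by U A \<longleftrightarrow> (\<forall>\<phi>\<in>fmls L UNIV {}. \<exists>A0. Pair S ` A0 \<subseteq> A \<and> (\<forall>c\<in>assign L G'. \<forall>c'\<in>assign L G'.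
     (\<forall>a\<in>A0. sat G' (c(x := a)) \<phi> \<longleftrightarrow> sat G' (c'(x := a)) \<phi>) \<longrightarrow>
     ((\<forall>\<^sub>F a in U. sat G' (c(x := a)) \<phi>) \<longleftrightarrow> (\<forall>\<^sub>F a in U. sat G' (c'(x := a)) \<phi>))))"

lemma ex_definable_by:
  assumes U: "ultra U" "\<forall>\<^sub>F a in U. a \<in> univ G S"
  shows "\<exists>A\<subseteq>elems L G. |A| \<le>o |tokens L ({} :: ('s, 'a) param set) :: ('s, 'f, 'r, 'a) token set| \<and> definable_by U A"
proof -
  have "\<exists>A0\<subseteq>univ G S. finite A0 \<and> (\<forall>c\<in>assign L G'. \<forall>c'\<in>assign L G'.
     (\<forall>a\<in>A0. sat G' (c(x := a)) \<phi> \<longleftrightarrow> sat G' (c'(x := a)) \<phi>) \<longrightarrow>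
     ((\<forall>\<^sub>F a in U. sat G' (c(x := a)) \<phi>) \<longleftrightarrow> (\<forall>\<^sub>F a in U. sat G' (c'(x := a)) \<phi>)))"
    if \<phi>: "\<phi> \<in> fmls L UNIV {}" for \<phi>
  proof -
    have "\<phi> \<in> fmls L UNIV (elems L G')" using \<phi> fmls_mono[of UNIV UNIV "{}" "elems L G'"] by blast
    from stable_rel_formula[OF T(3) model_G' this]
    have "stable_rel (univ G S) (assign L G') (\<lambda>a c. sat G' (c(x := a)) \<phi>)"
      by (rule stable_rel_mono) (use univ_GG' in auto)
    from ultra_definable[OF this U] show ?thesis .
  qed
  then obtain A0 where A0: "\<And>\<phi>. \<phi> \<in> fmls L UNIV {} \<Longrightarrow> A0 \<phi> \<subseteq> univ G S \<and> finite (A0 \<phi>) \<and>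
     (\<forall>c\<in>assign L G'. \<forall>c'\<in>assign L G'.
     (\<forall>a\<in>A0 \<phi>. sat G' (c(x := a)) \<phi> \<longleftrightarrow> sat G' (c'(x := a)) \<phi>) \<longrightarrow>
     ((\<forall>\<^sub>F a in U. sat G' (c(x := a)) \<phi>) \<longleftrightarrow> (\<forall>\<^sub>F a in U. sat G' (c'(x := a)) \<phi>)))"
    by metis
  define A where "A = (\<Union>\<phi>\<in>fmls L UNIV {}. Pair S ` A0 \<phi>)"
  let ?K = "tokens L ({} :: ('s, 'a) param set) :: ('s, 'f, 'r, 'a) token set"
  have inf: "infinite ?K" by (auto simp: tokens_def)
  have "|A| \<le>o |?K|"
    unfolding A_def
  proof (rule card_of_UNION_ordLeq_infinite[OF inf])
    show "|fmls L UNIV {} :: ('s, 'f, 'r, 'a) form set| \<le>o |?K|" by (rule fmls_ordLeq[OF tokens_param])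
    show "\<forall>\<phi>\<in>fmls L UNIV {}. |Pair S ` A0 \<phi>| \<le>o |?K|"
    proof
      fix \<phi> :: "('s, 'f, 'r, 'a) form" assume "\<phi> \<in> fmls L UNIV {}"
      then have "finite (Pair S ` A0 \<phi>)" using A0 by blast
      then have "|Pair S ` A0 \<phi>| <o |?K|"
        using inf by (intro finite_ordLess_infinite[OF card_of_Well_order card_of_Well_order])
          (simp_all add: Field_card_of)
      then show "|Pair S ` A0 \<phi>| \<le>o |?K|" by (rule ordLess_imp_ordLeq)
    qed
  qed
  moreover have "A \<subseteq> elems L G" using A0 x by (auto simp: A_def elems_def)
  moreover have "definable_by U A"
    unfolding definable_by_def
  proof
    fix \<phi> :: "('s, 'f, 'r, 'a) form" assume \<phi>: "\<phi> \<in> fmls L UNIV {}"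
    then have sub: "Pair S ` A0 \<phi> \<subseteq> A" unfolding A_def by blast
    show "\<exists>A0. Pair S ` A0 \<subseteq> A \<and> (\<forall>c\<in>assign L G'. \<forall>c'\<in>assign L G'.
       (\<forall>a\<in>A0. sat G' (c(x := a)) \<phi> \<longleftrightarrow> sat G' (c'(x := a)) \<phi>) \<longrightarrow>
       ((\<forall>\<^sub>F a in U. sat G' (c(x := a)) \<phi>) \<longleftrightarrow> (\<forall>\<^sub>F a in U. sat G' (c'(x := a)) \<phi>)))"
      by (rule exI[of _ "A0 \<phi>"], rule conjI[OF sub])
        (rule A0[OF \<phi>, THEN conjunct2, THEN conjunct2])
  qed
  ultimately show ?thesis by blast
qed

lemma definable_by_mono: "definable_by U A \<Longrightarrow> A \<subseteq> B \<Longrightarrow> definable_by U B"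
  unfolding definable_by_def by (meson order_trans)

text \<open>For an ultrafilter on \<open>G\<close>, \<open>tpU G' U\<close> is the coheir of \<open>tpU G U\<close>.\<close>
definition tpU :: "('s, 'f, 'r, 'a) fo_struct \<Rightarrow> 'a filter \<Rightarrow> ('s, 'f, 'r, 'a) form set" where
  "tpU M U = {\<phi> \<in> fmls L {x} (elems L M). \<forall>\<^sub>F a in U. holds_at M a \<phi>}"

lemma tpU_types:
  "ultra U \<Longrightarrow> \<forall>\<^sub>F a in U. a \<in> univ M S \<Longrightarrow> tpU M U \<in> types L M x (elems L M)"
  unfolding tpU_def by (rule ultra_types)

lemma inst_tpU:
  assumes "\<phi> \<in> fmls L UNIV {}" "c \<in> assign L M"
  shows "inst x c \<phi> \<in> tpU M U \<longleftrightarrow> (\<forall>\<^sub>F a in U. sat M (c(x := a)) \<phi>)"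
  using inst_fmls_assign[OF assms] by (simp add: tpU_def holds_at_inst)

text \<open>Instances of \<open>\<phi>\<close> at the deciding elements are formulas over \<open>N\<close> in the parameter variables, so
  assignments with the same type over \<open>N\<close> agree at these elements.\<close>
lemma tpU_invariant:
  fixes N :: "('s, 'f, 'r, 'a) fo_struct"
  assumes def: "definable_by U (elems L N)"
  shows "invariant L G' x (elems L N) (tpU G' U)"
  unfolding invariant_def
proof (intro ballI impI)
  fix \<phi> :: "('s, 'f, 'r, 'a) form" and c c'
  assume \<phi>: "\<phi> \<in> fmls L UNIV {}" and c: "c \<in> assign L G'" and c': "c' \<in> assign L G'"
    and eq: "\<forall>\<psi>\<in>fmls L (fv \<phi> - {x}) (elems L N). sat G' c \<psi> \<longleftrightarrow> sat G' c' \<psi>"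
  obtain A0 where A0: "Pair S ` A0 \<subseteq> elems L N" "\<forall>c\<in>assign L G'. \<forall>c'\<in>assign L G'.
     (\<forall>a\<in>A0. sat G' (c(x := a)) \<phi> \<longleftrightarrow> sat G' (c'(x := a)) \<phi>) \<longrightarrow>
     ((\<forall>\<^sub>F a in U. sat G' (c(x := a)) \<phi>) \<longleftrightarrow> (\<forall>\<^sub>F a in U. sat G' (c'(x := a)) \<phi>))"
    using bspec[OF def[unfolded definable_by_def] \<phi>] by (elim exE conjE)
  have "sat G' (c(x := a)) \<phi> \<longleftrightarrow> sat G' (c'(x := a)) \<phi>" if a: "a \<in> A0" for a
  proof -
    let ?\<sigma> = "Var(x := Par (S, a))"
    have wf: "wf_fm L \<phi>" using \<phi> by (simp add: fmls_def)
    have "wf_fm L (subst ?\<sigma> \<phi>)" using x wf_fv_sorts[OF wf] by (intro wf_subst[OF wf]) auto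
    moreover have "fv (subst ?\<sigma> \<phi>) \<subseteq> fv \<phi> - {x}"
      using fv_subst[of ?\<sigma> \<phi>] by (fastforce split: if_splits)
    moreover have "pars (subst ?\<sigma> \<phi>) \<subseteq> elems L N"
      using pars_subst[of ?\<sigma> \<phi>] A0(1) a \<phi> by (fastforce simp: fmls_def split: if_splits)
    ultimately have "sat G' c (subst ?\<sigma> \<phi>) \<longleftrightarrow> sat G' c' (subst ?\<sigma> \<phi>)" using eq by (simp add: fmls_def)
    moreover have "sat G' e (subst ?\<sigma> \<phi>) \<longleftrightarrow> sat G' (e(x := a)) \<phi>" for e
    proof -
      have "sat G' e (subst ?\<sigma> \<phi>) \<longleftrightarrow> sat G' (\<lambda>v. eval G' e (?\<sigma> v)) \<phi>" by (rule sat_subst) auto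
      also have "(\<lambda>v. eval G' e (?\<sigma> v)) = e(x := a)" by auto
      finally show ?thesis .
    qed
    ultimately show ?thesis by simp
  qed
  then have "\<forall>a\<in>A0. sat G' (c(x := a)) \<phi> \<longleftrightarrow> sat G' (c'(x := a)) \<phi>" by (rule ballI)
  from mp[OF bspec[OF bspec[OF A0(2) c] c'] this]
  have "(\<forall>\<^sub>F a in U. sat G' (c(x := a)) \<phi>) \<longleftrightarrow> (\<forall>\<^sub>F a in U. sat G' (c'(x := a)) \<phi>)" .
  then show "inst x c \<phi> \<in> tpU G' U \<longleftrightarrow> inst x c' \<phi> \<in> tpU G' U"
    unfolding inst_tpU[OF \<phi> c] inst_tpU[OF \<phi> c'] .
qed

lemma tpU_G':
  assumes U: "\<forall>\<^sub>F a in U. a \<in> univ G S" and \<phi>: "\<phi> \<in> fmls L {x} (elems L G)"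
  shows "\<phi> \<in> tpU G' U \<longleftrightarrow> \<phi> \<in> tpU G U"
proof -
  have "(\<forall>\<^sub>F a in U. holds_at G' a \<phi>) \<longleftrightarrow> (\<forall>\<^sub>F a in U. holds_at G a \<phi>)"
    by (rule eventually_subst, rule eventually_mono[OF U]) (use holds_at_GG'[OF \<phi>] in simp)
  moreover have "\<phi> \<in> fmls L {x} (elems L G')"
    using \<phi> fmls_mono[OF order_refl elem_sub_elems[OF G'(2)]] by blast
  ultimately show ?thesis using \<phi> by (simp add: tpU_def)
qed

lemma tpU_G_invariant:
  fixes N :: "('s, 'f, 'r, 'a) fo_struct"
  assumes U: "\<forall>\<^sub>F a in U. a \<in> univ G S" and def: "definable_by U (elems L N)" and N: "elem_sub L N G"
  shows "invariant L G x (elems L N) (tpU G U)"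
  unfolding invariant_def
proof (intro ballI impI)
  fix \<phi> :: "('s, 'f, 'r, 'a) form" and c c'
  assume \<phi>: "\<phi> \<in> fmls L UNIV {}" and c: "c \<in> assign L G" and c': "c' \<in> assign L G"
    and eq: "\<forall>\<psi>\<in>fmls L (fv \<phi> - {x}) (elems L N). sat G c \<psi> \<longleftrightarrow> sat G c' \<psi>"
  have cG': "c \<in> assign L G'" "c' \<in> assign L G'" using c c' elem_sub_assign[OF G'(2)] by auto
  have "sat G' c \<psi> \<longleftrightarrow> sat G' c' \<psi>" if \<psi>: "\<psi> \<in> fmls L (fv \<phi> - {x}) (elems L N)" for \<psi>
  proof -
    have "\<psi> \<in> fmls L UNIV (elems L G)"
      using \<psi> fmls_mono[OF subset_UNIV elem_sub_elems[OF N]] by blast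
    then show ?thesis
      using bspec[OF eq \<psi>] elem_sub_sat[OF G'(2) _ c] elem_sub_sat[OF G'(2) _ c'] by blast
  qed
  then have "inst x c \<phi> \<in> tpU G' U \<longleftrightarrow> inst x c' \<phi> \<in> tpU G' U"
    using tpU_invariant[OF def] \<phi> cG' unfolding invariant_def by blast
  then show "inst x c \<phi> \<in> tpU G U \<longleftrightarrow> inst x c' \<phi> \<in> tpU G U"
    using tpU_G'[OF U inst_fmls_assign[OF \<phi> c]] tpU_G'[OF U inst_fmls_assign[OF \<phi> c']] by blast
qed

text \<open>A small model that contains the parameters of the definitions of both types exists by the
  Loewenheim-Skolem theorem, and saturation of \<open>G'\<close> provides the realizations.\<close>
lemma ex_type_prod:
  assumes U: "ultra U" "\<forall>\<^sub>F a in U. a \<in> univ G S" and V: "ultra V" "\<forall>\<^sub>F a in V. a \<in> univ G S"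
  shows "\<exists>r. is_type_prod L \<kappa> G G' m x (tpU G U) (tpU G V) r"
proof -
  let ?K = "tokens L ({} :: ('s, 'a) param set) :: ('s, 'f, 'r, 'a) token set"
  obtain A where A: "A \<subseteq> elems L G" "|A| \<le>o |?K|" "definable_by U A" using ex_definable_by[OF U] by blast
  obtain B where B: "B \<subseteq> elems L G" "|B| \<le>o |?K|" "definable_by V B" using ex_definable_by[OF V] by blast
  have "infinite ?K" by (auto simp: tokens_def)
  then have AB: "|A \<union> B| \<le>o |?K|"
    using A(2) B(2) card_of_Card_order[of ?K]
    by (intro card_of_Un_ordLeq_infinite_Field) (simp_all only: Field_card_of, simp_all)
  obtain N where N: "elem_sub L N G" "small \<kappa> (elems L N)" "A \<union> B \<subseteq> elems L N"
    using small_model[OF Un_least[OF A(1) B(1)] AB small_finite[OF finite.emptyI]]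
    by (elim exE conjE) (rule that)
  have def: "definable_by U (elems L N)" "definable_by V (elems L N)"
    using definable_by_mono[OF A(3)] definable_by_mono[OF B(3)] N(3) by blast+
  have U': "\<forall>\<^sub>F a in U. a \<in> univ G' S" using U(2) by (rule eventually_mono) (rule univ_GG')
  have "tpU G V \<in> types L G' x (elems L G)"
    using tpU_types[OF V] types_elem_sub[OF G'(2) order_refl x] by simp
  then obtain b where b: "realizes G' x b (tpU G V)"
    using G'(1,3) x elem_sub_elems[OF G'(2)] unfolding monster_def by meson
  then have bS: "b \<in> univ G' S" by (simp add: realizes_def)
  let ?B = "elems L G \<union> {(S, b)}"
  have BG': "?B \<subseteq> elems L G'" using elem_sub_elems[OF G'(2)] bS elems_iff[of b G'] by auto
  have "tpU G' U \<inter> fmls L {x} ?B \<in> types L G' x ?B"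
    using tpU_types[OF U(1) U'] BG' by (rule types_restrict)
  moreover have "small \<kappa>' ?B" using small_insert'[OF G'(3)] by simp
  ultimately obtain a where a: "realizes G' x a (tpU G' U \<inter> fmls L {x} ?B)"
    using G'(1) x BG' unfolding monster_def by meson
  have "tpU G U \<subseteq> tpU G' U" using tpU_G'[OF U(2)] by (auto simp: tpU_def)
  then have "is_type_prod L \<kappa> G G' m x (tpU G U) (tpU G V)
      (tp L G' x (fint G' m [a, b]) (elems L G))"
    unfolding is_type_prod_def
    using N(1,2) tpU_G_invariant[OF U(2) def(1) N(1)] tpU_G_invariant[OF V(2) def(2) N(1)]
      tpU_types[OF U(1) U'] tpU_invariant[OF def(1)] a b by blast
  then show ?thesis by blast
qed

text \<open>The variable \<open>y\<close> must not occur in \<open>\<phi>\<close>, not even bound, since substitution does not rename.\<close>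
lemma ex_product_formula:
  assumes \<phi>: "\<phi> \<in> fmls L {x} A"
  shows "\<exists>y \<phi>1. fst y = S \<and> y \<noteq> x \<and> \<phi>1 \<in> fmls L {x, y} (pars \<phi>) \<and>
    (\<forall>M c. sat M c \<phi>1 \<longleftrightarrow> holds_at M (gmul M (c x) (c y)) \<phi>)"
proof -
  define y where "y = (S, Suc (Max (snd ` insert x (fm_vars \<phi>))))"
  have ymax: "snd v < snd y" if "v \<in> insert x (fm_vars \<phi>)" for v
  proof -
    have "snd v \<le> Max (snd ` insert x (fm_vars \<phi>))"
      using that finite_fm(1)[of \<phi>] by (intro Max_ge) auto
    then show ?thesis by (simp add: y_def)
  qed
  have y: "fst y = S" "y \<noteq> x" "y \<notin> fm_vars \<phi>" using ymax[of y] ymax[of x] by (auto simp: y_def)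
  have \<phi>w: "wf_fm L \<phi>" "fv \<phi> \<subseteq> {x}" using \<phi> by (auto simp: fmls_def)
  define \<phi>1 where "\<phi>1 = subst (Var(x := Fn m [Var x, Var y])) \<phi>"
  have sat1: "sat M c \<phi>1 \<longleftrightarrow> holds_at M (gmul M (c x) (c y)) \<phi>" for M c
  proof -
    have "sat M c \<phi>1 \<longleftrightarrow> sat M (\<lambda>v. eval M c ((Var(x := Fn m [Var x, Var y])) v)) \<phi>"
      unfolding \<phi>1_def by (rule sat_subst) (use y in auto)
    also have "\<dots> \<longleftrightarrow> holds_at M (gmul M (c x) (c y)) \<phi>"
      by (rule holds_at_sat[OF \<phi>, symmetric]) simp
    finally show ?thesis .
  qed
  have \<phi>1: "\<phi>1 \<in> fmls L {x, y} (pars \<phi>)"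
  proof -
    have "wf_fm L \<phi>1" unfolding \<phi>1_def using \<phi>w(1,2) m x y(1) by (intro wf_subst) auto
    moreover have "fv \<phi>1 \<subseteq> {x, y}"
      unfolding \<phi>1_def using fv_subst[of "Var(x := Fn m [Var x, Var y])" \<phi>] \<phi>w(2)
      by (fastforce split: if_splits)
    moreover have "pars \<phi>1 \<subseteq> pars \<phi>"
      unfolding \<phi>1_def using pars_subst[of "Var(x := Fn m [Var x, Var y])" \<phi>] \<phi>w(2)
      by (fastforce split: if_splits)
    ultimately show ?thesis by (simp add: fmls_def)
  qed
  show ?thesis
    by (intro exI[of _ y] exI[of _ \<phi>1] conjI allI y(1,2) \<phi>1 sat1)
qed

lemma stable_rel_gmul:
  assumes \<phi>: "\<phi> \<in> fmls L {x} (elems L G)"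
  shows "stable_rel (univ G S) (univ G S) (\<lambda>a b. holds_at G (gmul G a b) \<phi>)"
proof -
  obtain y \<phi>1 where y: "fst y = S" "y \<noteq> x" and \<phi>1: "\<phi>1 \<in> fmls L {x, y} (pars \<phi>)"
    and sat1: "\<And>M c. sat M c \<phi>1 \<longleftrightarrow> holds_at M (gmul M (c x) (c y)) \<phi>"
    using ex_product_formula[OF \<phi>] by (elim exE conjE) (rule that; blast)
  obtain g where g: "g \<in> assign L G" using ex_assign struct(1) by blast
  have "\<phi>1 \<in> fmls L UNIV (elems L G)"
    using \<phi>1 \<phi> by (auto simp: fmls_def)
  from stable_rel_formula[OF T(3,2) this]
  have "stable_rel (univ G S) (assign L G) (\<lambda>a c. sat G (c(x := a)) \<phi>1)" .
  from stable_rel_image[OF this, of id "univ G S" "\<lambda>b. g(y := b)" "univ G S"]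
  show ?thesis using assign_upd[OF g, of _ y] y by (auto simp: sat1)
qed

text \<open>By saturation of \<open>G\<close> choose \<open>b0\<close> in \<open>G\<close> with the type of \<open>b\<close> over \<open>N\<close>, the parameters
  of \<open>\<phi>\<close>, and finitely many elements that define \<open>U\<close> on the translates of \<open>\<phi>\<close>.  Invariance of
  \<open>p'\<close> over \<open>N\<close> allows to replace \<open>b\<close> by \<open>b0\<close>, and over \<open>G\<close> the type \<open>p'\<close> is the type of \<open>U\<close>.
  Since \<open>b\<close> realizes the type of \<open>V\<close>, \<open>V\<close>-almost all elements of \<open>G\<close> agree with \<open>b\<close>, hence with
  \<open>b0\<close>, at the finitely many defining elements.  Thus the product does not depend on the choice of \<open>N\<close>,
  \<open>p'\<close>, \<open>a\<close> and \<open>b\<close>.\<close>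
lemma is_type_prod_mem:
  assumes U: "ultra U" "\<forall>\<^sub>F a in U. a \<in> univ G S" and V: "ultra V" "\<forall>\<^sub>F a in V. a \<in> univ G S"
    and prod: "is_type_prod L \<kappa> G G' m x (tpU G U) (tpU G V) r"
    and \<phi>: "\<phi> \<in> fmls L {x} (elems L G)"
  shows "\<phi> \<in> r \<longleftrightarrow> (\<forall>\<^sub>F b in V. \<forall>\<^sub>F a in U. holds_at G (gmul G a b) \<phi>)"
proof -
  obtain N p' a b where N: "elem_sub L N G" "small \<kappa> (elems L N)"
    and p': "p' \<in> types L G' x (elems L G')" "invariant L G' x (elems L N) p'" "tpU G U \<subseteq> p'"
    and b: "realizes G' x b (tpU G V)"
    and a: "realizes G' x a (p' \<inter> fmls L {x} (elems L G \<union> {(S, b)}))"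
    and r: "r = tp L G' x (fint G' m [a, b]) (elems L G)"
    using prod unfolding is_type_prod_def by (elim exE conjE)
  have bS: "b \<in> univ G' S" and aS: "a \<in> univ G' S" using a b by (simp_all add: realizes_def)
  have elGG': "elems L G \<subseteq> elems L G'" by (rule elem_sub_elems[OF G'(2)])
  let ?B = "elems L G \<union> {(S, b)}"
  have BG': "?B \<subseteq> elems L G'" using elGG' bS elems_iff[of b G'] by auto
  \<comment> \<open>A formula in two variables defining \<open>\<phi>\<close> of the product.\<close>
  obtain y \<phi>1 where y: "fst y = S" "y \<noteq> x" and \<phi>1: "\<phi>1 \<in> fmls L {x, y} (pars \<phi>)"
    and sat1: "\<And>M c. sat M c \<phi>1 \<longleftrightarrow> holds_at M (gmul M (c x) (c y)) \<phi>"
    using ex_product_formula[OF \<phi>] by (elim exE conjE) (rule that; blast)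
  have \<phi>w: "pars \<phi> \<subseteq> elems L G" using \<phi> by (auto simp: fmls_def)
  obtain \<phi>2 F c where \<phi>2: "\<phi>2 \<in> fmls L ({x, y} \<union> F) {}" "finite F" "F \<inter> {x, y} = {}"
    "\<forall>v\<in>F. (fst v, c v) \<in> pars \<phi>1"
    "\<forall>M e. (\<forall>v\<in>F. e v = c v) \<longrightarrow> (sat M e \<phi>1 \<longleftrightarrow> sat M e \<phi>2)"
    using parameters_as_variables[OF \<phi>1 finite.insertI[OF finite.insertI[OF finite.emptyI], of x y]]
    by (elim exE conjE) (rule that; assumption)
  have p1: "pars \<phi>1 \<subseteq> elems L G" using \<phi>1 \<phi>w by (auto simp: fmls_def)
  have \<phi>2': "\<phi>2 \<in> fmls L UNIV {}" using \<phi>2(1) fmls_mono[OF subset_UNIV order_refl] by blast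
  obtain d where d: "d \<in> assign L G" using ex_assign struct(1) by blast
  define g where "g = override_on d c F"
  have "g v \<in> univ G (fst v)" if v: "fst v \<in> sorts L" for v
  proof (cases "v \<in> F")
    case True
    then have "(fst v, c v) \<in> elems L G" using \<phi>2(4) p1 by blast
    then show ?thesis using True by (simp add: g_def elems_def)
  next
    case False
    then show ?thesis using assignD[OF d v] by (simp add: g_def)
  qed
  then have g: "g \<in> assign L G" by (rule assignI)
  have g': "g \<in> assign L G'" using elem_sub_assign[OF G'(2) g] .
  have gF: "g v = c v" if "v \<in> F" for v using that by (simp add: g_def)
  have sat2: "sat M (g(y := b1, x := a1)) \<phi>2 \<longleftrightarrow> holds_at M (gmul M a1 b1) \<phi>" for M a1 b1
  proof -
    have "\<forall>v\<in>F. (g(y := b1, x := a1)) v = c v" using \<phi>2(3) gF by auto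
    then have "sat M (g(y := b1, x := a1)) \<phi>2 \<longleftrightarrow> sat M (g(y := b1, x := a1)) \<phi>1" using \<phi>2(5) by blast
    then show ?thesis using y(2) by (simp add: sat1)
  qed
  have inst2: "holds_at M a1 (inst x (g(y := b1)) \<phi>2) \<longleftrightarrow> holds_at M (gmul M a1 b1) \<phi>" for M a1 b1
    by (simp add: holds_at_inst sat2)
  have gy: "g(y := b1) \<in> assign L M" if "g \<in> assign L M" "b1 \<in> univ M S" for b1 M
    by (rule assign_upd[OF that(1)]) (simp add: y that(2))
  \<comment> \<open>The product in terms of the global type \<open>p'\<close>.\<close>
  have "\<phi> \<in> r \<longleftrightarrow> holds_at G' a (rtranslate m x b \<phi>)"
    using \<phi> by (simp add: r tp_def holds_at_translate[OF \<phi>])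
  also have "\<dots> \<longleftrightarrow> rtranslate m x b \<phi> \<in> p'"
  proof -
    have "rtranslate m x b \<phi> \<in> fmls L {x} ?B" using translate_fmls(1)[OF \<phi>, of b] by simp
    then show ?thesis
      using realizes_iff[OF types_restrict[OF p'(1) BG'] a] by blast
  qed
  also have "\<dots> \<longleftrightarrow> inst x (g(y := b)) \<phi>2 \<in> p'"
  proof (rule types_equiv[OF p'(1)])
    show "rtranslate m x b \<phi> \<in> fmls L {x} (elems L G')"
      using translate_fmls(1)[OF \<phi>, of b] fmls_mono[OF order_refl BG', of L "{x}"] by auto
    show "inst x (g(y := b)) \<phi>2 \<in> fmls L {x} (elems L G')"
      by (rule inst_fmls_assign[OF \<phi>2' gy[OF g' bS]])
    show "holds_at G' a1 (rtranslate m x b \<phi>) \<longleftrightarrow> holds_at G' a1 (inst x (g(y := b)) \<phi>2)" for a1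
      by (simp add: inst2 holds_at_translate[OF \<phi>])
  qed
  finally have r_p': "\<phi> \<in> r \<longleftrightarrow> inst x (g(y := b)) \<phi>2 \<in> p'" .
  \<comment> \<open>Over finitely many elements of \<open>G\<close> that define \<open>U\<close> on the translates of \<open>\<phi>\<close>, move \<open>b\<close> into \<open>G\<close>.\<close>
  from ultra_definable[OF stable_rel_gmul[OF \<phi>] U] obtain A0 where A0: "A0 \<subseteq> univ G S" "finite A0"
    and def: "\<forall>b\<in>univ G S. \<forall>b'\<in>univ G S.
      (\<forall>a\<in>A0. holds_at G (gmul G a b) \<phi> \<longleftrightarrow> holds_at G (gmul G a b') \<phi>) \<longrightarrow>
      ((\<forall>\<^sub>F a in U. holds_at G (gmul G a b) \<phi>) \<longleftrightarrow> (\<forall>\<^sub>F a in U. holds_at G (gmul G a b') \<phi>))"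
    by blast
  define A where "A = elems L N \<union> (pars \<phi> \<union> Pair S ` A0 \<union> (\<lambda>v. (fst v, c v)) ` F)"
  have A: "A \<subseteq> elems L G"
    using elem_sub_elems[OF N(1)] \<phi>w A0(1) \<phi>2(4) p1 x by (auto simp: A_def elems_def)
  have "small \<kappa> A"
    unfolding A_def
    by (rule small_Un[OF N(2) small_finite]) (use \<phi>2(2) A0(2) finite_fm(2)[of \<phi>] in simp)
  moreover have "tp L G' y b A \<in> types L G y A"
    using tp_types[of b G' y L A] types_elem_sub[OF G'(2) A, of y] y(1) x bS by simp
  ultimately obtain b0 where b0: "realizes G y b0 (tp L G' y b A)"
    using G A x y(1) unfolding monster_def by metis
  have b0S: "b0 \<in> univ G S" using b0 y(1) by (simp add: realizes_def)
  have b0_iff: "holds_at G' b \<psi> \<longleftrightarrow> holds_at G b0 \<psi>" if \<psi>: "\<psi> \<in> fmls L {y} A" for \<psi>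
    using realizes_iff[OF \<open>tp L G' y b A \<in> types L G y A\<close> b0 \<psi>] \<psi> by (simp add: tp_def)
  have b0_iff': "holds_at G' b \<psi> \<longleftrightarrow> holds_at G' b0 \<psi>" if \<psi>: "\<psi> \<in> fmls L {y} A" for \<psi>
  proof -
    have "\<psi> \<in> fmls L {y} (elems L G)" using \<psi> fmls_mono[OF order_refl A] by blast
    then show ?thesis using b0_iff[OF \<psi>] elem_sub_holds_at[OF G'(2), of \<psi> y b0] b0S y(1) by simp
  qed
  have "inst x (g(y := b)) \<phi>2 \<in> p' \<longleftrightarrow> inst x (g(y := b0)) \<phi>2 \<in> p'"
  proof -
    have "sat G' (g(y := b)) \<psi> \<longleftrightarrow> sat G' (g(y := b0)) \<psi>"
      if \<psi>: "\<psi> \<in> fmls L (fv \<phi>2 - {x}) (elems L N)" for \<psi>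
    proof -
      have "inst y g \<psi> \<in> fmls L {y} A"
      proof (rule inst_fmls[OF \<psi>])
        show "fv \<phi>2 - {x} \<subseteq> insert y F" using \<phi>2(1) by (auto simp: fmls_def)
        show "(fst v, g v) \<in> A" if "v \<in> F" for v using that gF by (auto simp: A_def)
      qed (auto simp: A_def)
      from b0_iff'[OF this] show ?thesis by (simp add: holds_at_inst)
    qed
    then show ?thesis
      using p'(2) \<phi>2' gy[OF g' bS] gy[OF g' univ_GG'[OF b0S]] unfolding invariant_def by blast
  qed
  also have "\<dots> \<longleftrightarrow> inst x (g(y := b0)) \<phi>2 \<in> tpU G U"
    by (rule types_extend_eq[OF tpU_types[OF U, unfolded types_elem_sub[OF G'(2) order_refl x]]
          p'(1) elGG' p'(3)])
      (rule inst_fmls_assign[OF \<phi>2' gy[OF g b0S]])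
  also have "\<dots> \<longleftrightarrow> (\<forall>\<^sub>F a in U. holds_at G (gmul G a b0) \<phi>)"
    by (simp add: inst_tpU[OF \<phi>2' gy[OF g b0S]] sat2)
  finally have r_b0: "\<phi> \<in> r \<longleftrightarrow> (\<forall>\<^sub>F a in U. holds_at G (gmul G a b0) \<phi>)" using r_p' by simp
  have A0_b: "holds_at G' (gmul G' a1 b) \<phi> \<longleftrightarrow> holds_at G (gmul G a1 b0) \<phi>" if a1: "a1 \<in> A0" for a1
  proof -
    let ?\<sigma> = "Var(x := Par (S, a1))"
    have "wf_fm L (subst ?\<sigma> \<phi>1)"
      using \<phi>1 x y(1) wf_fv_sorts[of L \<phi>1] by (intro wf_subst) (auto simp: fmls_def)
    moreover have "fv (subst ?\<sigma> \<phi>1) \<subseteq> {y}"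
      using fv_subst[of ?\<sigma> \<phi>1] \<phi>1 by (fastforce simp: fmls_def split: if_splits)
    moreover have "pars (subst ?\<sigma> \<phi>1) \<subseteq> A"
      using pars_subst[of ?\<sigma> \<phi>1] a1 \<phi>1 by (fastforce simp: fmls_def A_def split: if_splits)
    ultimately have "subst ?\<sigma> \<phi>1 \<in> fmls L {y} A" by (simp add: fmls_def)
    moreover have "holds_at M b1 (subst ?\<sigma> \<phi>1) \<longleftrightarrow> holds_at M (gmul M a1 b1) \<phi>" for M b1
    proof -
      have "holds_at M b1 (subst ?\<sigma> \<phi>1) \<longleftrightarrow> sat M (\<lambda>v. eval M (\<lambda>_. b1) (?\<sigma> v)) \<phi>1"
        unfolding holds_at_def by (rule sat_subst) auto
      then show ?thesis using y(2) by (simp add: sat1)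
    qed
    ultimately show ?thesis using b0_iff[of "subst ?\<sigma> \<phi>1"] by simp
  qed
  have "\<forall>\<^sub>F b1 in V. \<forall>a1\<in>A0. holds_at G (gmul G a1 b1) \<phi> \<longleftrightarrow> holds_at G (gmul G a1 b0) \<phi>"
  proof (rule eventually_ball_finite[OF A0(2)], rule ballI)
    fix a1 assume a1: "a1 \<in> A0"
    then have "insert (S, a1) (elems L G) = elems L G" using A0(1) x by (auto simp: elems_def)
    then have lt: "ltranslate m x a1 \<phi> \<in> fmls L {x} (elems L G)"
      using translate_fmls(2)[OF \<phi>, of a1] by simp
    have "tpU G V \<in> types L G' x (elems L G)"
      using tpU_types[OF V] types_elem_sub[OF G'(2) order_refl x] by simp
    from realizes_iff[OF this b lt]
    have "(\<forall>\<^sub>F b1 in V. holds_at G b1 (ltranslate m x a1 \<phi>)) \<longleftrightarrow> holds_at G (gmul G a1 b0) \<phi>"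
      using lt A0_b[OF a1] by (simp add: tpU_def holds_at_translate[OF \<phi>])
    then have "(\<forall>\<^sub>F b1 in V. holds_at G (gmul G a1 b1) \<phi>) \<longleftrightarrow> holds_at G (gmul G a1 b0) \<phi>"
      by (simp add: holds_at_translate[OF \<phi>])
    then show "\<forall>\<^sub>F b1 in V. holds_at G (gmul G a1 b1) \<phi> \<longleftrightarrow> holds_at G (gmul G a1 b0) \<phi>"
      unfolding ultra_iff[OF V(1)] using ultra_nonbot[OF V(1)] by (simp add: eventually_const)
  qed
  then have "\<forall>\<^sub>F b1 in V. (\<forall>\<^sub>F a in U. holds_at G (gmul G a b1) \<phi>) \<longleftrightarrow>
      (\<forall>\<^sub>F a in U. holds_at G (gmul G a b0) \<phi>)"
    using V(2) by eventually_elim (use def b0S in blast)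
  then have "(\<forall>\<^sub>F b1 in V. \<forall>\<^sub>F a in U. holds_at G (gmul G a b1) \<phi>) \<longleftrightarrow>
      (\<forall>\<^sub>F a in U. holds_at G (gmul G a b0) \<phi>)"
    unfolding ultra_iff[OF V(1)] using ultra_nonbot[OF V(1)] by (simp add: eventually_const)
  then show ?thesis using r_b0 by simp
qed

lemma type_prod_mem:
  assumes U: "ultra U" "\<forall>\<^sub>F a in U. a \<in> univ G S" and V: "ultra V" "\<forall>\<^sub>F a in V. a \<in> univ G S"
    and \<phi>: "\<phi> \<in> fmls L {x} (elems L G)"
  shows "type_prod L \<kappa> G G' m x (tpU G U) (tpU G V) \<in> types L G x (elems L G)"
    and "\<phi> \<in> type_prod L \<kappa> G G' m x (tpU G U) (tpU G V) \<longleftrightarrow>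
      (\<forall>\<^sub>F b in V. \<forall>\<^sub>F a in U. holds_at G (gmul G a b) \<phi>)"
proof -
  let ?P = "is_type_prod L \<kappa> G G' m x (tpU G U) (tpU G V)"
  obtain r where r: "?P r" using ex_type_prod[OF U V] by blast
  have ty: "r' \<in> types L G x (elems L G)" if "?P r'" for r'
  proof -
    from that obtain a b where ab: "a \<in> univ G' S" "b \<in> univ G' S"
      "r' = tp L G' x (fint G' m [a, b]) (elems L G)"
      unfolding is_type_prod_def realizes_def by blast
    then show ?thesis
      using tp_types[OF gmul_closed[OF struct(2) ab(1,2)], of L "elems L G"]
        types_elem_sub[OF G'(2) order_refl x] by simp
  qed
  have "r' = r" if r': "?P r'" for r'
    using types_sub[OF ty[OF r]] types_sub[OF ty[OF r']]
      is_type_prod_mem[OF U V r] is_type_prod_mem[OF U V r'] by blast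
  then have "type_prod L \<kappa> G G' m x (tpU G U) (tpU G V) = r"
    unfolding type_prod_def using r by (rule the_equality[rotated])
  then show "type_prod L \<kappa> G G' m x (tpU G U) (tpU G V) \<in> types L G x (elems L G)"
    and "\<phi> \<in> type_prod L \<kappa> G G' m x (tpU G U) (tpU G V) \<longleftrightarrow>
      (\<forall>\<^sub>F b in V. \<forall>\<^sub>F a in U. holds_at G (gmul G a b) \<phi>)"
    using ty[OF r] is_type_prod_mem[OF U V r \<phi>] by simp_all
qed

end

text \<open>Images of compact sets are compact, which gives inner approximation; outer approximation follows
  by passing to complements.\<close>
lemma regular_borel_distr:
  assumes P: "regular_borel_prob X P" and Y: "Hausdorff_space Y" and f: "continuous_map X Y f"
  shows "f \<in> measurable P (borel_of_top Y)" and "regular_borel_prob Y (distr P (borel_of_top Y) f)"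
proof -
  interpret P: prob_space P using P by (simp add: regular_borel_prob_def)
  have sets: "sets P = sets (borel_of_top X)" and space: "space P = topspace X"
    using P by (simp_all add: regular_borel_prob_def)
  show meas: "f \<in> measurable P (borel_of_top Y)"
    unfolding borel_of_top_def
  proof (rule measurable_measure_of)
    show "f -` V \<inter> space P \<in> sets P" if "V \<in> {V. openin Y V}" for V
    proof -
      have "openin X {p \<in> topspace X. f p \<in> V}" using f that by (simp add: continuous_map_def)
      moreover have "{p \<in> topspace X. f p \<in> V} = f -` V \<inter> space P" using space by auto
      ultimately show ?thesis using openin_borel_of_top sets by metis
    qed
  qed (use f space in \<open>auto simp: continuous_map_def dest: openin_subset\<close>)
  let ?Q = "distr P (borel_of_top Y) f"
  interpret Q: prob_space ?Q by (rule P.prob_space_distr[OF meas])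
  have mQ: "measure ?Q A = measure P (f -` A \<inter> space P)" if "A \<in> sets (borel_of_top Y)" for A
    by (rule measure_distr[OF meas that])
  have inner: "\<exists>K. compactin Y K \<and> K \<in> sets ?Q \<and> K \<subseteq> B \<and> measure ?Q B - measure ?Q K < e"
    if B: "B \<in> sets ?Q" and e: "0 < e" for B and e :: real
  proof -
    have B': "f -` B \<inter> space P \<in> sets P" using meas B by (simp add: measurable_sets)
    then obtain K V where K: "compactin X K" "K \<in> sets P" "openin X V" "K \<subseteq> f -` B \<inter> space P"
      "f -` B \<inter> space P \<subseteq> V" "measure P V - measure P K < e"
      using P e unfolding regular_borel_prob_def by blast
    have fK: "compactin Y (f ` K)" using image_compactin[OF K(1) f] .
    then have fKm: "f ` K \<in> sets (borel_of_top Y)"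
      using Y compactin_imp_closedin closedin_borel_of_top by blast
    have "measure P (f -` B \<inter> space P) \<le> measure P V"
      using K openin_borel_of_top sets by (intro P.finite_measure_mono) auto
    moreover have "measure P K \<le> measure P (f -` (f ` K) \<inter> space P)"
      using K(2,4) fKm meas by (intro P.finite_measure_mono) (auto simp: measurable_sets)
    ultimately have "measure ?Q B - measure ?Q (f ` K) < e"
      using K(6) mQ[OF fKm] mQ[of B] B by simp
    then show ?thesis using fK fKm K(4) by (intro exI[of _ "f ` K"]) auto
  qed
  show "regular_borel_prob Y ?Q"
    unfolding regular_borel_prob_def
  proof (intro conjI ballI allI impI)
    fix B and e :: real assume B: "B \<in> sets ?Q" and e: "0 < e"
    obtain K where K: "compactin Y K" "K \<in> sets ?Q" "K \<subseteq> B" "measure ?Q B - measure ?Q K < e/2"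
      using inner[OF B, of "e/2"] e by auto
    have B': "topspace Y - B \<in> sets ?Q" using sets.compl_sets[OF B] by simp
    obtain K' where K': "compactin Y K'" "K' \<in> sets ?Q" "K' \<subseteq> topspace Y - B"
      "measure ?Q (topspace Y - B) - measure ?Q K' < e/2"
      using inner[OF B', of "e/2"] e by auto
    have "openin Y (topspace Y - K')"
      using compactin_imp_closedin[OF Y K'(1)] by (simp add: closedin_def)
    moreover have "measure ?Q (topspace Y - K') = 1 - measure ?Q K'"
      "measure ?Q (topspace Y - B) = 1 - measure ?Q B"
      using Q.prob_compl[OF K'(2)] Q.prob_compl[OF B] by simp_all
    then have "measure ?Q (topspace Y - K') - measure ?Q K < e" using K(4) K'(4) by simp
    moreover have "B \<subseteq> topspace Y - K'"
      using K'(3) sets.sets_into_space[OF B] by auto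
    ultimately show "\<exists>K U. compactin Y K \<and> K \<in> sets ?Q \<and> openin Y U \<and> K \<subseteq> B \<and> B \<subseteq> U \<and>
        measure ?Q U - measure ?Q K < e"
      using K by blast
  qed (simp_all add: Q.prob_space_axioms)
qed

section \<open>Definable sets and Keisler measures\<close>

locale stable_keisler = stable_monster L T G G' \<kappa> \<kappa>' m x
  for L :: "('s, 'f, 'r) lang" and T :: "('s, 'f, 'r, 'a) form set"
    and G G' :: "('s, 'f, 'r, 'a) fo_struct"
    and \<kappa> :: "'k rel" and \<kappa>' :: "'l rel" and m :: 'f and x :: "'s var" +
  fixes e :: 'a and \<mu> :: "('s, 'f, 'r, 'a) form \<Rightarrow> real"
  assumes comm: "comm_group (def_group G m (fst x) e)"
    and keisler: "keisler L G x (elems L G) \<mu>"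
begin

definition defset :: "('s, 'f, 'r, 'a) form \<Rightarrow> 'a set" where
  "defset \<phi> = {a \<in> univ G S. holds_at G a \<phi>}"

abbreviation "defsets A \<equiv> defset ` fmls L {x} A"
abbreviation "tps A \<equiv> types L G x A"

lemma defset_Neg: "defset (Neg \<phi>) = univ G S - defset \<phi>"
  by (auto simp: defset_def holds_at_def)

lemma defset_Disj: "defset (Disj \<phi> \<psi>) = defset \<phi> \<union> defset \<psi>"
  by (auto simp: defset_def holds_at_def)

lemma defset_mem_type:
  assumes "p \<in> tps A" "\<phi> \<in> fmls L {x} A"
  shows "defset \<phi> \<in> defset ` p \<longleftrightarrow> \<phi> \<in> p"
proof
  assume "defset \<phi> \<in> defset ` p"
  then obtain \<psi> where \<psi>: "defset \<phi> = defset \<psi>" "\<psi> \<in> p" by (rule imageE)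
  have "\<phi> \<in> p \<longleftrightarrow> \<psi> \<in> p"
    by (rule types_equiv[OF assms]) (use \<psi> types_sub[OF assms(1)] in \<open>auto simp: defset_def\<close>)
  then show "\<phi> \<in> p" using \<psi> by blast
qed simp

lemma algebra_defsets: "algebra (univ G S) (defsets A)"
  unfolding algebra_iff_Un
proof (intro conjI ballI)
  show "defsets A \<subseteq> Pow (univ G S)" by (auto simp: defset_def)
  show "{} \<in> defsets A"
    by (rule image_eqI[of _ _ Falsum]) (auto simp: defset_def holds_at_def fmls_def)
  show "univ G S - E \<in> defsets A" if E: "E \<in> defsets A" for E
  proof -
    obtain \<phi> where "E = defset \<phi>" "\<phi> \<in> fmls L {x} A" using E by (rule imageE)
    then show ?thesis by (intro image_eqI[of _ _ "Neg \<phi>"]) (simp_all add: defset_Neg)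
  qed
  show "E \<union> F \<in> defsets A" if E: "E \<in> defsets A" and F: "F \<in> defsets A" for E F
  proof -
    obtain \<phi> where \<phi>: "E = defset \<phi>" "\<phi> \<in> fmls L {x} A" using E by (rule imageE)
    obtain \<psi> where \<psi>: "F = defset \<psi>" "\<psi> \<in> fmls L {x} A" using F by (rule imageE)
    show ?thesis
      using \<phi> \<psi> fmls_Disj[OF \<phi>(2) \<psi>(2)] by (intro image_eqI[of _ _ "Disj \<phi> \<psi>"]) (simp_all only: defset_Disj)
  qed
qed

text \<open>Sending a type to the sets defined by its formulas identifies types over \<open>A\<close> with ultrafilters
  of the algebra of \<open>A\<close>-definable sets.\<close>
lemma stone_space_types: "stone_space (univ G S) (defsets A) (tps A) ((`) defset)"
proof (intro stone_space.intro algebra_defsets stone_space_axioms.intro)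
  interpret algebra "univ G S" "defsets A" by (rule algebra_defsets)
  show "bij_betw ((`) defset) (tps A) {u. set_ultrafilter (univ G S) (defsets A) u}"
    unfolding bij_betw_def
  proof
    show "inj_on ((`) defset) (tps A)"
    proof (rule inj_onI)
      fix p q assume pq: "p \<in> tps A" "q \<in> tps A" "defset ` p = defset ` q"
      have "\<phi> \<in> p \<longleftrightarrow> \<phi> \<in> q" if "\<phi> \<in> fmls L {x} A" for \<phi>
        using defset_mem_type[OF pq(1) that] defset_mem_type[OF pq(2) that] pq(3) by simp
      then show "p = q" using types_sub[OF pq(1)] types_sub[OF pq(2)] by blast
    qed
    show "((`) defset) ` tps A = {u. set_ultrafilter (univ G S) (defsets A) u}"
    proof (intro equalityI subsetI)
      fix u assume "u \<in> ((`) defset) ` tps A"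
      then obtain p where p: "u = defset ` p" "p \<in> tps A" by (rule imageE)
      have "E \<in> u \<or> univ G S - E \<in> u" if E: "E \<in> defsets A" for E
      proof -
        obtain \<phi> where \<phi>: "E = defset \<phi>" "\<phi> \<in> fmls L {x} A" using E by (rule imageE)
        then have "\<phi> \<in> p \<or> Neg \<phi> \<in> p" using p(2) by (simp add: types_def)
        then show ?thesis unfolding \<phi>(1) p(1) defset_Neg[symmetric] by blast
      qed
      moreover have "\<exists>c\<in>univ G S. \<forall>E\<in>\<F>. c \<in> E" if F: "finite \<F>" "\<F> \<subseteq> u" for \<F>
      proof -
        obtain \<Phi> where \<Phi>: "\<Phi> \<subseteq> p" "finite \<Phi>" "\<F> = defset ` \<Phi>"
          using finite_subset_image[OF F(1)] F(2) unfolding p(1) by blast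
        have "\<forall>\<Phi>. finite \<Phi> \<and> \<Phi> \<subseteq> p \<longrightarrow> (\<exists>a\<in>univ G S. \<forall>\<phi>\<in>\<Phi>. holds_at G a \<phi>)"
          using p(2) by (simp add: types_def)
        then obtain a where "a \<in> univ G S" "\<forall>\<phi>\<in>\<Phi>. holds_at G a \<phi>" using \<Phi> by blast
        then show ?thesis unfolding \<Phi>(3) by (intro bexI[of _ a]) (auto simp: defset_def)
      qed
      moreover have "u \<subseteq> defsets A" using p types_sub by blast
      ultimately show "u \<in> {u. set_ultrafilter (univ G S) (defsets A) u}"
        unfolding set_ultrafilter_def by blast
    next
      fix u assume "u \<in> {u. set_ultrafilter (univ G S) (defsets A) u}"
      then have u: "u \<subseteq> defsets A" "\<And>E. E \<in> defsets A \<Longrightarrow> E \<in> u \<or> univ G S - E \<in> u"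
        "\<And>\<F>. finite \<F> \<Longrightarrow> \<F> \<subseteq> u \<Longrightarrow> \<exists>c\<in>univ G S. \<forall>E\<in>\<F>. c \<in> E"
        unfolding set_ultrafilter_def by blast+
      define p where "p = {\<phi> \<in> fmls L {x} A. defset \<phi> \<in> u}"
      have "p \<in> tps A"
        unfolding types_def
      proof (intro CollectI conjI ballI allI impI)
        show "p \<subseteq> fmls L {x} A" by (auto simp: p_def)
        show "\<phi> \<in> p \<or> Neg \<phi> \<in> p" if "\<phi> \<in> fmls L {x} A" for \<phi>
          using u(2)[of "defset \<phi>"] that by (auto simp: p_def defset_Neg)
        show "\<exists>a\<in>univ G S. \<forall>\<phi>\<in>\<Phi>. holds_at G a \<phi>" if "finite \<Phi> \<and> \<Phi> \<subseteq> p" for \<Phi>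
          using u(3)[of "defset ` \<Phi>"] that by (force simp: p_def defset_def)
      qed
      moreover have "defset ` p = u" using u(1) by (auto simp: p_def)
      ultimately show "u \<in> ((`) defset) ` tps A" by blast
    qed
  qed
qed

lemma type_topology_eq: "stone_space.\<tau> (defsets A) (tps A) ((`) defset) = type_topology L G x A"
proof -
  interpret stone_space "univ G S" "defsets A" "tps A" "(`) defset" by (rule stone_space_types)
  have "cl (defset \<phi>) = {p \<in> tps A. \<phi> \<in> p}" if "\<phi> \<in> fmls L {x} A" for \<phi>
    unfolding cl_def by (rule Collect_cong) (use defset_mem_type[OF _ that] in blast)
  then have "cl ` defsets A = {{p \<in> tps A. \<phi> \<in> p} | \<phi>. \<phi> \<in> fmls L {x} A}"
    unfolding image_image by auto
  then show ?thesis unfolding \<tau>_def type_topology_def by simp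
qed

lemma keisler_clauses:
  assumes "\<phi> \<in> fmls L {x} (elems L G)" "\<psi> \<in> fmls L {x} (elems L G)"
  shows "0 \<le> \<mu> \<phi>"
    and "\<forall>a\<in>univ G S. holds_at G a \<phi> \<Longrightarrow> \<mu> \<phi> = 1"
    and "\<forall>a\<in>univ G S. holds_at G a \<phi> \<longleftrightarrow> holds_at G a \<psi> \<Longrightarrow> \<mu> \<phi> = \<mu> \<psi>"
    and "\<forall>a\<in>univ G S. \<not> (holds_at G a \<phi> \<and> holds_at G a \<psi>) \<Longrightarrow> \<mu> (Disj \<phi> \<psi>) = \<mu> \<phi> + \<mu> \<psi>"
  using keisler[unfolded keisler_def] assms by (elim conjE; simp only: Ball_def; blast)+

text \<open>A Keisler measure respects equivalence of formulas and therefore is a function of the definable set.\<close>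
definition mu_of :: "'a set \<Rightarrow> real" where
  "mu_of E = \<mu> (SOME \<phi>. \<phi> \<in> fmls L {x} (elems L G) \<and> defset \<phi> = E)"

lemma mu_of_defset:
  assumes "\<phi> \<in> fmls L {x} (elems L G)"
  shows "mu_of (defset \<phi>) = \<mu> \<phi>"
proof -
  let ?P = "\<lambda>\<psi>. \<psi> \<in> fmls L {x} (elems L G) \<and> defset \<psi> = defset \<phi>"
  have P: "?P (SOME \<psi>. ?P \<psi>)" by (rule someI[of ?P \<phi>]) (use assms in simp)
  then have "\<forall>a\<in>univ G S. holds_at G a (SOME \<psi>. ?P \<psi>) \<longleftrightarrow> holds_at G a \<phi>"
    unfolding defset_def by blast
  from keisler_clauses(3)[OF conjunct1[OF P] assms this]
  show ?thesis unfolding mu_of_def .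
qed

lemma stone_content_types:
  assumes A: "A \<subseteq> elems L G"
  shows "stone_content (univ G S) (defsets A) (tps A) ((`) defset) mu_of"
proof (intro stone_content.intro stone_space_types stone_content_axioms.intro)
  have sub: "\<phi> \<in> fmls L {x} A \<Longrightarrow> \<phi> \<in> fmls L {x} (elems L G)" for \<phi>
    using fmls_mono[OF order_refl A] by blast
  show "0 \<le> mu_of E" if E: "E \<in> defsets A" for E
  proof -
    obtain \<phi> where \<phi>: "E = defset \<phi>" "\<phi> \<in> fmls L {x} A" using E by (rule imageE)
    then show ?thesis using mu_of_defset[OF sub] keisler_clauses(1)[OF sub sub] by simp
  qed
  have Tr: "Neg Falsum \<in> fmls L {x} (elems L G)" by (simp add: fmls_def)
  have "univ G S = defset (Neg Falsum)" by (auto simp: defset_def holds_at_def)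
  moreover have "\<mu> (Neg Falsum) = 1"
    by (rule keisler_clauses(2)[OF Tr Tr]) (simp add: holds_at_def)
  ultimately show "mu_of (univ G S) = 1" using mu_of_defset[OF Tr] by simp
  show "mu_of (E \<union> F) = mu_of E + mu_of F"
    if E: "E \<in> defsets A" and F: "F \<in> defsets A" and EF: "E \<inter> F = {}" for E F
  proof -
    obtain \<phi> where \<phi>: "E = defset \<phi>" "\<phi> \<in> fmls L {x} A" using E by (rule imageE)
    obtain \<psi> where \<psi>: "F = defset \<psi>" "\<psi> \<in> fmls L {x} A" using F by (rule imageE)
    have s: "\<phi> \<in> fmls L {x} (elems L G)" "\<psi> \<in> fmls L {x} (elems L G)" using \<phi> \<psi> sub by auto
    have "\<forall>a\<in>univ G S. \<not> (holds_at G a \<phi> \<and> holds_at G a \<psi>)"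
      using EF unfolding \<phi> \<psi> defset_def by blast
    then have "\<mu> (Disj \<phi> \<psi>) = \<mu> \<phi> + \<mu> \<psi>" by (rule keisler_clauses(4)[OF s])
    then show ?thesis
      unfolding \<phi>(1) \<psi>(1) defset_Disj[symmetric]
      using mu_of_defset s fmls_Disj[OF s] by simp
  qed
qed

lemma supp_eq:
  assumes A: "A \<subseteq> elems L G"
  shows "stone_content.supp (tps A) ((`) defset) mu_of = support L G x A \<mu>"
proof -
  interpret stone_content "univ G S" "defsets A" "tps A" "(`) defset" mu_of
    by (rule stone_content_types[OF A])
  have "(\<forall>E\<in>defset ` p. 0 < mu_of E) \<longleftrightarrow> (\<forall>\<phi>\<in>p. 0 < \<mu> \<phi>)" if p: "p \<in> tps A" for p
  proof -
    have "mu_of (defset \<phi>) = \<mu> \<phi>" if "\<phi> \<in> p" for \<phi>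
      using mu_of_defset types_sub[OF p] fmls_mono[OF order_refl A] that by blast
    then show ?thesis by simp
  qed
  then show ?thesis unfolding supp_def support_def by blast
qed

lemma keisler_borel:
  assumes A: "A \<subseteq> elems L G"
  shows "regular_borel_prob (type_topology L G x A) (keisler_borel L G x A \<mu>)"
    and "E \<in> defsets A \<Longrightarrow>
      measure (keisler_borel L G x A \<mu>) (stone_space.cl (tps A) ((`) defset) E) = mu_of E"
    and "regular_borel_prob (type_topology L G x A) P \<Longrightarrow>
      \<forall>E\<in>defsets A. measure P (stone_space.cl (tps A) ((`) defset) E) = mu_of E \<Longrightarrow>
      keisler_borel L G x A \<mu> = P"
proof -
  interpret stone_content "univ G S" "defsets A" "tps A" "(`) defset" mu_of
    by (rule stone_content_types[OF A])
  have cl: "cl (defset \<phi>) = {p \<in> tps A. \<phi> \<in> p}" if "\<phi> \<in> fmls L {x} A" for \<phi>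
    unfolding cl_def by (rule Collect_cong) (use defset_mem_type[OF _ that] in blast)
  have iff: "(\<forall>\<phi>\<in>fmls L {x} A. measure P {p \<in> tps A. \<phi> \<in> p} = \<mu> \<phi>) \<longleftrightarrow>
      (\<forall>E\<in>defsets A. measure P (cl E) = mu_of E)" for P
  proof -
    have "mu_of (defset \<phi>) = \<mu> \<phi>" if "\<phi> \<in> fmls L {x} A" for \<phi>
      using mu_of_defset fmls_mono[OF order_refl A] that by blast
    then show ?thesis using cl by simp
  qed
  let ?Q = "\<lambda>P. regular_borel_prob (type_topology L G x A) P \<and>
     (\<forall>\<phi>\<in>fmls L {x} A. measure P {p \<in> tps A. \<phi> \<in> p} = \<mu> \<phi>)"
  have Q: "?Q P \<longleftrightarrow> regular_borel_prob \<tau> P \<and> (\<forall>E\<in>defsets A. measure P (cl E) = mu_of E)" for P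
    unfolding iff type_topology_eq ..
  have the: "keisler_borel L G x A \<mu> = P" if P: "?Q P" for P
    unfolding keisler_borel_def
  proof (rule the_equality)
    show "?Q P" by (rule P)
    show "P' = P" if P': "?Q P'" for P'
      using P'[unfolded Q] P[unfolded Q] by (elim conjE) (rule regular_borel_unique)
  qed
  have "\<exists>P. ?Q P" unfolding Q by (rule ex_regular_borel)
  then obtain P0 where P0: "?Q P0" ..
  have kb: "?Q (keisler_borel L G x A \<mu>)" unfolding the[OF P0] by (rule P0)
  then show "regular_borel_prob (type_topology L G x A) (keisler_borel L G x A \<mu>)"
    by (rule conjunct1)
  show "E \<in> defsets A \<Longrightarrow> measure (keisler_borel L G x A \<mu>) (cl E) = mu_of E"
    using kb[unfolded Q] by (elim conjE) (rule bspec)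
  show "keisler_borel L G x A \<mu> = P"
    if "regular_borel_prob (type_topology L G x A) P" "\<forall>E\<in>defsets A. measure P (cl E) = mu_of E"
    by (rule the, unfold iff) (rule conjI[OF that])
qed

abbreviation "\<Gamma> \<equiv> def_group G m (fst x) e"
abbreviation "GG \<equiv> elems L G"

lemma def_group_simps: "carrier \<Gamma> = univ G S" "a \<otimes>\<^bsub>\<Gamma>\<^esub> b = gmul G a b"
  by (simp_all add: def_group_def)

lemma translate_defset:
  assumes "a \<in> univ G S" "\<phi> \<in> fmls L {x} GG"
  shows "ltranslate m x a \<phi> \<in> fmls L {x} GG" "rtranslate m x a \<phi> \<in> fmls L {x} GG"
    "{b \<in> univ G S. gmul G a b \<in> defset \<phi>} = defset (ltranslate m x a \<phi>)"
    "{b \<in> univ G S. gmul G b a \<in> defset \<phi>} = defset (rtranslate m x a \<phi>)"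
proof -
  have "insert (S, a) GG = GG" using assms(1) by (simp add: elems_iff insert_absorb)
  then show "ltranslate m x a \<phi> \<in> fmls L {x} GG" "rtranslate m x a \<phi> \<in> fmls L {x} GG"
    using translate_fmls[OF assms(2), of a] by auto
  show "{b \<in> univ G S. gmul G a b \<in> defset \<phi>} = defset (ltranslate m x a \<phi>)"
    "{b \<in> univ G S. gmul G b a \<in> defset \<phi>} = defset (rtranslate m x a \<phi>)"
    using gmul_closed[OF struct(1)] assms(1) holds_at_translate[OF assms(2)]
    by (auto simp: defset_def)
qed

lemma stable_group_types: "stable_group \<Gamma> (defsets GG) (tps GG) ((`) defset) mu_of"
proof (intro stable_group.intro comm stable_group_axioms.intro)
  show "stone_content (carrier \<Gamma>) (defsets GG) (tps GG) ((`) defset) mu_of"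
    unfolding def_group_simps by (rule stone_content_types) simp
  show "{b \<in> carrier \<Gamma>. a \<otimes>\<^bsub>\<Gamma>\<^esub> b \<in> E} \<in> defsets GG"
    if a: "a \<in> carrier \<Gamma>" and E: "E \<in> defsets GG" for a E
  proof -
    obtain \<phi> where \<phi>: "E = defset \<phi>" "\<phi> \<in> fmls L {x} GG" using E by (rule imageE)
    show ?thesis
      using translate_defset(1,3)[OF _ \<phi>(2), of a] a unfolding def_group_simps \<phi>(1) by simp
  qed
  show "stable_rel (carrier \<Gamma>) (carrier \<Gamma>) (\<lambda>a b. a \<otimes>\<^bsub>\<Gamma>\<^esub> b \<in> E)" if E: "E \<in> defsets GG" for E
  proof -
    obtain \<phi> where \<phi>: "E = defset \<phi>" "\<phi> \<in> fmls L {x} GG" using E by (rule imageE)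
    show ?thesis
      unfolding def_group_simps \<phi>(1)
      by (rule stable_rel_cong[OF stable_rel_gmul[OF \<phi>(2)]])
        (simp add: defset_def gmul_closed[OF struct(1)])
  qed
qed

sublocale SG: stable_group \<Gamma> "defsets GG" "tps GG" "(`) defset" mu_of
  by (rule stable_group_types)

lemma SG_\<tau>: "SG.\<tau> = type_topology L G x GG"
  by (rule type_topology_eq)

lemma SG_supp: "SG.supp = support L G x GG \<mu>"
  by (rule supp_eq) simp

section \<open>Convolution as an integral over global types\<close>

text \<open>The limits over the two types appear in the other order than in \<open>is_prod\<close>, which the double limit
  criterion allows.\<close>
lemma type_prod_is_prod:
  assumes p: "p \<in> tps GG" and q: "q \<in> tps GG"
  shows "SG.is_prod p q (type_prod L \<kappa> G G' m x p q)"
proof -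
  obtain U where U: "ultra U" "\<forall>\<^sub>F a in U. a \<in> univ G S"
    "\<forall>\<phi>\<in>fmls L {x} GG. \<phi> \<in> p \<longleftrightarrow> (\<forall>\<^sub>F a in U. holds_at G a \<phi>)"
    using types_ultra[OF p] by blast
  obtain V where V: "ultra V" "\<forall>\<^sub>F a in V. a \<in> univ G S"
    "\<forall>\<phi>\<in>fmls L {x} GG. \<phi> \<in> q \<longleftrightarrow> (\<forall>\<^sub>F a in V. holds_at G a \<phi>)"
    using types_ultra[OF q] by blast
  have pq: "p = tpU G U" "q = tpU G V"
    using U(3) V(3) types_sub[OF p] types_sub[OF q] unfolding tpU_def by blast+
  let ?r = "type_prod L \<kappa> G G' m x p q"
  have r: "?r \<in> tps GG" "\<And>\<phi>. \<phi> \<in> fmls L {x} GG \<Longrightarrow>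
      \<phi> \<in> ?r \<longleftrightarrow> (\<forall>\<^sub>F b in V. \<forall>\<^sub>F a in U. holds_at G (gmul G a b) \<phi>)"
    unfolding pq using type_prod_mem[OF U(1,2) V(1,2), of "Neg Falsum"]
      type_prod_mem(2)[OF U(1,2) V(1,2)] by (simp_all add: fmls_def)
  have "E \<in> defset ` ?r \<longleftrightarrow> SG.dfn E q \<in> defset ` p" if E: "E \<in> defsets GG" for E
  proof -
    obtain \<phi> where \<phi>: "E = defset \<phi>" "\<phi> \<in> fmls L {x} GG" using E by (rule imageE)
    have "SG.dfn E q \<in> defsets GG" by (rule SG.dfn_mem[OF E q])
    then obtain \<psi> where \<psi>: "SG.dfn E q = defset \<psi>" "\<psi> \<in> fmls L {x} GG" by (rule imageE)
    have "SG.dfn E q \<in> defset ` p \<longleftrightarrow> (\<forall>\<^sub>F a in U. holds_at G a \<psi>)"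
      unfolding \<psi>(1) defset_mem_type[OF p \<psi>(2)] using U(3) \<psi>(2) by blast
    also have "\<dots> \<longleftrightarrow> (\<forall>\<^sub>F a in U. \<forall>\<^sub>F b in V. holds_at G (gmul G a b) \<phi>)"
    proof (rule eventually_subst, rule eventually_mono[OF U(2)])
      fix a assume a: "a \<in> univ G S"
      have "holds_at G a \<psi> \<longleftrightarrow> a \<in> SG.dfn E q" unfolding \<psi>(1) using a by (simp add: defset_def)
      also have "\<dots> \<longleftrightarrow> ltranslate m x a \<phi> \<in> q"
        using a translate_defset(3)[OF a \<phi>(2)] defset_mem_type[OF q translate_defset(1)[OF a \<phi>(2)]]
        unfolding SG.dfn_def SG.shift_def def_group_simps \<phi>(1) by simp
      also have "\<dots> \<longleftrightarrow> (\<forall>\<^sub>F b in V. holds_at G (gmul G a b) \<phi>)"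
        using V(3) translate_defset(1)[OF a \<phi>(2)] by (simp add: holds_at_translate[OF \<phi>(2)])
      finally show "holds_at G a \<psi> \<longleftrightarrow> (\<forall>\<^sub>F b in V. holds_at G (gmul G a b) \<phi>)" .
    qed
    also have "\<dots> \<longleftrightarrow> (\<forall>\<^sub>F b in V. \<forall>\<^sub>F a in U. holds_at G (gmul G a b) \<phi>)"
      by (rule double_limit[OF stable_rel_gmul[OF \<phi>(2)] U(1) V(1) U(2) V(2)])
    finally show ?thesis
      unfolding \<phi>(1) defset_mem_type[OF r(1) \<phi>(2)] using r(2)[OF \<phi>(2)] by blast
  qed
  then show ?thesis unfolding SG.is_prod_def using r(1) by blast
qed

text \<open>It suffices that \<open>d\<close> also agrees with \<open>Q\<close> on the finitely many translates of \<open>\<phi>\<close> provided by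
  \<open>dfn_approx\<close>: the set \<open>dfn (defset \<phi>)\<close> of the type of \<open>d\<close> is the right translate of \<open>\<phi>\<close> by \<open>d\<close>.\<close>
lemma ex_realization:
  assumes Q: "Q \<in> tps GG" and \<phi>: "\<phi> \<in> fmls L {x} GG" and A: "A \<subseteq> GG" "small \<kappa> A" and e: "\<epsilon> > 0"
  shows "\<exists>d. realizes G x d (Q \<inter> fmls L {x} A) \<and>
    \<bar>\<mu> (rtranslate m x d \<phi>) - mu_of (SG.dfn (defset \<phi>) Q)\<bar> \<le> \<epsilon>"
proof -
  let ?E = "defset \<phi>"
  have E: "?E \<in> defsets GG" using \<phi> by blast
  obtain A0 where A0: "A0 \<subseteq> univ G S" "finite A0" and ap: "\<forall>p\<in>tps GG. \<forall>q\<in>tps GG.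
      (\<forall>a\<in>A0. a \<in> SG.dfn ?E p \<longleftrightarrow> a \<in> SG.dfn ?E q) \<longrightarrow>
      mu_of (sym_diff_set (SG.dfn ?E p) (SG.dfn ?E q)) \<le> \<epsilon>"
    using SG.dfn_approx[OF E e] unfolding def_group_simps by blast
  define B where "B = A \<union> (pars \<phi> \<union> Pair S ` A0)"
  have B: "B \<subseteq> GG" using A(1) A0(1) \<phi> x by (auto simp: B_def elems_def fmls_def)
  have "small \<kappa> B"
    unfolding B_def by (rule small_Un[OF A(2) small_finite]) (use A0(2) finite_fm(2)[of \<phi>] in simp)
  moreover have t: "Q \<inter> fmls L {x} B \<in> types L G x B" by (rule types_restrict[OF Q B])
  ultimately obtain d where d: "realizes G x d (Q \<inter> fmls L {x} B)"
    using G B x unfolding monster_def by metis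
  have dS: "d \<in> univ G S" using d by (simp add: realizes_def)
  let ?d = "tp L G x d GG"
  have dt: "?d \<in> tps GG" by (rule tp_types[OF dS])
  have dfn_d: "a \<in> SG.dfn ?E ?d \<longleftrightarrow> a \<in> defset (rtranslate m x d \<phi>)" if a: "a \<in> univ G S" for a
  proof -
    have "a \<in> SG.dfn ?E ?d \<longleftrightarrow> ltranslate m x a \<phi> \<in> ?d"
      using a translate_defset(3)[OF a \<phi>] defset_mem_type[OF dt translate_defset(1)[OF a \<phi>]]
      unfolding SG.dfn_def SG.shift_def def_group_simps by simp
    also have "\<dots> \<longleftrightarrow> holds_at G (gmul G a d) \<phi>"
      using translate_defset(1)[OF a \<phi>] by (simp add: tp_def holds_at_translate[OF \<phi>])
    finally show ?thesis using a by (simp add: defset_def holds_at_translate[OF \<phi>])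
  qed
  have dfn_eq: "SG.dfn ?E ?d = defset (rtranslate m x d \<phi>)"
    using dfn_d unfolding SG.dfn_def defset_def def_group_simps by blast
  have "a \<in> SG.dfn ?E ?d \<longleftrightarrow> a \<in> SG.dfn ?E Q" if a: "a \<in> A0" for a
  proof -
    have aS: "a \<in> univ G S" using a A0 by blast
    have "pars \<phi> \<subseteq> B" "insert (S, a) B = B" using a by (auto simp: B_def)
    then have "\<phi> \<in> fmls L {x} B" "insert (S, a) B = B" using \<phi> by (auto simp: fmls_def)
    then have lB: "ltranslate m x a \<phi> \<in> fmls L {x} B" using translate_fmls(2)[of \<phi> B a] by simp
    have "a \<in> SG.dfn ?E Q \<longleftrightarrow> ltranslate m x a \<phi> \<in> Q"
      using aS translate_defset(3)[OF aS \<phi>] defset_mem_type[OF Q translate_defset(1)[OF aS \<phi>]]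
      unfolding SG.dfn_def SG.shift_def def_group_simps by simp
    also have "\<dots> \<longleftrightarrow> holds_at G d (ltranslate m x a \<phi>)"
      using realizes_iff[OF t d lB] lB by blast
    also have "\<dots> \<longleftrightarrow> a \<in> SG.dfn ?E ?d"
      using dfn_d[OF aS] aS by (simp add: defset_def holds_at_translate[OF \<phi>])
    finally show ?thesis by blast
  qed
  then have "mu_of (sym_diff_set (SG.dfn ?E ?d) (SG.dfn ?E Q)) \<le> \<epsilon>" using ap dt Q by blast
  then have "\<bar>mu_of (SG.dfn ?E ?d) - mu_of (SG.dfn ?E Q)\<bar> \<le> \<epsilon>"
    using SG.abs_m_diff_le[OF SG.dfn_mem[OF E dt] SG.dfn_mem[OF E Q]] by linarith
  moreover have "mu_of (SG.dfn ?E ?d) = \<mu> (rtranslate m x d \<phi>)"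
    unfolding dfn_eq by (rule mu_of_defset[OF translate_defset(2)[OF dS \<phi>]])
  moreover have "realizes G x d (Q \<inter> fmls L {x} A)"
    using d fmls_mono[OF order_refl, of A B L "{x}"] by (auto simp: realizes_def B_def)
  ultimately show ?thesis by auto
qed

text \<open>By the choice of \<open>N\<close> the value of the convolution function does not depend on the realization, so
  realizations as in \<open>ex_realization\<close> may be used, for every \<open>\<epsilon>\<close>.\<close>
lemma conv_fun_eq:
  assumes Q: "Q \<in> support L G x GG \<mu>" and \<phi>: "\<phi> \<in> fmls L {x} GG"
    and N: "conv_model L \<kappa> G m x \<mu> \<mu> \<phi> N"
  shows "Q \<inter> fmls L {x} (elems L N) \<in> support L G x (elems L N) \<mu>"
    and "conv_fun G m x \<mu> \<phi> (Q \<inter> fmls L {x} (elems L N)) = mu_of (SG.dfn (defset \<phi>) Q)"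
proof -
  let ?A = "elems L N" and ?q = "Q \<inter> fmls L {x} (elems L N)"
  have NG: "elem_sub L N G" "small \<kappa> ?A" using N by (simp_all add: conv_model_def)
  have A: "?A \<subseteq> GG" by (rule elem_sub_elems[OF NG(1)])
  have Qt: "Q \<in> tps GG" using Q by (simp add: support_def)
  show q: "?q \<in> support L G x ?A \<mu>"
    using types_restrict[OF Qt A] Q by (auto simp: support_def)
  have le: "\<bar>conv_fun G m x \<mu> \<phi> ?q - mu_of (SG.dfn (defset \<phi>) Q)\<bar> \<le> \<epsilon>" if e: "\<epsilon> > 0" for \<epsilon>
  proof -
    obtain d where d: "realizes G x d ?q"
      "\<bar>\<mu> (rtranslate m x d \<phi>) - mu_of (SG.dfn (defset \<phi>) Q)\<bar> \<le> \<epsilon>"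
      using ex_realization[OF Qt \<phi> A NG(2) e] by blast
    have "realizes G x (SOME d. realizes G x d ?q) ?q" using d(1) by (rule someI)
    then have "conv_fun G m x \<mu> \<phi> ?q = \<mu> (rtranslate m x d \<phi>)"
      using N q d(1) unfolding conv_model_def conv_fun_def by blast
    then show ?thesis using d(2) by simp
  qed
  have "\<bar>conv_fun G m x \<mu> \<phi> ?q - mu_of (SG.dfn (defset \<phi>) Q)\<bar> \<le> 0"
    by (rule field_le_epsilon, unfold add_0, rule le)
  then show "conv_fun G m x \<mu> \<phi> ?q = mu_of (SG.dfn (defset \<phi>) Q)" by simp
qed

abbreviation "PG \<equiv> keisler_borel L G x GG \<mu>"

text \<open>Restriction of types is continuous and carries the regular Borel measure of \<open>\<mu>\<close> on global types to
  the one on types over \<open>N\<close>, by uniqueness of the latter.  On the support the two integrands agree.\<close>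
lemma conv_eq_integral:
  assumes \<phi>: "\<phi> \<in> fmls L {x} GG" and star: "star_borel L \<kappa> G m x \<mu> \<mu>"
  shows "conv L \<kappa> G m x \<mu> \<mu> \<phi> = (LINT Q|PG. mu_of (SG.dfn (defset \<phi>) Q))"
proof -
  define N where "N = (SOME N. conv_model L \<kappa> G m x \<mu> \<mu> \<phi> N)"
  have N: "conv_model L \<kappa> G m x \<mu> \<mu> \<phi> N"
    unfolding N_def using star \<phi> unfolding star_borel_def by (metis someI)
  let ?A = "elems L N"
  have NG: "elem_sub L N G" using N by (simp add: conv_model_def)
  have A: "?A \<subseteq> GG" by (rule elem_sub_elems[OF NG])
  let ?S = "support L G x ?A \<mu>" and ?T = "type_topology L G x ?A" and ?F = "conv_fun G m x \<mu> \<phi>"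
  interpret N: stone_content "univ G S" "defsets ?A" "tps ?A" "(`) defset" mu_of
    by (rule stone_content_types[OF A])
  have Nt: "N.\<tau> = ?T" by (rule type_topology_eq)
  have Ns: "N.supp = ?S" by (rule supp_eq[OF A])
  define res where "res Q = Q \<inter> fmls L {x} ?A" for Q :: "('s, 'f, 'r, 'a) form set"
  have res: "res Q \<in> tps ?A" if "Q \<in> tps GG" for Q unfolding res_def by (rule types_restrict[OF that A])
  have sub: "\<psi> \<in> fmls L {x} ?A \<Longrightarrow> \<psi> \<in> fmls L {x} GG" for \<psi>
    using fmls_mono[OF order_refl A] by blast
  have res_cl: "{Q \<in> tps GG. res Q \<in> N.cl E} = SG.cl E" "E \<in> defsets GG" if E: "E \<in> defsets ?A" for E
  proof -
    obtain \<psi> where \<psi>: "E = defset \<psi>" "\<psi> \<in> fmls L {x} ?A" using E by (rule imageE)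
    have "E \<in> defset ` res Q \<longleftrightarrow> E \<in> defset ` Q" if "Q \<in> tps GG" for Q
      unfolding \<psi>(1) defset_mem_type[OF res[OF that] \<psi>(2)] defset_mem_type[OF that sub[OF \<psi>(2)]]
      using \<psi>(2) by (simp add: res_def)
    then show "{Q \<in> tps GG. res Q \<in> N.cl E} = SG.cl E"
      unfolding N.cl_def SG.cl_def using res by blast
    show "E \<in> defsets GG" using \<psi> sub by blast
  qed
  have cont: "continuous_map SG.\<tau> N.\<tau> res"
  proof (rule N.continuous_map_\<tau>)
    show "openin SG.\<tau> (res -` V \<inter> topspace SG.\<tau>)" if V: "V \<in> N.cl ` defsets ?A" for V
    proof -
      obtain E where E: "V = N.cl E" "E \<in> defsets ?A" using V by (rule imageE)
      have "res -` V \<inter> topspace SG.\<tau> = SG.cl E" using res_cl(1)[OF E(2)] E(1) by auto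
      then show ?thesis using SG.openin_cl[OF res_cl(2)[OF E(2)]] by simp
    qed
    have "tps ?A \<subseteq> \<Union> (N.cl ` defsets ?A)" using Union_upper[OF imageI[OF N.top, of N.cl]] by simp
    moreover have "res ` topspace SG.\<tau> \<subseteq> tps ?A" using res by auto
    ultimately show "res ` topspace SG.\<tau> \<subseteq> \<Union> (N.cl ` defsets ?A)" by (rule order_trans[rotated])
  qed
  have PG: "regular_borel_prob SG.\<tau> PG" "\<And>E. E \<in> defsets GG \<Longrightarrow> measure PG (SG.cl E) = mu_of E"
    using keisler_borel(1,2)[OF order_refl] unfolding SG_\<tau> by auto
  note distr = regular_borel_distr[OF PG(1) N.Hausdorff_space_\<tau> cont]
  have spPG: "space PG = tps GG" using PG(1) by (simp add: regular_borel_prob_def)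
  have PN: "keisler_borel L G x ?A \<mu> = distr PG (borel_of_top N.\<tau>) res"
  proof (rule keisler_borel(3)[OF A])
    show "regular_borel_prob ?T (distr PG (borel_of_top N.\<tau>) res)" using distr(2) Nt by simp
    show "\<forall>E\<in>defsets ?A. measure (distr PG (borel_of_top N.\<tau>) res) (N.cl E) = mu_of E"
    proof
      fix E assume E: "E \<in> defsets ?A"
      have "measure (distr PG (borel_of_top N.\<tau>) res) (N.cl E) = measure PG (res -` N.cl E \<inter> space PG)"
        by (rule measure_distr[OF distr(1) openin_borel_of_top[OF N.openin_cl[OF E]]])
      also have "res -` N.cl E \<inter> space PG = SG.cl E" using res_cl(1)[OF E] spPG by auto
      finally show "measure (distr PG (borel_of_top N.\<tau>) res) (N.cl E) = mu_of E"
        using PG(2)[OF res_cl(2)[OF E]] by simp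
    qed
  qed
  have Sm: "?S \<in> sets (borel_of_top N.\<tau>)"
    using closedin_borel_of_top[OF N.closedin_supp] unfolding Ns .
  let ?PN = "distr PG (borel_of_top N.\<tau>) res"
  have "sets (borel_of_top (subtopology ?T ?S)) \<subseteq> sets (restrict_space ?PN ?S)"
    unfolding sets_borel_of_top
  proof -
    have "topspace (subtopology ?T ?S) = space (restrict_space ?PN ?S)"
      by (simp add: space_restrict_space Nt Int_commute)
    moreover have "{V. openin (subtopology ?T ?S) V} \<subseteq> sets (restrict_space ?PN ?S)"
      using openin_borel_of_top by (auto simp: openin_subtopology sets_restrict_space Nt)
    ultimately show "sigma_sets (topspace (subtopology ?T ?S)) {V. openin (subtopology ?T ?S) V}
        \<subseteq> sets (restrict_space ?PN ?S)"
      using sets.sigma_sets_subset by metis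
  qed
  moreover have "space (borel_of_top (subtopology ?T ?S)) = space (restrict_space ?PN ?S)"
    by (simp add: space_restrict_space Nt Int_commute)
  moreover have "?F \<in> borel_measurable (borel_of_top (subtopology ?T ?S))"
    using N by (simp add: conv_model_def)
  ultimately have Fr: "?F \<in> borel_measurable (restrict_space ?PN ?S)"
    by (auto simp: measurable_def)
  have SPN: "?S \<inter> space ?PN \<in> sets ?PN" using Sm by (intro sets.Int sets.top) simp
  have Fm: "(\<lambda>q. indicator ?S q *\<^sub>R ?F q) \<in> borel_measurable ?PN"
    by (rule borel_measurable_restrict_space_iff[THEN iffD1, OF SPN Fr])
  have "conv L \<kappa> G m x \<mu> \<mu> \<phi> = integral\<^sup>L (restrict_space ?PN ?S) ?F"
    by (simp add: conv_def Let_def N_def[symmetric] PN)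
  also have "\<dots> = (LINT q|?PN. indicator ?S q *\<^sub>R ?F q)"
    by (rule integral_restrict_space[OF SPN])
  also have "\<dots> = (LINT Q|PG. indicator ?S (res Q) *\<^sub>R ?F (res Q))"
    using Fm by (intro integral_distr[OF distr(1)]) simp
  also have "\<dots> = (LINT Q|PG. mu_of (SG.dfn (defset \<phi>) Q))"
  proof (rule integral_cong_AE)
    show "(\<lambda>Q. indicator ?S (res Q) *\<^sub>R ?F (res Q)) \<in> borel_measurable PG"
      using measurable_compose[OF distr(1), of "\<lambda>q. indicator ?S q *\<^sub>R ?F q" borel] Fm by simp
    have "defset \<phi> \<in> defsets GG" using \<phi> by blast
    then have "(\<lambda>Q. mu_of (SG.dfn (defset \<phi>) Q)) \<in> borel_measurable (borel_of_top SG.\<tau>)"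
      by (intro SG.continuous_map_measurable SG.continuous_m_dfn)
    then show "(\<lambda>Q. mu_of (SG.dfn (defset \<phi>) Q)) \<in> borel_measurable PG"
      using PG(1) by (simp add: regular_borel_prob_def cong: measurable_cong_sets)
    have "AE Q in PG. Q \<in> SG.supp" using SG.AE_supp[OF PG(1)] PG(2) by blast
    then show "AE Q in PG. indicator ?S (res Q) *\<^sub>R ?F (res Q) = mu_of (SG.dfn (defset \<phi>) Q)"
    proof eventually_elim
      case (elim Q)
      then have "Q \<in> support L G x GG \<mu>" by (simp add: SG_supp)
      from conv_fun_eq[OF this \<phi> N] show ?case by (simp add: res_def)
    qed
  qed
  finally show ?thesis .
qed

lemma support_compact_group:
  assumes idem: "idempotent_measure L \<kappa> G m x \<mu>"
  shows "\<exists>u. let S = support L G x (elems L G) \<mu>;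
                 X = subtopology (type_topology L G x (elems L G)) S;
                 H = \<lparr>carrier = S, monoid.mult = type_prod L \<kappa> G G' m x, one = u\<rparr>
             in comm_group H \<and> topological_group H X \<and> compact_space X \<and> Hausdorff_space X"
proof -
  have PG: "regular_borel_prob SG.\<tau> PG" "\<And>E. E \<in> defsets GG \<Longrightarrow> measure PG (SG.cl E) = mu_of E"
    using keisler_borel(1,2)[OF order_refl] unfolding SG_\<tau> by auto
  interpret I: idempotent_stable_group \<Gamma> "defsets GG" "tps GG" "(`) defset" mu_of PG
  proof (intro idempotent_stable_group.intro stable_group_types idempotent_stable_group_axioms.intro PG)
    fix E assume "E \<in> defsets GG"
    then obtain \<phi> where \<phi>: "E = defset \<phi>" "\<phi> \<in> fmls L {x} GG" by (rule imageE)
    have "(LINT Q|PG. mu_of (SG.dfn (defset \<phi>) Q)) = \<mu> \<phi>"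
      using idem conv_eq_integral[OF \<phi>(2)] \<phi>(2) unfolding idempotent_measure_def by metis
    then show "(LINT p|PG. mu_of (SG.dfn E p)) = mu_of E"
      unfolding \<phi>(1) mu_of_defset[OF \<phi>(2)] .
  qed
  have "\<exists>u. let H = \<lparr>carrier = SG.supp, monoid.mult = type_prod L \<kappa> G G' m x, one = u\<rparr>;
      T = subtopology SG.\<tau> SG.supp
      in comm_group H \<and> topological_group H T \<and> compact_space T \<and> Hausdorff_space T"
    by (rule I.supp_compact_group) (use type_prod_is_prod I.supp_X in blast)
  then show ?thesis unfolding SG_\<tau> SG_supp Let_def .
qed

end

theorem corollary4p18:
  fixes L :: "('s, 'f, 'r) lang"
    and T :: "('s, 'f, 'r, 'a) form set"
    and G G' :: "('s, 'f, 'r, 'a) fo_struct"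
    and \<kappa> :: "'k rel" and \<kappa>' :: "'l rel"
    and m :: 'f and x :: "'s var" and e :: 'a
    and \<mu> :: "('s, 'f, 'r, 'a) form \<Rightarrow> real"
  assumes "wf_lang L" and "fst x \<in> sorts L"
    and "m \<in> funs L" and "fdom L m = [fst x, fst x]" and "fcod L m = fst x"
    and "is_theory L T" and "model_of L T G"
    and "monster L \<kappa> G"
    and "monster L \<kappa>' G'" and "elem_sub L G G'" and "small \<kappa>' (elems L G)"
    and "stable_theory L T"
    and "comm_group (def_group G m (fst x) e)"
    and "keisler L G x (elems L G) \<mu>"
    and "idempotent_measure L \<kappa> G m x \<mu>"
  shows "\<exists>u. let S = support L G x (elems L G) \<mu>;
                 X = subtopology (type_topology L G x (elems L G)) S;
                 H = \<lparr>carrier = S, monoid.mult = type_prod L \<kappa> G G' m x, one = u\<rparr>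
             in comm_group H \<and> topological_group H X \<and> compact_space X \<and> Hausdorff_space X"
proof -
  interpret stable_keisler L T G G' \<kappa> \<kappa>' m x e \<mu>
    by (intro stable_keisler.intro stable_monster.intro stable_keisler_axioms.intro assms)
  show ?thesis by (rule support_compact_group[OF assms(15)])
qed

end
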